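(* Let $n\ge 1$, let $\Omega\subset\mathbb{R}$ be a bounded closed interval, and let $M:\Omega\times\mathbb{R}_+\to\mathbb{R}$ be a function such that $(x,y)\mapsto M(x,\sqrt{y})$ belongs to $C^{2}(\Omega\times\mathbb{R}_{+})$ and such that the symmetric matrix $$\begin{pmatrix} M_{xx}+\frac{M_{y}}{y} & M_{xy}\\ M_{xy} & M_{yy}\end{pmatrix}$$ is negative semidefinite at every point $(x,y)$ with $x\in\Omega$, $y>0$. Let $R>0$ and let $d\mu=e^{-U(x)}dx$ be a probability measure on $\mathbb{R}^n$ such that $U$ is smooth and $\mathrm{Hess}\,U(x)\geq R\cdot Id$ for all $x\in\mathbb{R}^n$. Then for every $g\in C^{\infty}(\mathbb{R}^{n};\Omega)$, $$\int_{\mathbb{R}^{n}} M\left(g,\frac{\|\nabla g\|}{\sqrt{R}}\right)d\mu\;\leq\; M\left(\int_{\mathbb{R}^{n}} g\,d\mu,\,0\right).$$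
   Context: $\mathbb{R}_+=\{x\in\mathbb{R}: x\ge 0\}$. $C^{\infty}(\mathbb{R}^{n};\Omega)$ is the set of smooth functions on $\mathbb{R}^n$ with values in $\Omega$. $C^2(\Omega\times\mathbb{R}_+)$ means twice continuously differentiable up to the boundary. Subscripts denote partial derivatives of $M=M(x,y)$, $\|\nabla g\|$ is the Euclidean norm of the gradient, and $\mathrm{Hess}\,U\ge R\cdot Id$ is the inequality of symmetric matrices. *)

theory Defs
  imports "HOL-Probability.Probability"
begin

text \<open>
  Functions of class C^k on a set, up to the boundary: derivatives are taken relative to the set,
  so at a boundary point they are one-sided. The set is meant to be one on which such derivatives
  are unique, such as the whole space or a convex set with nonempty interior; there,
  \<^term>\<open>frechet_derivative f (at x within S)\<close> is the derivative and not an arbitrary choice.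
\<close>
primrec C_k_on :: "nat \<Rightarrow> 'a::euclidean_space set \<Rightarrow> ('a \<Rightarrow> real) \<Rightarrow> bool" where
  "C_k_on 0 S f \<longleftrightarrow> continuous_on S f"
| "C_k_on (Suc k) S f \<longleftrightarrow>
     f differentiable_on S \<and> (\<forall>v. C_k_on k S (\<lambda>x. frechet_derivative f (at x within S) v))"

definition smooth :: "('a::euclidean_space \<Rightarrow> real) \<Rightarrow> bool" where
  "smooth f \<longleftrightarrow> (\<forall>k. C_k_on k UNIV f)"

definition partial :: "'n \<Rightarrow> (real^'n \<Rightarrow> real) \<Rightarrow> real^'n \<Rightarrow> real" where
  "partial i f x = frechet_derivative f (at x) (axis i 1)"

definition grad :: "(real^'n \<Rightarrow> real) \<Rightarrow> real^'n \<Rightarrow> real^'n" where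
  "grad f x = (\<chi> i. partial i f x)"

definition Hess :: "(real^'n \<Rightarrow> real) \<Rightarrow> real^'n \<Rightarrow> real^'n^'n" where
  "Hess f x = (\<chi> i j. partial i (partial j f) x)"

definition pos_semidef :: "real^'n^'n \<Rightarrow> bool" where
  "pos_semidef A \<longleftrightarrow> transpose A = A \<and> (\<forall>v. 0 \<le> v \<bullet> (A *v v))"

definition neg_semidef :: "real^'n^'n \<Rightarrow> bool" where
  "neg_semidef A \<longleftrightarrow> transpose A = A \<and> (\<forall>v. v \<bullet> (A *v v) \<le> 0)"

text \<open>
  Partial derivatives of a function M(x,y) with x in an interval \<open>I\<close>; the x-derivative is
  one-sided at the end points of \<open>I\<close>. The y-derivative is used only for y > 0.
\<close>
definition Dx :: "real set \<Rightarrow> (real \<Rightarrow> real \<Rightarrow> real) \<Rightarrow> real \<Rightarrow> real \<Rightarrow> real" where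
  "Dx I M x y = vector_derivative (\<lambda>t. M t y) (at x within I)"

definition Dy :: "(real \<Rightarrow> real \<Rightarrow> real) \<Rightarrow> real \<Rightarrow> real \<Rightarrow> real" where
  "Dy M x y = deriv (\<lambda>t. M x t) y"

definition M_matrix :: "real set \<Rightarrow> (real \<Rightarrow> real \<Rightarrow> real) \<Rightarrow> real \<Rightarrow> real \<Rightarrow> real^2^2" where
  "M_matrix I M x y = vector
     [vector [Dx I (Dx I M) x y + Dy M x y / y, Dy (Dx I M) x y],
      vector [Dy (Dx I M) x y,                  Dy (Dy M) x y]]"

text \<open>
  The Lebesgue integral of a real function with values in the extended reals, so that an integral
  equal to minus infinity is not replaced by the default value 0 of the Bochner integral. As
  \<open>ennreal\<close> sends negative numbers to 0, the two terms are the integrals of the positive and the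
  negative part. Since \<open>\<infinity> - \<infinity> = \<infinity>\<close> in \<^typ>\<open>ereal\<close>, a finite upper bound on this integral
  includes the assertion that the positive part has a finite integral.
\<close>
definition ext_integral :: "'a measure \<Rightarrow> ('a \<Rightarrow> real) \<Rightarrow> ereal" where
  "ext_integral \<mu> f =
     enn2ereal (\<integral>\<^sup>+ x. ennreal (f x) \<partial>\<mu>) - enn2ereal (\<integral>\<^sup>+ x. ennreal (- f x) \<partial>\<mu>)"

lemma ext_integral_eq_integral:
  assumes "integrable \<mu> f"
  shows "ext_integral \<mu> f = ereal (\<integral>x. f x \<partial>\<mu>)"
proof -
  obtain p where p: "(\<integral>\<^sup>+ x. ennreal (f x) \<partial>\<mu>) = ennreal p" "p \<ge> 0"
    using assms unfolding real_integrable_def by (metis ennreal_cases infinity_ennreal_def)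
  obtain q where q: "(\<integral>\<^sup>+ x. ennreal (- f x) \<partial>\<mu>) = ennreal q" "q \<ge> 0"
    using assms unfolding real_integrable_def by (metis ennreal_cases infinity_ennreal_def)
  show ?thesis
    using p q by (simp add: ext_integral_def real_lebesgue_integral_def[OF assms] enn2ereal_ennreal)
qed

end

theory Submission
  imports Defs "HOL-Real_Asymp.Real_Asymp"
begin

text \<open>
  Write \<open>N (x, w) = M x (sqrt w)\<close>. The semigroup of the generator \<open>\<Delta> - \<nabla>U \<cdot> \<nabla>\<close> is replaced by the
  explicit Markov chain \<open>Q f x = E f (S x + sqrt (2 h) \<xi>)\<close> with \<open>\<xi>\<close> standard Gaussian and \<open>S\<close> the inverse
  of \<open>x + h \<nabla>U x\<close>, a contraction with factor \<open>1 / (1 + h R)\<close> because \<open>Hess U \<ge> R\<close>.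
  The matrix condition gives \<open>E N (f, (\<alpha> + 2 h) |\<nabla>f|\<^sup>2) \<le> N (E f, \<alpha> |E \<nabla>f|\<^sup>2)\<close> for the Gaussian average, and
  the contraction increases the weight \<open>\<alpha>\<close> by the factor \<open>(1 + h R)\<^sup>2\<close>. Hence
  \<open>Q (N (f, \<beta> |\<nabla>f|\<^sup>2)) \<le> N (Q f, \<beta> |\<nabla>Q f|\<^sup>2)\<close> at the fixed point \<open>\<beta>\<close>, which tends to \<open>1 / R\<close> as \<open>h \<rightarrow> 0\<close>.
  The measure \<open>\<mu>\<close> is invariant under \<open>Q\<close> up to \<open>o(h)\<close> times the Lipschitz constant of the test function;
  as \<open>Q\<close> contracts Lipschitz constants, the total error after arbitrarily many steps is \<open>o(1)\<close>,
  while \<open>Q\<^sup>k g\<close> becomes constant. This settles functions \<open>g\<close> that are constant at infinity. For general \<open>g\<close> a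
  truncation of \<open>g\<close> could make the left-hand side uncontrollable, so the measure is truncated
  instead: adding multiples of a convex penalty to \<open>U\<close> conditions \<open>\<mu>\<close> on a ball and preserves
  \<open>Hess U \<ge> R\<close>.
\<close>

section \<open>Functions of two variables satisfying the matrix condition\<close>

text \<open>The variable \<open>w = y\<^sup>2\<close> suits the hypothesis, which makes
  \<open>N\<close> regular up to \<open>w = 0\<close>, and squared lengths add over coordinates: the
  Gaussian inequality can be proved one coordinate at a time, and one coordinate is a limit of fair
  coin flips. For a flip of size \<open>d\<close> the entry \<open>M_y / y\<close> of the matrix
  pays for the weight \<open>d\<^sup>2\<close> that the flip moves. The drift step is implicit
  because \<open>Hess U\<close> may be unbounded above: the explicit map
  \<open>x - h \<nabla>U x\<close> need not be a contraction for any \<open>h\<close>. The fixed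
  point solves \<open>\<beta> = \<alpha> + 2 h = \<alpha> (1 + h R)\<^sup>2\<close>, which gives
  \<open>\<alpha> = 1 / (R + h R\<^sup>2 / 2)\<close>. The obstacle is uniformity of the invariance
  error: of an iterated test function only the Lipschitz constant is controlled. Every estimate
  therefore puts second derivatives on the density or on the Gaussian, never on the test function.
  The number of steps goes to infinity for fixed \<open>h\<close>, and only then \<open>h\<close>
  goes to 0, so no continuous-time semigroup has to be constructed.\<close>

lemma has_derivative_along_curve:
  fixes f A B :: "real \<times> real \<Rightarrow> real" and X :: "real \<Rightarrow> real \<times> real"
  assumes f: "\<And>p. p \<in> S \<Longrightarrow> (f has_derivative (\<lambda>v. fst v * A p + snd v * B p)) (at p within S)"
    and X: "(X has_derivative (\<lambda>h. (P h, Q h))) (at r within T)" and XS: "X ` T \<subseteq> S" and r: "r \<in> T"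
  shows "((\<lambda>r. f (X r)) has_derivative (\<lambda>h. P h * A (X r) + Q h * B (X r))) (at r within T)"
proof -
  have "(f has_derivative (\<lambda>v. fst v * A (X r) + snd v * B (X r))) (at (X r) within X ` T)"
    using f[of "X r"] XS r by (blast intro: has_derivative_subset)
  from has_derivative_in_compose[OF X this] show ?thesis by simp
qed

text \<open>The mean value theorem in \<open>x\<close> for the difference of two horizontal slices,
  then in \<open>y\<close> for \<open>Nx\<close>. Derivatives are relative to \<open>S\<close>, so
  the rectangle may touch the boundary.\<close>

lemma mixed_difference:
  fixes N :: "real \<times> real \<Rightarrow> real"
  assumes "s > 0" "t > 0" and sub: "{x..x+s} \<times> {y..y+t} \<subseteq> S"
    and dN: "\<And>p. p \<in> S \<Longrightarrow> (N has_derivative (\<lambda>v. fst v * Nx p + snd v * Ny p)) (at p within S)"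
    and dNx: "\<And>p. p \<in> S \<Longrightarrow> (Nx has_derivative (\<lambda>v. fst v * Nxx p + snd v * Nxy p)) (at p within S)"
  obtains \<xi> \<eta> where "\<xi> \<in> {x..x+s}" "\<eta> \<in> {y..y+t}"
    "N (x+s, y+t) - N (x+s, y) - N (x, y+t) + N (x, y) = s * t * Nxy (\<xi>, \<eta>)"
proof -
  have 1: "((\<lambda>r. N (r, z)) has_derivative (\<lambda>h. h * Nx (r, z))) (at r within {x..x+s})"
    if "r \<in> {x..x+s}" "z \<in> {y..y+t}" for r z
  proof -
    have "((\<lambda>r. N (r, z)) has_derivative (\<lambda>h. h * Nx (r, z) + 0 * Ny (r,z))) (at r within {x..x+s})"
      by (rule has_derivative_along_curve[where X = "\<lambda>r. (r, z)", OF dN])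
        (use that sub in \<open>auto intro!: derivative_eq_intros\<close>)
    then show ?thesis by simp
  qed
  have 2: "((\<lambda>r. Nx (z, r)) has_derivative (\<lambda>h. h * Nxy (z, r))) (at r within {y..y+t})"
    if "r \<in> {y..y+t}" "z \<in> {x..x+s}" for r z
  proof -
    have "((\<lambda>r. Nx (z, r)) has_derivative (\<lambda>h. 0 * Nxx (z, r) + h * Nxy (z,r))) (at r within {y..y+t})"
      by (rule has_derivative_along_curve[where X = "\<lambda>r. (z, r)", OF dNx])
        (use that sub in \<open>auto intro!: derivative_eq_intros\<close>)
    then show ?thesis by simp
  qed
  have "\<exists>\<xi>\<in>{x<..<x+s}. (N (x+s, y+t) - N (x+s, y)) - (N (x, y+t) - N (x, y)) =
      (x + s - x) * (Nx (\<xi>, y+t) - Nx (\<xi>, y))"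
  proof (rule mvt_simple)
    show "x < x + s" using assms by simp
    fix r assume "x \<le> r" "r \<le> x + s"
    then show "((\<lambda>r. N (r, y+t) - N (r, y)) has_derivative (\<lambda>h. h * (Nx (r, y+t) - Nx (r, y)))) (at r within {x..x+s})"
      using assms(2) by (intro has_derivative_eq_rhs[OF has_derivative_diff[OF 1 1]]) (auto simp: right_diff_distrib)
  qed
  then obtain \<xi> where \<xi>: "\<xi> \<in> {x<..<x+s}"
    "N (x+s, y+t) - N (x+s, y) - (N (x, y+t) - N (x, y)) = s * (Nx (\<xi>, y+t) - Nx (\<xi>, y))"
    by auto
  have "\<exists>\<eta>\<in>{y<..<y+t}. Nx (\<xi>, y+t) - Nx (\<xi>, y) = (y + t - y) * Nxy (\<xi>, \<eta>)"
    using assms \<xi>(1) by (intro mvt_simple) (auto intro!: 2)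
  then obtain \<eta> where \<eta>: "\<eta> \<in> {y<..<y+t}" "Nx (\<xi>, y+t) - Nx (\<xi>, y) = t * Nxy (\<xi>, \<eta>)"
    by auto
  show ?thesis
    by (rule that[of \<xi> \<eta>]) (use \<xi> \<eta> in auto)
qed


text \<open>\<open>N (x, w)\<close> stands for \<open>M x (sqrt w)\<close>, so \<open>Ny\<close> is
  the derivative in \<open>w = y\<^sup>2\<close> and not in \<open>y\<close>, and \<open>Nxy\<close>
  is the \<open>w\<close>-derivative of \<open>Nx\<close>. With \<open>M_y = 2 y N_w\<close> and
  \<open>M_yy = 2 N_w + 4 y\<^sup>2 N_ww\<close> the quadratic form of the matrix becomes
  \<open>matrix_cond\<close>.\<close>

locale bellman =
  fixes a b :: real and N Nx Ny Nxx Nxy Nyx Nyy :: "real \<times> real \<Rightarrow> real" and S :: "(real \<times> real) set"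
  defines "S \<equiv> {a..b} \<times> {0..}"
  assumes ab: "a < b"
    and dN: "\<And>p. p \<in> S \<Longrightarrow> (N has_derivative (\<lambda>v. fst v * Nx p + snd v * Ny p)) (at p within S)"
    and dNx: "\<And>p. p \<in> S \<Longrightarrow> (Nx has_derivative (\<lambda>v. fst v * Nxx p + snd v * Nxy p)) (at p within S)"
    and dNy: "\<And>p. p \<in> S \<Longrightarrow> (Ny has_derivative (\<lambda>v. fst v * Nyx p + snd v * Nyy p)) (at p within S)"
    and cont2: "continuous_on S Nxx" "continuous_on S Nxy" "continuous_on S Nyx" "continuous_on S Nyy"
    and matrix_cond: "\<And>x y p q. \<lbrakk>x \<in> {a..b}; y > 0\<rbrakk> \<Longrightarrow>
      (Nxx (x, y\<^sup>2) + 2 * Ny (x, y\<^sup>2)) * p\<^sup>2 + 4 * y * Nxy (x, y\<^sup>2) * p * q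
        + (2 * Ny (x, y\<^sup>2) + 4 * y\<^sup>2 * Nyy (x, y\<^sup>2)) * q\<^sup>2 \<le> 0"
begin

lemma cont_N: "continuous_on S N" and cont_Nx: "continuous_on S Nx" and cont_Ny: "continuous_on S Ny"
  using has_derivative_continuous_on[OF dN] has_derivative_continuous_on[OF dNx]
    has_derivative_continuous_on[OF dNy] by simp_all

text \<open>Schwarz's theorem up to the boundary of the strip: one second difference over a small
  square is evaluated in both orders, and both mixed derivatives are continuous.\<close>

lemma mixed_eq: assumes "p \<in> S" shows "Nxy p = Nyx p"
proof (rule ccontr)
  assume ne: "Nxy p \<noteq> Nyx p"
  define e where "e = \<bar>Nxy p - Nyx p\<bar> / 2"
  have e: "e > 0" using ne by (simp add: e_def)
  obtain d1 where d1: "d1 > 0" "\<And>q. q \<in> S \<Longrightarrow> dist q p < d1 \<Longrightarrow> dist (Nxy q) (Nxy p) < e"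
    using cont2(2) assms e by (metis continuous_on_iff)
  obtain d2 where d2: "d2 > 0" "\<And>q. q \<in> S \<Longrightarrow> dist q p < d2 \<Longrightarrow> dist (Nyx q) (Nyx p) < e"
    using cont2(3) assms e by (metis continuous_on_iff)
  define d where "d = min (min d1 d2) (b - a) / 4"
  have d: "d > 0" "4 * d \<le> d1" "4 * d \<le> d2" "4 * d \<le> b - a" using d1 d2 ab by (auto simp: d_def min_def)
  obtain x y where p: "p = (x, y)" "a \<le> x" "x \<le> b" "y \<ge> 0" using assms by (cases p) (auto simp: S_def)
  \<comment> \<open>The square extends to the left when \<open>x\<close> is too close to
    \<open>b\<close>; upwards there is always room. Its points lie within \<open>2 * d\<close> of
    \<open>p\<close>, which the division by 4 keeps below \<open>d1\<close> and
    \<open>d2\<close>.\<close>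
  define x0 where "x0 = (if x + d \<le> b then x else x - d)"
  have x0: "{x0..x0+d} \<subseteq> {a..b}" "{x0..x0+d} \<subseteq> {x-d..x+d}"
    using p d by (auto simp: x0_def split: if_splits)
  have sub: "{x0..x0+d} \<times> {y..y+d} \<subseteq> S" using x0 p by (auto simp: S_def)
  have near: "dist q p < d1 \<and> dist q p < d2 \<and> q \<in> S" if "q \<in> {x0..x0+d} \<times> {y..y+d}" for q
  proof -
    have "dist q p \<le> \<bar>fst q - x\<bar> + \<bar>snd q - y\<bar>"
      unfolding p(1) dist_prod_def by (cases q) (auto simp: dist_real_def intro!: sqrt_sum_squares_le_sum_abs)
    also have "\<dots> \<le> 2 * d" using that x0(2) d by (cases q) (auto simp: abs_if split: if_splits)
    finally have "dist q p \<le> 2 * d" .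
    moreover have "q \<in> S" using that sub by blast
    ultimately show ?thesis using d by linarith
  qed
  obtain \<xi> \<eta> where 1: "\<xi> \<in> {x0..x0+d}" "\<eta> \<in> {y..y+d}"
    "N (x0+d, y+d) - N (x0+d, y) - N (x0, y+d) + N (x0, y) = d * d * Nxy (\<xi>, \<eta>)"
    by (rule mixed_difference[OF d(1) d(1) sub dN dNx])
  \<comment> \<open>The other order of differences comes from \<open>mixed_difference\<close>
    itself, with the coordinates exchanged.\<close>
  define S' where "S' = prod.swap ` S"
  have sw: "bounded_linear (prod.swap :: real \<times> real \<Rightarrow> _)"
    unfolding prod.swap_def by (intro bounded_linear_intros)
  have swd: "(f \<circ> prod.swap has_derivative (\<lambda>v. fst v * B (prod.swap q) + snd v * A (prod.swap q))) (at q within S')"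
    if "\<And>p. p \<in> S \<Longrightarrow> (f has_derivative (\<lambda>v. fst v * A p + snd v * B p)) (at p within S)" "q \<in> S'"
    for f A B :: "real \<times> real \<Rightarrow> real" and q
  proof -
    have "(f has_derivative (\<lambda>v. fst v * A (prod.swap q) + snd v * B (prod.swap q))) (at (prod.swap q) within prod.swap ` S')"
      using that by (auto simp: S'_def image_image)
    from has_derivative_in_compose[OF bounded_linear_imp_has_derivative[OF sw] this]
    show ?thesis by (simp add: o_def add.commute)
  qed
  have sub': "{y..y+d} \<times> {x0..x0+d} \<subseteq> S'" using sub unfolding S'_def
    by (metis image_mono product_swap)
  obtain \<eta>' \<xi>' where 2: "\<eta>' \<in> {y..y+d}" "\<xi>' \<in> {x0..x0+d}" 
    "(N \<circ> prod.swap) (y+d, x0+d) - (N \<circ> prod.swap) (y+d, x0) - (N \<circ> prod.swap) (y, x0+d) + (N \<circ> prod.swap) (y, x0) = d * d * (Nyx \<circ> prod.swap) (\<eta>', \<xi>')"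
    by (rule mixed_difference[OF d(1) d(1) sub', of "N \<circ> prod.swap" "Ny \<circ> prod.swap" "Nx \<circ> prod.swap"
          "Nyy \<circ> prod.swap" "Nyx \<circ> prod.swap"]) (use swd[OF dN] swd[OF dNy] in auto)
  have "d * d * Nxy (\<xi>, \<eta>) = d * d * Nyx (\<xi>', \<eta>')" using 1(3) 2(3) unfolding o_apply swap_simp by linarith
  then have "Nxy (\<xi>, \<eta>) = Nyx (\<xi>', \<eta>')" using d by simp
  moreover have "dist (Nxy (\<xi>, \<eta>)) (Nxy p) < e" using near[of "(\<xi>, \<eta>)"] 1 d1 by auto
  moreover have "dist (Nyx (\<xi>', \<eta>')) (Nyx p) < e" using near[of "(\<xi>', \<eta>')"] 2 d2 by auto
  ultimately have "\<bar>Nxy p - Nyx p\<bar> < e + e"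
    unfolding dist_real_def by linarith
  then show False by (simp add: e_def)
qed

text \<open>The matrix condition speaks only of \<open>y > 0\<close>; its consequences reach
  \<open>w = 0\<close> by continuity.\<close>

lemma limit_w0:
  assumes "continuous_on S f" "x \<in> {a..b}" "\<And>y. y > 0 \<Longrightarrow> f (x, y\<^sup>2) \<le> (0::real)"
  shows "f (x, 0) \<le> 0"
proof -
  have "((\<lambda>y. f (x, y\<^sup>2)) \<longlongrightarrow> f (x, 0\<^sup>2)) (at_right 0)"
  proof -
    have "continuous_on {0..} (\<lambda>y. f (x, y\<^sup>2))"
      by (rule continuous_on_compose2[OF assms(1)]) (use assms(2) in \<open>auto intro!: continuous_intros simp: S_def\<close>)
    then have "((\<lambda>y. f (x, y\<^sup>2)) \<longlongrightarrow> f (x, 0\<^sup>2)) (at 0 within {0..})"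
      unfolding continuous_on_def by (metis atLeast_iff order_refl)
    then show ?thesis by (rule tendsto_within_subset) auto
  qed
  moreover have "\<forall>\<^sub>F y in at_right 0. f (x, y\<^sup>2) \<le> 0"
    using assms(3) by (auto simp: eventually_at_right_less intro: eventually_mono[OF eventually_at_right_less])
  ultimately show ?thesis by (metis power_zero_numeral tendsto_upperbound trivial_limit_at_right_real)
qed

text \<open>\<open>M_y = 2 y N_w\<close> vanishes at \<open>y = 0\<close>, and
  \<open>M_yy \<le> 0\<close> by the second diagonal entry of the matrix, so
  \<open>M_y \<le> 0\<close>. The factor \<open>y\<close> is what makes the boundary value
  known.\<close>

lemma Ny_nonpos: assumes "p \<in> S" shows "Ny p \<le> 0"
proof -
  obtain x w where p: "p = (x, w)" "x \<in> {a..b}" "w \<ge> 0" using assms by (cases p) (auto simp: S_def)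
  have pos: "Ny (x, y\<^sup>2) \<le> 0" if "y > 0" for y
  proof -
    have "\<exists>z\<in>{0<..<y}. (y * Ny (x, y\<^sup>2)) - 0 * Ny (x, 0\<^sup>2) = (y - 0) * (Ny (x, z\<^sup>2) + 2 * z\<^sup>2 * Nyy (x, z\<^sup>2))"
    proof (rule mvt_simple[OF that])
      fix z :: real assume z: "0 \<le> z" "z \<le> y"
      have "((\<lambda>z. Ny (x, z\<^sup>2)) has_derivative (\<lambda>h. 0 * Nyx (x, z\<^sup>2) + 2 * z * h * Nyy (x,z\<^sup>2))) (at z within {0..y})"
        by (rule has_derivative_along_curve[where X = "\<lambda>z. (x, z\<^sup>2)", OF dNy])
          (use z p in \<open>auto intro!: derivative_eq_intros simp: S_def\<close>)
      then show "((\<lambda>z. z * Ny (x, z\<^sup>2)) has_derivative (\<lambda>h. h * (Ny (x, z\<^sup>2) + 2 * z\<^sup>2 * Nyy (x, z\<^sup>2)))) (at z within {0..y})"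
        by (auto intro!: derivative_eq_intros simp: algebra_simps power2_eq_square)
    qed
    then obtain z where z: "z \<in> {0<..<y}" "Ny (x, y\<^sup>2) = Ny (x, z\<^sup>2) + 2 * z\<^sup>2 * Nyy (x, z\<^sup>2)"
      using that by auto
    then show ?thesis using matrix_cond[OF p(2), of z 0 1] by simp
  qed
  show ?thesis
  proof (cases "w = 0")
    case True
    then show ?thesis using limit_w0[OF cont_Ny p(2) pos] p by simp
  next
    case False
    then show ?thesis using pos[of "sqrt w"] p by simp
  qed
qed

text \<open>The left-hand side is the second derivative of \<open>N\<close> along a curve with
  \<open>x\<close>-velocity \<open>c\<close> on which \<open>w\<close> is the squared length of a
  vector moving on a line: \<open>\<beta>\<close> is the inner product of position and velocity,
  \<open>\<gamma>\<close> the squared speed, and the hypothesis on them is Cauchy-Schwarz. The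
  matrix is tested at \<open>(c, \<beta> / y)\<close>, and \<open>Ny \<le> 0\<close> absorbs the
  excess of \<open>\<gamma>\<close> over \<open>(\<beta> / y)\<^sup>2\<close>.\<close>

lemma second_order:
  assumes "(x, w) \<in> S" "\<beta>\<^sup>2 \<le> w * \<gamma>" "\<gamma> \<ge> 0"
  shows "Nxx (x, w) * c\<^sup>2 + 2 * (Nxy (x, w) + Nyx (x, w)) * c * \<beta> + 4 * Nyy (x, w) * \<beta>\<^sup>2 + 2 * Ny (x, w) * \<gamma>
    \<le> - 2 * Ny (x, w) * c\<^sup>2"
proof (cases "w = 0")
  case True
  then have \<beta>: "\<beta> = 0" using assms by auto
  have x: "x \<in> {a..b}" using assms by (auto simp: S_def)
  have "Nxx (x, 0) + 2 * Ny (x, 0) \<le> 0"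
  proof (rule limit_w0[where f = "\<lambda>p. Nxx p + 2 * Ny p"])
    show "continuous_on S (\<lambda>p. Nxx p + 2 * Ny p)" by (intro continuous_intros cont2 cont_Ny)
    show "Nxx (x, y\<^sup>2) + 2 * Ny (x, y\<^sup>2) \<le> 0" if "y > 0" for y
      using matrix_cond[OF x that, of 1 0] by simp
  qed (rule x)
  then have "(Nxx (x, 0) + 2 * Ny (x, 0)) * c\<^sup>2 \<le> 0" by (simp add: mult_nonpos_nonneg)
  moreover have "Ny (x, 0) * \<gamma> \<le> 0" using Ny_nonpos assms True by (auto intro: mult_nonpos_nonneg)
  ultimately show ?thesis using \<beta> True by (simp add: algebra_simps)
next
  case False
  then have w: "w > 0" and x: "x \<in> {a..b}" using assms by (auto simp: S_def)
  define y where "y = sqrt w"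
  have y: "y > 0" "y\<^sup>2 = w" using w by (auto simp: y_def)
  define q where "q = \<beta> / y"
  have q: "\<beta> = y * q" using y by (simp add: q_def)
  have "q\<^sup>2 \<le> \<gamma>" using assms(2) w unfolding q y(2)[symmetric] by (simp add: power_mult_distrib)
  then have "Ny (x, w) * \<gamma> \<le> Ny (x, w) * q\<^sup>2"
    using Ny_nonpos[OF assms(1)] by (rule mult_left_mono_neg)
  moreover have "(Nxx (x, w) + 2 * Ny (x, w)) * c\<^sup>2 + 4 * y * Nxy (x, w) * c * q
        + (2 * Ny (x, w) + 4 * w * Nyy (x, w)) * q\<^sup>2 \<le> 0"
    using matrix_cond[OF x y(1), of c q] y(2) by simp
  ultimately show ?thesis
    using mixed_eq[OF assms(1)] unfolding q by (simp add: algebra_simps y(2)[symmetric] power2_eq_square)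
qed

text \<open>Along the curve \<open>X\<close> the second derivative of \<open>N\<close> is at most
  \<open>2 * \<kappa> * c\<^sup>2\<close>. Subtracting
  \<open>\<kappa> * c\<^sup>2 * r\<^sup>2\<close> leaves a concave function of \<open>r\<close>, and
  its midpoint inequality on \<open>{-1..1}\<close> is the claim.\<close>

lemma two_point:
  assumes x: "x + c \<in> {a..b}" "x - c \<in> {a..b}" and w: "\<beta>\<^sup>2 \<le> w * \<gamma>" "\<gamma> \<ge> 0" "w \<ge> 0"
    and \<kappa>: "\<And>r. r \<in> {-1..1} \<Longrightarrow> - Ny (x + r * c, w + 2 * \<beta> * r + \<gamma> * r\<^sup>2) \<le> \<kappa>"
  shows "(N (x + c, w + 2 * \<beta> + \<gamma>) + N (x - c, w - 2 * \<beta> + \<gamma>)) / 2 \<le> N (x, w) + \<kappa> * c\<^sup>2"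
proof -
  define X where "X = (\<lambda>r. (x + r * c, w + 2 * \<beta> * r + \<gamma> * r\<^sup>2))"
  have nonneg: "w + 2 * \<beta> * r + \<gamma> * r\<^sup>2 \<ge> 0" for r
  proof (cases "\<gamma> = 0")
    case True
    then show ?thesis using w by simp
  next
    case False
    then have "\<gamma> > 0" using w by simp
    have "0 \<le> (\<beta> + \<gamma> * r)\<^sup>2 + (w * \<gamma> - \<beta>\<^sup>2)" using w by simp
    also have "\<dots> = \<gamma> * (w + 2 * \<beta> * r + \<gamma> * r\<^sup>2)" by (simp add: algebra_simps power2_eq_square)
    finally show ?thesis using \<open>\<gamma> > 0\<close> by (simp add: zero_le_mult_iff)
  qed
  have xin: "x + r * c \<in> {a..b}" if "r \<in> {-1..1}" for r
  proof -
    have "\<bar>r * c\<bar> \<le> 1 * \<bar>c\<bar>" unfolding abs_mult using that by (intro mult_right_mono) auto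
    then show ?thesis using x by (auto simp: abs_if split: if_splits)
  qed
  have XS: "X r \<in> S" if "r \<in> {-1..1}" for r
    using xin[OF that] nonneg[of r] by (auto simp: X_def S_def)
  have dX: "(X has_derivative (\<lambda>h. (h * c, h * (2 * \<beta> + 2 * \<gamma> * r)))) (at r within {-1<..<1})" for r
    unfolding X_def by (auto intro!: derivative_eq_intros simp: algebra_simps)
  have comp: "((\<lambda>r. f (X r)) has_real_derivative (c * A (X r) + (2 * \<beta> + 2 * \<gamma> * r) * B (X r))) (at r)"
    if f: "\<And>p. p \<in> S \<Longrightarrow> (f has_derivative (\<lambda>v. fst v * A p + snd v * B p)) (at p within S)" and r: "r \<in> {-1<..<1}"
    for f A B r
  proof -
    have "((\<lambda>r. f (X r)) has_derivative (\<lambda>h. h * c * A (X r) + h * (2 * \<beta> + 2 * \<gamma> * r) * B (X r))) (at r within {-1<..<1})"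
      by (rule has_derivative_along_curve[OF f]) (use r in \<open>auto intro!: dX XS\<close>)
    moreover have "at r within {-1<..<1} = at r" using r by (intro at_within_open) auto
    moreover have "(\<lambda>h. h * c * A (X r) + h * (2 * \<beta> + 2 * \<gamma> * r) * B (X r))
       = (*) (c * A (X r) + (2 * \<beta> + 2 * \<gamma> * r) * B (X r))"
      by (auto simp: algebra_simps)
    ultimately show ?thesis unfolding has_field_derivative_def by (simp only:)
  qed
  define g where "g = (\<lambda>r. N (X r) - \<kappa> * c\<^sup>2 * r\<^sup>2)"
  define g1 where "g1 = (\<lambda>r. c * Nx (X r) + (2 * \<beta> + 2 * \<gamma> * r) * Ny (X r) - 2 * \<kappa> * c\<^sup>2 * r)"
  define g2 where "g2 = (\<lambda>r. c * (c * Nxx (X r) + (2 * \<beta> + 2 * \<gamma> * r) * Nxy (X r)) + 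
     (2 * \<gamma> * Ny (X r) + (2 * \<beta> + 2 * \<gamma> * r) * (c * Nyx (X r) + (2 * \<beta> + 2 * \<gamma> * r) * Nyy (X r))) - 2 * \<kappa> * c\<^sup>2)"
  have conc: "concave_on {-1<..<1} g"
  proof (rule f''_le0_imp_concave)
    show "(g has_real_derivative g1 r) (at r)" if "r \<in> {-1<..<1}" for r
      unfolding g_def g1_def by (auto intro!: derivative_eq_intros comp[OF dN that])
    show "(g1 has_real_derivative g2 r) (at r)" if "r \<in> {-1<..<1}" for r
      unfolding g1_def g2_def by (auto intro!: derivative_eq_intros comp[OF dNx that] comp[OF dNy that] simp: algebra_simps)
    show "g2 r \<le> 0" if r: "r \<in> {-1<..<1}" for r
    proof -
      have r': "r \<in> {-1..1}" using r by auto
      define wr \<beta>r where "wr = w + 2 * \<beta> * r + \<gamma> * r\<^sup>2" and "\<beta>r = \<beta> + \<gamma> * r"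
      have "(x + r * c, wr) \<in> S" using XS[OF r'] by (simp add: X_def wr_def)
      moreover have "\<beta>r\<^sup>2 \<le> wr * \<gamma>" using w unfolding \<beta>r_def wr_def by (simp add: algebra_simps power2_eq_square)
      ultimately have "Nxx (X r) * c\<^sup>2 + 2 * (Nxy (X r) + Nyx (X r)) * c * \<beta>r + 4 * Nyy (X r) * \<beta>r\<^sup>2 + 2 * Ny (X r) * \<gamma>
        \<le> - 2 * Ny (X r) * c\<^sup>2" using second_order[of "x + r * c" wr \<beta>r \<gamma> c] w by (simp add: X_def wr_def)
      also have "\<dots> = 2 * (- Ny (X r)) * c\<^sup>2" by simp
      also have "\<dots> \<le> 2 * \<kappa> * c\<^sup>2" using \<kappa>[OF r'] by (intro mult_right_mono) (auto simp: X_def)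
      finally show ?thesis unfolding g2_def \<beta>r_def by (simp add: algebra_simps power2_eq_square)
    qed
  qed auto
  have contg: "continuous_on {-1..1} g"
    unfolding g_def
    by (intro continuous_intros continuous_on_compose2[OF cont_N]) (auto simp: X_def intro!: continuous_intros XS[unfolded X_def])
  \<comment> \<open>Concavity comes from two-sided derivatives and is available on the open interval
    only; the end points are reached by continuity.\<close>
  have lim1: "((\<lambda>t. g t + g (- t)) \<longlongrightarrow> g 1 + g (- 1)) (at_left 1)"
  proof -
    have "continuous_on {-1..1} (\<lambda>t. g t + g (- t))"
      by (intro continuous_intros contg continuous_on_compose2[OF contg]) auto
    then have "((\<lambda>t. g t + g (- t)) \<longlongrightarrow> g 1 + g (- 1)) (at 1 within {-1..1})"
      by (auto simp: continuous_on_def)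
    moreover have "at 1 within {-1..1} = at_left (1::real)" by (rule at_within_Icc_at_left) simp
    ultimately show ?thesis by simp
  qed
  have "\<forall>\<^sub>F t in at_left (1::real). g t + g (- t) \<le> 2 * g 0"
  proof (rule eventually_at_leftI[of 0])
    fix t :: real assume t: "t \<in> {0<..<1}"
    have "(1 - 1/2) * g t + 1/2 * g (- t) \<le> g ((1 - 1/2) *\<^sub>R t + (1/2) *\<^sub>R (- t))"
      by (rule concave_onD[OF conc]) (use t in auto)
    then show "g t + g (- t) \<le> 2 * g 0" by simp
  qed simp
  with lim1 have "g 1 + g (-1) \<le> 2 * g 0"
    by (intro tendsto_upperbound[OF lim1]) auto
  then show ?thesis by (simp add: g_def X_def algebra_simps)
qed

lemma N_antimono: assumes "x \<in> {a..b}" "0 \<le> w" "w \<le> w'" shows "N (x, w') \<le> N (x, w)"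
proof (cases "w = w'")
  case False
  have "\<exists>z\<in>{w<..<w'}. N (x, w') - N (x, w) = (w' - w) * Ny (x, z)"
  proof (rule mvt_simple)
    show "w < w'" using False assms by simp
    fix z assume z: "w \<le> z" "z \<le> w'"
    have "((\<lambda>z. N (x, z)) has_derivative (\<lambda>h. 0 * Nx (x, z) + h * Ny (x,z))) (at z within {w..w'})"
      by (rule has_derivative_along_curve[where X = "\<lambda>z. (x, z)", OF dN])
        (use z assms in \<open>auto intro!: derivative_eq_intros simp: S_def\<close>)
    then show "((\<lambda>z. N (x, z)) has_derivative (\<lambda>h. h * Ny (x, z))) (at z within {w..w'})" by simp
  qed
  then obtain z where "z \<in> {w<..<w'}" "N (x, w') - N (x, w) = (w' - w) * Ny (x, z)" by auto
  moreover have "(w' - w) * Ny (x, z) \<le> 0"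
    using Ny_nonpos[of "(x, z)"] calculation assms by (intro mult_nonneg_nonpos) (auto simp: S_def)
  ultimately show ?thesis by linarith
qed simp

lemma N_increment:
  assumes "x \<in> {a..b}" "0 \<le> w" "e \<ge> 0" "\<And>z. z \<in> {w..w+e} \<Longrightarrow> Ny (x, z) \<le> L"
  shows "N (x, w + e) \<le> N (x, w) + e * L"
proof (cases "e = 0")
  case False
  have "\<exists>z\<in>{w<..<w+e}. N (x, w + e) - N (x, w) = (w + e - w) * Ny (x, z)"
  proof (rule mvt_simple)
    show "w < w + e" using False assms by simp
    fix z assume z: "w \<le> z" "z \<le> w + e"
    have "((\<lambda>z. N (x, z)) has_derivative (\<lambda>h. 0 * Nx (x, z) + h * Ny (x,z))) (at z within {w..w+e})"
      by (rule has_derivative_along_curve[where X = "\<lambda>z. (x, z)", OF dN])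
        (use z assms in \<open>auto intro!: derivative_eq_intros simp: S_def\<close>)
    then show "((\<lambda>z. N (x, z)) has_derivative (\<lambda>h. h * Ny (x, z))) (at z within {w..w+e})" by simp
  qed
  then obtain z where "z \<in> {w<..<w+e}" "N (x, w + e) - N (x, w) = e * Ny (x, z)" by auto
  moreover have "e * Ny (x, z) \<le> e * L" using calculation assms by (intro mult_left_mono) auto
  ultimately show ?thesis by linarith
qed simp

text \<open>On a compact range of \<open>w\<close> the second derivatives are bounded. This is what
  makes the error of one coin flip cubic in its size.\<close>

lemma Ny_lipschitz:
  obtains C where "C \<ge> 0" "\<And>p q. p \<in> {a..b} \<times> {0..W} \<Longrightarrow> q \<in> {a..b} \<times> {0..W} \<Longrightarrow> \<bar>Ny p - Ny q\<bar> \<le> C * norm (p - q)"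
    "\<And>p. p \<in> {a..b} \<times> {0..W} \<Longrightarrow> \<bar>Ny p\<bar> \<le> C"
proof -
  define K where "K = {a..b} \<times> {0..W}"
  have K: "compact K" "convex K" "K \<subseteq> S" by (auto simp: K_def S_def intro!: compact_Times convex_Times)
  have bnd: "\<exists>B\<ge>0. \<forall>p\<in>K. \<bar>f p\<bar> \<le> B" if "continuous_on S f" for f :: "real \<times> real \<Rightarrow> real"
  proof -
    have "compact (f ` K)" using that K by (meson compact_continuous_image continuous_on_subset)
    then show ?thesis by (metis bounded_pos compact_imp_bounded image_eqI less_eq_real_def real_norm_def)
  qed
  obtain B1 where B1: "B1 \<ge> 0" "\<And>p. p \<in> K \<Longrightarrow> \<bar>Nyx p\<bar> \<le> B1" using bnd[OF cont2(3)] by auto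
  obtain B2 where B2: "B2 \<ge> 0" "\<And>p. p \<in> K \<Longrightarrow> \<bar>Nyy p\<bar> \<le> B2" using bnd[OF cont2(4)] by auto
  obtain B3 where B3: "B3 \<ge> 0" "\<And>p. p \<in> K \<Longrightarrow> \<bar>Ny p\<bar> \<le> B3" using bnd[OF cont_Ny] by auto
  have "norm (Ny p - Ny q) \<le> (B1 + B2) * norm (p - q)" if "p \<in> K" "q \<in> K" for p q
  proof (rule differentiable_bound[OF K(2) _ _ that])
    fix z assume z: "z \<in> K"
    show "(Ny has_derivative (\<lambda>v. fst v * Nyx z + snd v * Nyy z)) (at z within K)"
      using dNy[of z] z K(3) by (blast intro: has_derivative_subset)
    show "onorm (\<lambda>v. fst v * Nyx z + snd v * Nyy z) \<le> B1 + B2"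
    proof (rule onorm_bound)
      fix v :: "real \<times> real"
      have "norm (fst v * Nyx z + snd v * Nyy z) \<le> \<bar>fst v\<bar> * \<bar>Nyx z\<bar> + \<bar>snd v\<bar> * \<bar>Nyy z\<bar>"
        by (metis abs_mult abs_triangle_ineq real_norm_def)
      also have "\<dots> \<le> norm v * B1 + norm v * B2"
        using B1 B2 z norm_fst_le[of "fst v" "snd v"] norm_snd_le[of "snd v" "fst v"] by (intro add_mono mult_mono) (auto simp: norm_ge_zero)
      finally show "norm (fst v * Nyx z + snd v * Nyy z) \<le> (B1 + B2) * norm v" by (simp add: algebra_simps)
    qed (use B1 B2 in auto)
  qed
  then have *: "\<bar>Ny p - Ny q\<bar> \<le> (B1 + B2) * norm (p - q)" if "p \<in> K" "q \<in> K" for p q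
    using that by simp
  show ?thesis
  proof (rule that[of "B1 + B2 + B3"])
    show "\<bar>Ny p - Ny q\<bar> \<le> (B1 + B2 + B3) * norm (p - q)" if "p \<in> {a..b} \<times> {0..W}" "q \<in> {a..b} \<times> {0..W}" for p q
      using *[of p q] that B3(1) by (simp add: K_def distrib_right add_increasing2)
    show "\<bar>Ny p\<bar> \<le> B1 + B2 + B3" if "p \<in> {a..b} \<times> {0..W}" for p
      using B3(2)[of p] that B1(1) B2(1) by (simp add: K_def)
  qed (use B1 B2 B3 in simp)
qed

end

section \<open>Averages over a fair coin flip and their iterates\<close>

definition two_point_avg :: "real \<Rightarrow> (real \<Rightarrow> 'v::real_vector) \<Rightarrow> real \<Rightarrow> 'v" where
  "two_point_avg d \<phi> x = (1/2) *\<^sub>R (\<phi> (x + d) + \<phi> (x - d))"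

text \<open>That \<open>u'\<close> is the derivative of \<open>u\<close> is expressed by a quadratic
  Taylor bound, and one \<open>K\<close> serves all the bounds. In this form the condition passes to
  averages with the same \<open>K\<close>, so an iteration keeps one error constant.\<close>

definition lipschitz_data :: "real \<Rightarrow> (real \<Rightarrow> real) \<Rightarrow> (real \<Rightarrow> real) \<Rightarrow> (real \<Rightarrow> 'v::real_normed_vector) \<Rightarrow> bool" where
  "lipschitz_data K u u' F \<longleftrightarrow>
    (\<forall>x. \<bar>u' x\<bar> \<le> K \<and> norm (F x) \<le> K) \<and>
    (\<forall>x t. \<bar>u (x + t) - u x - t * u' x\<bar> \<le> K * t\<^sup>2) \<and>
    (\<forall>x t. \<bar>u (x + t) - u x\<bar> \<le> K * \<bar>t\<bar>) \<and>
    (\<forall>x t. \<bar>u' (x + t) - u' x\<bar> \<le> K * \<bar>t\<bar>) \<and>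
    (\<forall>x t. norm (F (x + t) - F x) \<le> K * \<bar>t\<bar>)"

lemma norm_half_sum_le:
  fixes p q :: "'w::real_normed_vector"
  assumes "norm p \<le> B" "norm q \<le> B" shows "norm ((1/2) *\<^sub>R (p + q)) \<le> B"
  using norm_triangle_ineq[of p q] assms by simp

lemma lipschitz_data_avg:
  assumes "lipschitz_data K u u' F"
  shows "lipschitz_data K (two_point_avg d u) (two_point_avg d u') (two_point_avg d F)"
proof -
  note A = assms[unfolded lipschitz_data_def]
  note half = norm_half_sum_le
  show ?thesis unfolding lipschitz_data_def
  proof (intro conjI allI)
    fix x t
    show "\<bar>two_point_avg d u' x\<bar> \<le> K" using A half[of "u' (x+d)" K "u' (x-d)"] by (simp add: two_point_avg_def)
    show "norm (two_point_avg d F x) \<le> K" using A half[of "F (x+d)" K "F (x-d)"] by (simp add: two_point_avg_def)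
    have e: "x + t + d = x + d + t" "x + t - d = x - d + t" by auto
    have "norm ((1/2) *\<^sub>R ((u (x+d+t) - u (x+d) - t * u' (x+d)) + (u (x-d+t) - u (x-d) - t * u' (x-d)))) \<le> K * t\<^sup>2"
      by (rule half) (use A in auto)
    then show "\<bar>two_point_avg d u (x + t) - two_point_avg d u x - t * two_point_avg d u' x\<bar> \<le> K * t\<^sup>2"
      unfolding two_point_avg_def e by (simp add: algebra_simps)
    have "norm ((1/2) *\<^sub>R ((u (x+d+t) - u (x+d)) + (u (x-d+t) - u (x-d)))) \<le> K * \<bar>t\<bar>"
      by (rule half) (use A in auto)
    then show "\<bar>two_point_avg d u (x + t) - two_point_avg d u x\<bar> \<le> K * \<bar>t\<bar>"
      unfolding two_point_avg_def e by (simp add: algebra_simps)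
    have "norm ((1/2) *\<^sub>R ((u' (x+d+t) - u' (x+d)) + (u' (x-d+t) - u' (x-d)))) \<le> K * \<bar>t\<bar>"
      by (rule half) (use A in auto)
    then show "\<bar>two_point_avg d u' (x + t) - two_point_avg d u' x\<bar> \<le> K * \<bar>t\<bar>"
      unfolding two_point_avg_def e by (simp add: algebra_simps)
    have "norm ((1/2) *\<^sub>R ((F (x+d+t) - F (x+d)) + (F (x-d+t) - F (x-d)))) \<le> K * \<bar>t\<bar>"
      by (rule half) (use A in auto)
    then show "norm (two_point_avg d F (x + t) - two_point_avg d F x) \<le> K * \<bar>t\<bar>"
      unfolding two_point_avg_def e by (simp add: algebra_simps)
  qed
qed

lemma two_point_avg_in_interval:
  fixes u :: "real \<Rightarrow> real"
  assumes "\<And>x. u x \<in> {a..b}" shows "two_point_avg d u x \<in> {a..b}"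
  using assms[of "x+d"] assms[of "x-d"] by (auto simp: two_point_avg_def)

lemma two_point_avg_funpow_mono:
  fixes f g :: "real \<Rightarrow> real"
  assumes "\<And>x. f x \<le> g x + c"
  shows "(two_point_avg d ^^ m) f x \<le> (two_point_avg d ^^ m) g x + c"
proof (induction m arbitrary: x)
  case (Suc m)
  have e: "(two_point_avg d ^^ Suc m) h x = ((two_point_avg d ^^ m) h (x+d) + (two_point_avg d ^^ m) h (x-d)) / 2"
    for h :: "real \<Rightarrow> real"
    unfolding funpow.simps o_apply by (subst two_point_avg_def) simp
  show ?case using Suc.IH[of "x+d"] Suc.IH[of "x-d"] unfolding e by argo
qed (use assms in auto)

context bellman begin

text \<open>\<open>two_point\<close> compares the average over a flip with the value at the mid
  vector, up to an error of about \<open>- Ny * c\<^sup>2\<close>. The extra weight changes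
  \<open>N\<close> by about \<open>Ny * d\<^sup>2 * (u' x)\<^sup>2\<close>, and the two cancel
  because \<open>c\<close>, half the increment of \<open>u\<close>, equals \<open>d * u' x\<close>
  up to a term quadratic in \<open>d\<close>. The constant is chosen before the functions, which
  permits iteration.\<close>

lemma two_point_step:
  fixes K :: real
  assumes "K \<ge> 0"
  obtains C where "C \<ge> 0" "\<And>u u' (F :: real \<Rightarrow> 'v::real_inner) d s x. \<lbrakk>lipschitz_data K u u' F; \<And>x. u x \<in> {a..b}; 0 \<le> d; d \<le> 1; 0 \<le> s; s \<le> 1\<rbrakk> \<Longrightarrow>
    two_point_avg d (\<lambda>x. N (u x, (norm (F x))\<^sup>2 + (s + d\<^sup>2) * (u' x)\<^sup>2)) x
      \<le> N (two_point_avg d u x, (norm (two_point_avg d F x))\<^sup>2 + s * (two_point_avg d u' x)\<^sup>2) + C * d^3"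
proof -
  \<comment> \<open>The base value \<open>w\<close> is at most \<open>2 * K\<^sup>2\<close>, and the
    curve together with the added weight moves it by at most \<open>7 * K\<^sup>2 * d\<close>; hence
    the range up to \<open>9 * K\<^sup>2\<close>. \<open>D\<close> below bounds the displacement of
    both arguments per unit of \<open>d\<close>.\<close>
  obtain L where L: "L \<ge> 0" "\<And>p q. p \<in> {a..b} \<times> {0..9 * K\<^sup>2} \<Longrightarrow> q \<in> {a..b} \<times> {0..9 * K\<^sup>2} \<Longrightarrow> \<bar>Ny p - Ny q\<bar> \<le> L * norm (p - q)"
    "\<And>p. p \<in> {a..b} \<times> {0..9 * K\<^sup>2} \<Longrightarrow> \<bar>Ny p\<bar> \<le> L"
    using Ny_lipschitz by blast
  define D where "D = K + 7 * K\<^sup>2"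
  have D: "D \<ge> 0" using assms by (simp add: D_def)
  define C where "C = L * K\<^sup>2 * (4 + 2 * D)"
  show ?thesis
  proof (rule that[of C])
    show "C \<ge> 0" using L D by (simp add: C_def)
  next
    fix u u' and F :: "real \<Rightarrow> 'v" and d s x :: real
    assume data: "lipschitz_data K u u' F" and u: "\<And>x. u x \<in> {a..b}" and d: "0 \<le> d" "d \<le> 1" and s: "0 \<le> s" "s \<le> 1"
    note A = data[unfolded lipschitz_data_def]
    \<comment> \<open>Mid values and half-differences: the two outcomes of the flip are the
      parameters \<open>r = 1\<close> and \<open>r = -1\<close> on a segment.\<close>
    define u0 c where "u0 = (u (x+d) + u (x-d)) / 2" and "c = (u (x+d) - u (x-d)) / 2"
    define F0 G where "F0 = (1/2) *\<^sub>R (F (x+d) + F (x-d))" and "G = (1/2) *\<^sub>R (F (x+d) - F (x-d))"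
    define v0 e where "v0 = (u' (x+d) + u' (x-d)) / 2" and "e = (u' (x+d) - u' (x-d)) / 2"
    have Fpm: "F (x+d) = F0 + G" "F (x-d) = F0 - G" 
      by (simp_all add: F0_def G_def algebra_simps flip: scaleR_add_left)
    have upm: "u (x+d) = u0 + c" "u (x-d) = u0 - c" "u' (x+d) = v0 + e" "u' (x-d) = v0 - e"
      by (simp_all add: u0_def c_def v0_def e_def field_simps)
    define w \<beta> \<gamma> where "w = (norm F0)\<^sup>2 + s * v0\<^sup>2" and "\<beta> = F0 \<bullet> G + s * v0 * e" and "\<gamma> = (norm G)\<^sup>2 + s * e\<^sup>2"
    have sq: "(norm F0)\<^sup>2 = F0 \<bullet> F0" "(norm G)\<^sup>2 = G \<bullet> G" by (simp_all add: power2_norm_eq_inner)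
    have xd: "x - d + 2 * d = x + d" by simp
    have cK: "\<bar>c\<bar> \<le> K * d"
    proof -
      have "\<bar>u (x - d + 2 * d) - u (x - d)\<bar> \<le> K * \<bar>2 * d\<bar>" using A by blast
      then show ?thesis unfolding xd using d by (simp add: c_def)
    qed
    have eK: "\<bar>e\<bar> \<le> K * d"
    proof -
      have "\<bar>u' (x - d + 2 * d) - u' (x - d)\<bar> \<le> K * \<bar>2 * d\<bar>" using A by blast
      then show ?thesis unfolding xd using d by (simp add: e_def)
    qed
    have GK: "norm G \<le> K * d"
    proof -
      have "norm (F (x - d + 2 * d) - F (x - d)) \<le> K * \<bar>2 * d\<bar>" using A by blast
      then show ?thesis unfolding xd using d by (simp add: G_def)
    qed
    have F0K: "norm F0 \<le> K" unfolding F0_def by (rule norm_half_sum_le) (use A in auto)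
    have v0K: "\<bar>v0\<bar> \<le> K" using norm_half_sum_le[of "u' (x+d)" K "u' (x-d)"] A by (simp add: v0_def)
    have uK: "\<bar>u' z\<bar> \<le> K" for z using A by blast
    \<comment> \<open>The number \<open>sqrt s * v0\<close> is adjoined to \<open>F0\<close> as one
      more coordinate, so that \<open>w\<close>, \<open>\<beta>\<close> and \<open>\<gamma>\<close>
      are inner products in a product space.\<close>
    have cs: "\<beta>\<^sup>2 \<le> w * \<gamma>"
    proof -
      have "((F0, sqrt s * v0) \<bullet> (G, sqrt s * e))\<^sup>2 \<le> ((F0, sqrt s * v0) \<bullet> (F0, sqrt s * v0)) * ((G, sqrt s * e) \<bullet> (G, sqrt s * e))"
        by (rule Cauchy_Schwarz_ineq)
      moreover have "(F0, sqrt s * v0) \<bullet> (G, sqrt s * e) = \<beta>"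
        using s by (simp add: \<beta>_def inner_prod_def algebra_simps)
      moreover have "(F0, sqrt s * v0) \<bullet> (F0, sqrt s * v0) = w" "(G, sqrt s * e) \<bullet> (G, sqrt s * e) = \<gamma>"
        unfolding w_def \<gamma>_def sq inner_prod_def using s by (simp_all add: power2_eq_square algebra_simps)
      ultimately show ?thesis by simp
    qed
    have \<gamma>0: "\<gamma> \<ge> 0" and w0: "w \<ge> 0" using s by (simp_all add: \<gamma>_def w_def)
    have sqle: "z\<^sup>2 \<le> B\<^sup>2" if "\<bar>z\<bar> \<le> B" for z B :: real
      using power_mono[OF that abs_ge_zero, of 2] by simp
    have wK: "w \<le> 2 * K\<^sup>2"
    proof -
      have "(norm F0)\<^sup>2 \<le> K\<^sup>2" using F0K by (simp add: power_mono)
      moreover have "s * v0\<^sup>2 \<le> 1 * K\<^sup>2" using s v0K by (intro mult_mono sqle) auto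
      ultimately show ?thesis by (simp add: w_def)
    qed
    have \<beta>K: "\<bar>\<beta>\<bar> \<le> 2 * K\<^sup>2 * d"
    proof -
      have "\<bar>F0 \<bullet> G\<bar> \<le> norm F0 * norm G" by (rule Cauchy_Schwarz_ineq2)
      also have "\<dots> \<le> K * (K * d)" using F0K GK assms by (intro mult_mono) auto
      finally have 1: "\<bar>F0 \<bullet> G\<bar> \<le> K\<^sup>2 * d" by (simp add: power2_eq_square mult.assoc)
      have "\<bar>s * v0 * e\<bar> = s * (\<bar>v0\<bar> * \<bar>e\<bar>)" using s by (simp add: abs_mult)
      also have "\<dots> \<le> 1 * (K * (K * d))" using s v0K eK assms d by (intro mult_mono) auto
      finally show ?thesis using 1 unfolding \<beta>_def power2_eq_square by linarith
    qed
    have \<gamma>K: "\<gamma> \<le> 2 * K\<^sup>2 * d"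
    proof -
      have dd: "d\<^sup>2 \<le> d" using d by (simp add: power2_eq_square mult_left_le)
      have "(norm G)\<^sup>2 \<le> (K * d)\<^sup>2" using GK by (simp add: power_mono)
      moreover have "s * e\<^sup>2 \<le> 1 * (K * d)\<^sup>2" using s eK
        by (intro mult_mono sqle) auto
      moreover have "(K * d)\<^sup>2 \<le> K\<^sup>2 * d" using dd by (simp add: power_mult_distrib mult_left_mono)
      ultimately show ?thesis by (simp add: \<gamma>_def)
    qed
    have Kd: "K\<^sup>2 * d \<le> K\<^sup>2" "0 \<le> K\<^sup>2 * d" using d by (simp_all add: mult_left_le)
    define p0 where "p0 = (u0, w)"
    have u0in: "u0 \<in> {a..b}" using u[of "x+d"] u[of "x-d"] by (auto simp: u0_def)
    have p0in: "p0 \<in> {a..b} \<times> {0..9 * K\<^sup>2}" using u0in w0 wK by (simp add: p0_def)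
    have wr: "0 \<le> w + 2 * \<beta> * r + \<gamma> * r\<^sup>2" for r
    proof -
      have "w + 2 * \<beta> * r + \<gamma> * r\<^sup>2 = (norm (F0 + r *\<^sub>R G))\<^sup>2 + s * (v0 + r * e)\<^sup>2"
        unfolding w_def \<beta>_def \<gamma>_def power2_norm_eq_inner
        by (simp add: inner_add_left inner_add_right inner_commute algebra_simps power2_eq_square)
      then show ?thesis using s by simp
    qed
    have wr': "\<bar>2 * \<beta> * r + \<gamma> * r\<^sup>2\<bar> \<le> 6 * K\<^sup>2 * d" if "r \<in> {-1..1}" for r
    proof -
      have "\<bar>2 * \<beta> * r\<bar> \<le> (2 * (2 * K\<^sup>2 * d)) * 1" unfolding abs_mult using \<beta>K that
        by (intro mult_mono) auto
      moreover have "\<bar>\<gamma> * r\<^sup>2\<bar> \<le> (2 * K\<^sup>2 * d) * 1" unfolding abs_mult using \<gamma>K \<gamma>0 that d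
        by (intro mult_mono) (auto simp: abs_square_le_1)
      ultimately show ?thesis by linarith
    qed
    have near: "Ny (z, y) - Ny p0 \<le> L * (D * d) \<and> Ny p0 - Ny (z, y) \<le> L * (D * d)"
      if "z \<in> {a..b}" "0 \<le> y" "\<bar>z - u0\<bar> \<le> K * d" "\<bar>y - w\<bar> \<le> 7 * K\<^sup>2 * d" for z y
    proof -
      have "y \<le> 9 * K\<^sup>2" using abs_le_D1[OF that(4)] wK Kd by linarith
      then have "(z, y) \<in> {a..b} \<times> {0..9 * K\<^sup>2}" using that by simp
      then have "\<bar>Ny (z, y) - Ny p0\<bar> \<le> L * norm ((z, y) - p0)" using L(2) p0in by blast
      also have "norm ((z, y) - p0) \<le> \<bar>z - u0\<bar> + \<bar>y - w\<bar>"
        using norm_Pair_le[of "z - u0" "y - w"] by (simp add: p0_def)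
      also have "\<dots> \<le> D * d" using that by (simp add: D_def algebra_simps)
      finally have "\<bar>Ny (z, y) - Ny p0\<bar> \<le> L * (D * d)" using L(1) by (simp add: mult_left_mono)
      then show ?thesis by linarith
    qed
    have rc: "\<bar>r * c\<bar> \<le> K * d" if "r \<in> {-1..1}" for r
    proof -
      have "\<bar>r * c\<bar> \<le> 1 * (K * d)" unfolding abs_mult using that cK by (intro mult_mono) auto
      then show ?thesis by simp
    qed
    have xin: "u0 + r * c \<in> {a..b}" if "r \<in> {-1..1}" for r
    proof -
      have "\<bar>r * c\<bar> \<le> 1 * \<bar>c\<bar>" unfolding abs_mult using that by (intro mult_right_mono) auto
      then show ?thesis using u[of "x+d"] u[of "x-d"] unfolding upm by (auto simp: abs_if split: if_splits)
    qed
    \<comment> \<open>Here \<open>\<kappa>\<close> is \<open>- Ny\<close> at the centre plus a bound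
      for its change along the curve.\<close>
    have step1: "(N (u0 + c, w + 2 * \<beta> + \<gamma>) + N (u0 - c, w - 2 * \<beta> + \<gamma>)) / 2 \<le> N (u0, w) + (- Ny p0 + L * (D * d)) * c\<^sup>2"
    proof (rule two_point)
      show "u0 + c \<in> {a..b}" "u0 - c \<in> {a..b}" using u[of "x+d"] u[of "x-d"] unfolding upm by auto
      fix r :: real assume r: "r \<in> {-1..1}"
      have "Ny p0 - Ny (u0 + r * c, w + 2 * \<beta> * r + \<gamma> * r\<^sup>2) \<le> L * (D * d)"
        using near[OF xin[OF r] wr[of r]] rc[OF r] wr'[OF r] Kd by auto
      then show "- Ny (u0 + r * c, w + 2 * \<beta> * r + \<gamma> * r\<^sup>2) \<le> - Ny p0 + L * (D * d)" by linarith
    qed (use cs \<gamma>0 w0 in auto)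
    \<comment> \<open>Adding the weight \<open>d\<^sup>2\<close> contributes
      \<open>Ny p0 * c\<^sup>2\<close> up to cubic errors; averaged over the two signs this removes
      the term \<open>- Ny p0 * c\<^sup>2\<close> of \<open>step1\<close>.\<close>
    have main: "N (u z, (norm (F z))\<^sup>2 + (s + d\<^sup>2) * (u' z)\<^sup>2) \<le> N (u z, (norm (F z))\<^sup>2 + s * (u' z)\<^sup>2) + Ny p0 * c\<^sup>2 + L * (4 * K\<^sup>2 * d^3) + (L * D * K\<^sup>2) * d^3"
      if z: "(z = x + d \<and> r = 1) \<or> (z = x - d \<and> r = -1)" for z r :: real
    proof -
      have r: "r \<in> {-1..1}" using z by auto
      have uz: "u z = u0 + r * c" using z upm by auto
      have wz: "(norm (F z))\<^sup>2 + s * (u' z)\<^sup>2 = w + 2 * \<beta> * r + \<gamma> * r\<^sup>2"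
      proof -
        have "F z = F0 + r *\<^sub>R G" "u' z = v0 + r * e" using z Fpm upm by auto
        then show ?thesis unfolding w_def \<beta>_def \<gamma>_def power2_norm_eq_inner
          by (simp add: inner_add_left inner_add_right inner_commute algebra_simps power2_eq_square)
      qed
      have du: "0 \<le> d\<^sup>2 * (u' z)\<^sup>2" "d\<^sup>2 * (u' z)\<^sup>2 \<le> K\<^sup>2 * d\<^sup>2"
        using uK[of z] assms by (auto simp: mult.commute[of "d\<^sup>2"] intro!: mult_right_mono sqle)
      have dd: "K\<^sup>2 * d\<^sup>2 \<le> K\<^sup>2 * d" using d by (intro mult_left_mono) (auto simp: power2_eq_square mult_left_le)
      have "N (u z, ((norm (F z))\<^sup>2 + s * (u' z)\<^sup>2) + d\<^sup>2 * (u' z)\<^sup>2) \<le> N (u z, (norm (F z))\<^sup>2 + s * (u' z)\<^sup>2) + d\<^sup>2 * (u' z)\<^sup>2 * (Ny p0 + L * (D * d))"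
      proof (rule N_increment)
        fix y assume "y \<in> {(norm (F z))\<^sup>2 + s * (u' z)\<^sup>2..(norm (F z))\<^sup>2 + s * (u' z)\<^sup>2 + d\<^sup>2 * (u' z)\<^sup>2}"
        then have y: "w + 2 * \<beta> * r + \<gamma> * r\<^sup>2 \<le> y" "y \<le> w + 2 * \<beta> * r + \<gamma> * r\<^sup>2 + K\<^sup>2 * d" using wz du dd by auto
        have "Ny (u z, y) - Ny p0 \<le> L * (D * d)"
          using near[of "u z" y] u[of z] wr[of r] rc[OF r] y wr'[OF r] Kd unfolding uz by (auto simp: abs_le_iff)
        then show "Ny (u z, y) \<le> Ny p0 + L * (D * d)" by linarith
      qed (use u s du in auto)
      moreover have "d\<^sup>2 * (u' z)\<^sup>2 * (L * (D * d)) \<le> (K\<^sup>2 * d\<^sup>2) * (L * (D * d))"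
        using du L D d by (intro mult_right_mono) auto
      moreover have "Ny p0 * (d\<^sup>2 * (u' z)\<^sup>2) \<le> Ny p0 * c\<^sup>2 + L * (4 * K\<^sup>2 * d^3)"
      proof -
        have cd: "\<bar>c - d * u' z\<bar> \<le> 2 * K * d\<^sup>2"
        proof -
          \<comment> \<open>The Taylor bound is taken from \<open>z\<close> to the opposite outcome
            of the flip.\<close>
          have "\<bar>u (z + (- 2 * r * d)) - u z - (- 2 * r * d) * u' z\<bar> \<le> K * (- 2 * r * d)\<^sup>2" using A by blast
          then show ?thesis using z by (auto simp: c_def power_mult_distrib abs_if field_simps split: if_splits)
        qed
        have cd2: "\<bar>c + d * u' z\<bar> \<le> 2 * K * d"
        proof -
          have "\<bar>d * u' z\<bar> \<le> d * K" unfolding abs_mult using uK[of z] d by (intro mult_mono) auto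
          moreover have "2 * K * d = K * d + d * K" by simp
          ultimately show ?thesis using cK abs_triangle_ineq[of c "d * u' z"] by linarith
        qed
        have "c\<^sup>2 - d\<^sup>2 * (u' z)\<^sup>2 = (c - d * u' z) * (c + d * u' z)"
          by (simp add: algebra_simps power2_eq_square)
        then have "\<bar>c\<^sup>2 - d\<^sup>2 * (u' z)\<^sup>2\<bar> = \<bar>c - d * u' z\<bar> * \<bar>c + d * u' z\<bar>"
          by (simp add: abs_mult)
        also have "\<dots> \<le> (2 * K * d\<^sup>2) * (2 * K * d)" using cd cd2 assms d by (intro mult_mono) auto
        also have "\<dots> = 4 * K\<^sup>2 * d^3" by (simp add: power2_eq_square power3_eq_cube)
        finally have *: "\<bar>c\<^sup>2 - d\<^sup>2 * (u' z)\<^sup>2\<bar> \<le> 4 * K\<^sup>2 * d^3" .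
        have "Ny p0 * (d\<^sup>2 * (u' z)\<^sup>2 - c\<^sup>2) \<le> \<bar>Ny p0\<bar> * \<bar>c\<^sup>2 - d\<^sup>2 * (u' z)\<^sup>2\<bar>"
          using abs_ge_self[of "Ny p0 * (d\<^sup>2 * (u' z)\<^sup>2 - c\<^sup>2)"] by (simp add: abs_mult abs_minus_commute)
        also have "\<dots> \<le> L * (4 * K\<^sup>2 * d^3)" using L(3)[OF p0in] * L(1) by (intro mult_mono) auto
        finally show ?thesis by (simp add: algebra_simps)
      qed
      ultimately show ?thesis by (simp add: algebra_simps power2_eq_square power3_eq_cube)
    qed
    have plus: "(norm (F (x+d)))\<^sup>2 + s * (u' (x+d))\<^sup>2 = w + 2 * \<beta> + \<gamma>" 
      unfolding Fpm upm w_def \<beta>_def \<gamma>_def power2_norm_eq_inner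
      by (simp add: inner_add_left inner_add_right inner_commute algebra_simps power2_eq_square)
    have minus: "(norm (F (x-d)))\<^sup>2 + s * (u' (x-d))\<^sup>2 = w - 2 * \<beta> + \<gamma>" 
      unfolding Fpm upm w_def \<beta>_def \<gamma>_def power2_norm_eq_inner
      by (simp add: inner_diff_left inner_diff_right inner_commute algebra_simps power2_eq_square)
    have "two_point_avg d (\<lambda>x. N (u x, (norm (F x))\<^sup>2 + (s + d\<^sup>2) * (u' x)\<^sup>2)) x
       \<le> (N (u0 + c, w + 2 * \<beta> + \<gamma>) + N (u0 - c, w - 2 * \<beta> + \<gamma>)) / 2 + Ny p0 * c\<^sup>2 + L * (4 * K\<^sup>2 * d^3) + (L * D * K\<^sup>2) * d^3"
      using main[of "x+d" 1, OF disjI1[OF conjI[OF refl refl]]] main[of "x-d" "-1", OF disjI2[OF conjI[OF refl refl]]]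
      unfolding plus minus unfolding two_point_avg_def upm real_scaleR_def by argo
    also have "\<dots> \<le> N (u0, w) + L * (D * d) * c\<^sup>2 + L * (4 * K\<^sup>2 * d^3) + (L * D * K\<^sup>2) * d^3"
      using step1 unfolding distrib_right mult_minus_left by argo
    also have "\<dots> \<le> N (u0, w) + L * (D * d) * (K * d)\<^sup>2 + L * (4 * K\<^sup>2 * d^3) + (L * D * K\<^sup>2) * d^3"
      using cK L D d assms by (intro add_right_mono add_left_mono mult_left_mono sqle) auto
    also have "\<dots> = N (u0, w) + C * d^3"
      by (simp add: C_def algebra_simps power2_eq_square power3_eq_cube)
    finally show "two_point_avg d (\<lambda>x. N (u x, (norm (F x))\<^sup>2 + (s + d\<^sup>2) * (u' x)\<^sup>2)) x
      \<le> N (two_point_avg d u x, (norm (two_point_avg d F x))\<^sup>2 + s * (two_point_avg d u' x)\<^sup>2) + C * d^3"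
      by (simp add: two_point_avg_def u0_def w_def F0_def v0_def)
  qed
qed

text \<open>Each flip removes \<open>d\<^sup>2\<close> from the weight of the squared derivative at
  the cost \<open>C * d^3\<close>. The innermost flip is taken first, so the induction hypothesis is
  applied to averaged data, to which \<open>lipschitz_data_avg\<close> gives the same
  \<open>K\<close>.\<close>

lemma two_point_iterate:
  fixes K :: real
  assumes "K \<ge> 0"
  obtains C where "C \<ge> 0" "\<And>u u' (F :: real \<Rightarrow> 'v::real_inner) d s m x. \<lbrakk>lipschitz_data K u u' F; \<And>x. u x \<in> {a..b}; 0 \<le> d; d \<le> 1; 0 \<le> s; s + real m * d\<^sup>2 \<le> 1\<rbrakk> \<Longrightarrow>
    (two_point_avg d ^^ m) (\<lambda>x. N (u x, (norm (F x))\<^sup>2 + (s + real m * d\<^sup>2) * (u' x)\<^sup>2)) x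
      \<le> N ((two_point_avg d ^^ m) u x, (norm ((two_point_avg d ^^ m) F x))\<^sup>2 + s * ((two_point_avg d ^^ m) u' x)\<^sup>2) + real m * (C * d^3)"
proof (rule two_point_step[OF assms, where 'v = 'v])
  fix C assume C: "C \<ge> 0" "\<And>u u' (F :: real \<Rightarrow> 'v::real_inner) d s x. \<lbrakk>lipschitz_data K u u' F; \<And>x. u x \<in> {a..b}; 0 \<le> d; d \<le> 1; 0 \<le> s; s \<le> 1\<rbrakk> \<Longrightarrow>
    two_point_avg d (\<lambda>x. N (u x, (norm (F x))\<^sup>2 + (s + d\<^sup>2) * (u' x)\<^sup>2)) x
      \<le> N (two_point_avg d u x, (norm (two_point_avg d F x))\<^sup>2 + s * (two_point_avg d u' x)\<^sup>2) + C * d^3"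
  show thesis
  proof (rule that[OF C(1)])
    fix u u' and F :: "real \<Rightarrow> 'v" and d s :: real and m x
    assume "lipschitz_data K u u' F" "\<And>x. u x \<in> {a..b}" "0 \<le> d" "d \<le> 1" "0 \<le> s" "s + real m * d\<^sup>2 \<le> 1"
    then show "(two_point_avg d ^^ m) (\<lambda>x. N (u x, (norm (F x))\<^sup>2 + (s + real m * d\<^sup>2) * (u' x)\<^sup>2)) x
      \<le> N ((two_point_avg d ^^ m) u x, (norm ((two_point_avg d ^^ m) F x))\<^sup>2 + s * ((two_point_avg d ^^ m) u' x)\<^sup>2) + real m * (C * d^3)"
    proof (induction m arbitrary: u u' F x)
      case 0
      then show ?case by simp
    next
      case (Suc m)
      have sm: "0 \<le> s + real m * d\<^sup>2" "s + real m * d\<^sup>2 \<le> 1" 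
        using Suc.prems by (auto simp: algebra_simps intro: order_trans[rotated])
      have "(two_point_avg d ^^ Suc m) (\<lambda>x. N (u x, (norm (F x))\<^sup>2 + (s + real (Suc m) * d\<^sup>2) * (u' x)\<^sup>2)) x
         = (two_point_avg d ^^ m) (two_point_avg d (\<lambda>x. N (u x, (norm (F x))\<^sup>2 + ((s + real m * d\<^sup>2) + d\<^sup>2) * (u' x)\<^sup>2))) x"
        by (simp only: funpow_Suc_right o_apply) (simp add: algebra_simps)
      also have "\<dots> \<le> (two_point_avg d ^^ m) (\<lambda>x. N (two_point_avg d u x, (norm (two_point_avg d F x))\<^sup>2 + (s + real m * d\<^sup>2) * (two_point_avg d u' x)\<^sup>2)) x + C * d^3"
        by (rule two_point_avg_funpow_mono) (use C(2) Suc.prems sm in auto)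
      also have "\<dots> \<le> N ((two_point_avg d ^^ m) (two_point_avg d u) x, (norm ((two_point_avg d ^^ m) (two_point_avg d F) x))\<^sup>2 + s * ((two_point_avg d ^^ m) (two_point_avg d u') x)\<^sup>2) + real m * (C * d^3) + C * d^3"
        using Suc.IH[OF lipschitz_data_avg[OF Suc.prems(1)] two_point_avg_in_interval[OF Suc.prems(2)] Suc.prems(3-5) sm(2)]
        by simp
      finally show ?case by (simp only: funpow_Suc_right o_apply) (simp add: algebra_simps)
    qed
  qed
qed

end

section \<open>The one-dimensional Gaussian inequality\<close>

primrec coin_walk :: "real \<Rightarrow> nat \<Rightarrow> real pmf" where
  "coin_walk d 0 = return_pmf 0"
| "coin_walk d (Suc m) = pmf_of_set (UNIV :: bool set) \<bind> (\<lambda>c. map_pmf (\<lambda>y. y + (if c then d else - d)) (coin_walk d m))"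

lemma finite_set_coin_walk: "finite (set_pmf (coin_walk d m))"
  by (induction m) auto

text \<open>Reads an iterated average as an expectation over a sum of independent signs, to which
  the central limit theorem applies.\<close>

lemma expectation_coin_walk:
  fixes \<phi> :: "real \<Rightarrow> 'v::{banach, second_countable_topology}"
  shows "measure_pmf.expectation (coin_walk d m) (\<lambda>y. \<phi> (x + y)) = (two_point_avg d ^^ m) \<phi> x"
proof (induction m arbitrary: x)
  case 0
  then show ?case by simp
next
  case (Suc m)
  have "measure_pmf.expectation (coin_walk d (Suc m)) (\<lambda>y. \<phi> (x + y)) = 
     (\<Sum>c\<in>UNIV. measure_pmf.expectation (map_pmf (\<lambda>y. y + (if c then d else - d)) (coin_walk d m)) (\<lambda>y. \<phi> (x + y)) /\<^sub>R real (card (UNIV :: bool set)))"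
    unfolding coin_walk.simps by (rule pmf_expectation_bind_pmf_of_set) (auto simp: finite_set_coin_walk)
  also have "\<dots> = (1/2) *\<^sub>R (measure_pmf.expectation (coin_walk d m) (\<lambda>y. \<phi> ((x + d) + y)) + measure_pmf.expectation (coin_walk d m) (\<lambda>y. \<phi> ((x - d) + y)))"
    by (simp add: UNIV_bool algebra_simps)
  also have "\<dots> = two_point_avg d ((two_point_avg d ^^ m) \<phi>) x"
    unfolding Suc.IH by (subst two_point_avg_def) simp
  finally show ?case by simp
qed

text \<open>The exponential is an eigenfunction of the average with eigenvalue
  \<open>cos (t * d)\<close>; at \<open>x = 0\<close> this yields the characteristic function of the
  walk.\<close>

lemma two_point_avg_iexp_funpow: "(two_point_avg d ^^ m) (\<lambda>x. iexp (t * x)) x = of_real (cos (t * d) ^ m) * iexp (t * x)"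
proof (induction m arbitrary: x)
  case (Suc m)
  have e: "iexp (t * d) + iexp (- t * d) = 2 * of_real (cos (t * d))"
    unfolding cos_of_real[symmetric] using cos_exp_eq[of "of_real (t * d)"] by (simp add: field_simps)
  have "(two_point_avg d ^^ Suc m) (\<lambda>x. iexp (t * x)) x = two_point_avg d ((two_point_avg d ^^ m) (\<lambda>x. iexp (t * x))) x"
    by simp
  also have "\<dots> = of_real (cos (t * d) ^ m) * ((iexp (t * x) * iexp (t * d) + iexp (t * x) * iexp (- t * d)) / 2)"
    unfolding two_point_avg_def Suc.IH
    by (simp add: algebra_simps scaleR_conv_of_real flip: exp_add)
  also have "(iexp (t * x) * iexp (t * d) + iexp (t * x) * iexp (- t * d)) / 2 = of_real (cos (t * d)) * iexp (t * x)"
    unfolding distrib_left[symmetric] e by simp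
  finally show ?case by (simp add: mult_ac)
qed simp

lemma cos_power_tendsto: "(\<lambda>n. cos (t / sqrt (real n)) ^ n) \<longlonglongrightarrow> exp (- t\<^sup>2 / 2)"
proof (cases "t = 0")
  case False
  have *: "(\<lambda>n. cos (s / sqrt (real n)) ^ n) \<longlonglongrightarrow> exp (- s\<^sup>2 / 2)" if "s > 0" for s
    using that by (real_asymp simp: power2_eq_square)
  show ?thesis using *[of "\<bar>t\<bar>"] False by (cases "t > 0") auto
qed simp

text \<open>By Levy's continuity theorem, the convergence of the characteristic functions
  \<open>cos (t / sqrt m) ^ m\<close> to that of the normal law gives weak convergence, hence
  convergence for bounded continuous test functions.\<close>

lemma two_point_avg_funpow_tendsto_normal:
  fixes \<phi> :: "real \<Rightarrow> 'v::{banach, second_countable_topology}"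
  assumes cont: "continuous_on UNIV \<phi>" and bdd: "\<And>x. norm (\<phi> x) \<le> B"
  shows "(\<lambda>m. (two_point_avg (1 / sqrt (real m)) ^^ m) \<phi> 0) \<longlonglongrightarrow> (\<integral>x. \<phi> x \<partial>std_normal_distribution)"
proof -
  \<comment> \<open>The law is moved from the discrete sigma-algebra of a pmf to
    \<open>borel\<close>, where weak convergence is formulated.\<close>
  define \<nu> where "\<nu> m = distr (measure_pmf (coin_walk (1 / sqrt (real m)) m)) borel (\<lambda>x. x)" for m
  have E: "(\<integral>x. h x \<partial>\<nu> m) = (two_point_avg (1 / sqrt (real m)) ^^ m) h 0"
    if "continuous_on UNIV h" for m and h :: "real \<Rightarrow> 'w::{banach, second_countable_topology}"
  proof -
    have [measurable]: "h \<in> borel_measurable borel" using that by (rule borel_measurable_continuous_onI)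
    have "(\<integral>x. h x \<partial>\<nu> m) = measure_pmf.expectation (coin_walk (1 / sqrt (real m)) m) (\<lambda>y. h (0 + y))"
      unfolding \<nu>_def by (subst integral_distr) auto
    then show ?thesis by (simp only: expectation_coin_walk)
  qed
  have rd: "real_distribution (\<nu> m)" for m
    unfolding \<nu>_def real_distribution_def real_distribution_axioms_def
    by (auto intro!: measure_pmf.prob_space_distr)
  have "weak_conv_m \<nu> std_normal_distribution"
  proof (rule levy_continuity[OF rd real_dist_normal_dist])
    fix t
    have "char (\<nu> m) t = of_real (cos (t / sqrt (real m)) ^ m)" for m
      unfolding char_def by (subst E) (auto intro!: continuous_intros simp: two_point_avg_iexp_funpow[of _ _ t 0, simplified])
    then show "(\<lambda>m. char (\<nu> m) t) \<longlonglongrightarrow> char std_normal_distribution t"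
      unfolding char_std_normal_distribution using tendsto_of_real[OF cos_power_tendsto[of t], where 'a = complex] by simp
  qed
  then have "(\<lambda>m. \<integral>x. \<phi> x \<partial>\<nu> m) \<longlonglongrightarrow> (\<integral>x. \<phi> x \<partial>std_normal_distribution)"
    using cont by (intro weak_conv_imp_integral_bdd_continuous_conv[OF rd real_dist_normal_dist _ _ bdd])
      (auto simp: continuous_on_eq_continuous_at)
  then show ?thesis by (simp add: E[OF cont])
qed

lemma abs_le_interval: "x \<in> {a..b} \<Longrightarrow> \<bar>x\<bar> \<le> \<bar>a\<bar> + \<bar>b\<bar>" for x a b :: real
  by (auto simp: abs_if)

lemma two_point_avg_funpow_in_interval:
  fixes u :: "real \<Rightarrow> real"
  assumes "\<And>x. u x \<in> {a..b}" shows "(two_point_avg d ^^ m) u x \<in> {a..b}"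
proof (induction m arbitrary: x)
  case 0
  show ?case using assms by simp
next
  case (Suc m)
  show ?case unfolding funpow.simps o_apply by (rule two_point_avg_in_interval) (rule Suc.IH)
qed

context bellman begin

text \<open>With \<open>d = 1 / sqrt m\<close>, the \<open>m\<close> flips use up the weight
  \<open>m * d\<^sup>2 = 1\<close> and cost \<open>m * (C * d^3) = C / sqrt m\<close>, which
  vanishes in the limit.\<close>

lemma gaussian_inequality_lipschitz:
  fixes F :: "real \<Rightarrow> 'v::euclidean_space"
  assumes data: "lipschitz_data K u u' F" and u: "\<And>x. u x \<in> {a..b}"
  shows "(\<integral>y. N (u y, (norm (F y))\<^sup>2 + (u' y)\<^sup>2) \<partial>std_normal_distribution)
    \<le> N (\<integral>y. u y \<partial>std_normal_distribution, (norm (\<integral>y. F y \<partial>std_normal_distribution))\<^sup>2)"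
proof -
  note A = data[unfolded lipschitz_data_def]
  have K: "K \<ge> 0" using A by (meson abs_ge_zero order_trans)
  have lip: "continuous_on UNIV f" if "\<And>x t. norm (f (x + t) - f x) \<le> K * \<bar>t\<bar>" for f :: "real \<Rightarrow> 'w::real_normed_vector"
  proof -
    have "norm (f y - f x) \<le> K * norm (y - x)" for x y using that[of x "y - x"] by simp
    then have "K-lipschitz_on UNIV f"
      by (intro lipschitz_onI[OF _ K]) (simp add: dist_norm)
    then show ?thesis by (rule lipschitz_on_continuous_on)
  qed
  have cont: "continuous_on UNIV u" "continuous_on UNIV u'" "continuous_on UNIV F"
    using A by (auto intro!: lip)
  obtain C where C: "C \<ge> 0" "\<And>d s m x. \<lbrakk>0 \<le> d; d \<le> 1; 0 \<le> s; s + real m * d\<^sup>2 \<le> 1\<rbrakk> \<Longrightarrow>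
    (two_point_avg d ^^ m) (\<lambda>x. N (u x, (norm (F x))\<^sup>2 + (s + real m * d\<^sup>2) * (u' x)\<^sup>2)) x
      \<le> N ((two_point_avg d ^^ m) u x, (norm ((two_point_avg d ^^ m) F x))\<^sup>2 + s * ((two_point_avg d ^^ m) u' x)\<^sup>2) + real m * (C * d^3)"
  proof (rule two_point_iterate[OF K, where 'v = 'v])
    fix C assume "C \<ge> 0" and *: "\<And>u u' (F :: real \<Rightarrow> 'v) d s m x. \<lbrakk>lipschitz_data K u u' F; \<And>x. u x \<in> {a..b}; 0 \<le> d; d \<le> 1; 0 \<le> s; s + real m * d\<^sup>2 \<le> 1\<rbrakk> \<Longrightarrow>
    (two_point_avg d ^^ m) (\<lambda>x. N (u x, (norm (F x))\<^sup>2 + (s + real m * d\<^sup>2) * (u' x)\<^sup>2)) x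
      \<le> N ((two_point_avg d ^^ m) u x, (norm ((two_point_avg d ^^ m) F x))\<^sup>2 + s * ((two_point_avg d ^^ m) u' x)\<^sup>2) + real m * (C * d^3)"
    show thesis by (rule that[OF \<open>C \<ge> 0\<close>]) (rule *[OF data u])
  qed
  define \<Phi> where "\<Phi> = (\<lambda>y. N (u y, (norm (F y))\<^sup>2 + (u' y)\<^sup>2))"
  have inS: "(u y, (norm (F y))\<^sup>2 + (u' y)\<^sup>2) \<in> {a..b} \<times> {0..2 * K\<^sup>2}" for y
  proof -
    have "(norm (F y))\<^sup>2 \<le> K\<^sup>2" using A by (simp add: power_mono)
    moreover have "\<bar>u' y\<bar>\<^sup>2 \<le> K\<^sup>2" using A by (intro power_mono) auto
    ultimately show ?thesis using u[of y] by auto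
  qed
  have cK: "continuous_on ({a..b} \<times> {0..2 * K\<^sup>2}) N"
    using cont_N by (rule continuous_on_subset) (auto simp: S_def)
  have cont\<Phi>: "continuous_on UNIV \<Phi>" unfolding \<Phi>_def
    by (rule continuous_on_compose2[OF cK]) (use inS in \<open>auto intro!: continuous_intros cont\<close>)
  have "bounded (N ` ({a..b} \<times> {0..2 * K\<^sup>2}))"
    by (intro compact_imp_bounded compact_continuous_image cK compact_Times compact_Icc)
  then obtain B where B: "\<And>p. p \<in> {a..b} \<times> {0..2 * K\<^sup>2} \<Longrightarrow> norm (N p) \<le> B"
    unfolding bounded_iff by blast
  let ?d = "\<lambda>m::nat. 1 / sqrt (real m)"
  have l1: "(\<lambda>m. (two_point_avg (?d m) ^^ m) \<Phi> 0) \<longlonglongrightarrow> (\<integral>y. \<Phi> y \<partial>std_normal_distribution)"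
    by (rule two_point_avg_funpow_tendsto_normal[OF cont\<Phi>, of B]) (use B inS in \<open>auto simp: \<Phi>_def\<close>)
  have l2: "(\<lambda>m. (two_point_avg (?d m) ^^ m) u 0) \<longlonglongrightarrow> (\<integral>y. u y \<partial>std_normal_distribution)"
    by (rule two_point_avg_funpow_tendsto_normal[OF cont(1), of "\<bar>a\<bar> + \<bar>b\<bar>"]) (use u abs_le_interval in auto)
  have l3: "(\<lambda>m. (two_point_avg (?d m) ^^ m) F 0) \<longlonglongrightarrow> (\<integral>y. F y \<partial>std_normal_distribution)"
    by (rule two_point_avg_funpow_tendsto_normal[OF cont(3), of K]) (use A in auto)
  have ab': "(two_point_avg d ^^ m) u x \<in> {a..b}" for d m x
    using u by (rule two_point_avg_funpow_in_interval)
  have lim_in: "(\<integral>y. u y \<partial>std_normal_distribution) \<in> {a..b}"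
    using l2 ab' by (intro Lim_in_closed_set[OF closed_atLeastAtMost _ _ l2]) auto
  have l4: "(\<lambda>m. N ((two_point_avg (?d m) ^^ m) u 0, (norm ((two_point_avg (?d m) ^^ m) F 0))\<^sup>2))
     \<longlonglongrightarrow> N (\<integral>y. u y \<partial>std_normal_distribution, (norm (\<integral>y. F y \<partial>std_normal_distribution))\<^sup>2)"
    by (rule continuous_on_tendsto_compose[OF cont_N])
      (use ab' lim_in in \<open>auto intro!: tendsto_intros l2 l3 simp: S_def\<close>)
  have "(\<lambda>m. C * ?d m) \<longlonglongrightarrow> C * 0"
    by (intro tendsto_mult tendsto_const) real_asymp
  from tendsto_add[OF l4 this] have l5: "(\<lambda>m. N ((two_point_avg (?d m) ^^ m) u 0, (norm ((two_point_avg (?d m) ^^ m) F 0))\<^sup>2) + C * ?d m)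
     \<longlonglongrightarrow> N (\<integral>y. u y \<partial>std_normal_distribution, (norm (\<integral>y. F y \<partial>std_normal_distribution))\<^sup>2)"
    by (simp only: mult_zero_right add_0_right)
  have "(two_point_avg (?d m) ^^ m) \<Phi> 0 \<le> N ((two_point_avg (?d m) ^^ m) u 0, (norm ((two_point_avg (?d m) ^^ m) F 0))\<^sup>2) + C * ?d m"
    if "m \<ge> 1" for m
  proof -
    have md: "real m * (?d m)\<^sup>2 = 1" using that by (simp add: power_divide)
    have "real m * (C * (?d m)^3) = C * ?d m * (real m * (?d m)\<^sup>2)" by (simp add: power2_eq_square power3_eq_cube)
    then have eq: "real m * (C * (?d m)^3) = C * ?d m" unfolding md by simp
    have d1: "0 \<le> ?d m" "?d m \<le> 1" "0 + real m * (?d m)\<^sup>2 \<le> 1" using that md by (auto simp: divide_le_eq)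
    have "(two_point_avg (?d m) ^^ m) (\<lambda>x. N (u x, (norm (F x))\<^sup>2 + (0 + real m * (?d m)\<^sup>2) * (u' x)\<^sup>2)) 0
      \<le> N ((two_point_avg (?d m) ^^ m) u 0, (norm ((two_point_avg (?d m) ^^ m) F 0))\<^sup>2 + 0 * ((two_point_avg (?d m) ^^ m) u' 0)\<^sup>2) + real m * (C * (?d m)^3)"
      by (rule C(2)[OF d1(1,2) order_refl d1(3)])
    then show ?thesis unfolding eq md \<Phi>_def by (simp only: add_0_left mult_1 mult_zero_left add_0_right)
  qed
  then have "(\<integral>y. \<Phi> y \<partial>std_normal_distribution) \<le> N (\<integral>y. u y \<partial>std_normal_distribution, (norm (\<integral>y. F y \<partial>std_normal_distribution))\<^sup>2)"
    by (intro LIMSEQ_le[OF l1 l5] exI[of _ 1]) simp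
  then show ?thesis by (simp add: \<Phi>_def)
qed

end

section \<open>From Lipschitz derivatives to continuous bounded derivatives\<close>

lemma antiderivative_exists:
  fixes f :: "real \<Rightarrow> 'v::euclidean_space"
  assumes "continuous_on UNIV f"
  obtains G where "\<And>x. (G has_vector_derivative f x) (at x)"
proof
  fix x :: real
  define c where "c = \<bar>x\<bar> + 1"
  have "((\<lambda>u. LBINT y=0..u. f y) has_vector_derivative f x) (at x within {-c..c})"
    by (rule interval_integral_FTC2[of "-c" 0 c, unfolded zero_ereal_def[symmetric]]) (use assms in \<open>auto simp: c_def intro: continuous_on_subset\<close>)
  moreover have "at x within {-c..c} = at x"
    by (rule at_within_interior) (simp add: c_def abs_if)
  ultimately show "((\<lambda>u. LBINT y=0..u. f y) has_vector_derivative f x) (at x)" by simp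
qed

lemma symmetric_difference_quotient_tendsto:
  fixes G :: "real \<Rightarrow> 'v::real_normed_vector"
  assumes "(G has_vector_derivative g) (at x)" and e: "e \<longlonglongrightarrow> 0" "\<And>n::nat. e n > 0"
  shows "(\<lambda>n. (1 / (2 * e n)) *\<^sub>R (G (x + e n) - G (x - e n))) \<longlonglongrightarrow> g"
proof -
  define r where "r h = norm (G (x + h) - G x - h *\<^sub>R g) / norm h" for h
  have "r 0 = 0" by (simp add: r_def)
  moreover have "r \<midarrow>0\<rightarrow> 0" using assms(1) unfolding has_vector_derivative_def has_derivative_at r_def by simp
  ultimately have r0: "r \<midarrow>0\<rightarrow> r 0" by simp
  have "(\<lambda>n. r (e n)) \<longlonglongrightarrow> r 0" "(\<lambda>n. r (- e n)) \<longlonglongrightarrow> r 0"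
    using tendsto_compose[OF r0] e(1) tendsto_minus[OF e(1)] by auto
  from tendsto_add[OF this] have "(\<lambda>n. r (e n) + r (- e n)) \<longlonglongrightarrow> 0" using \<open>r 0 = 0\<close> by simp
  then have "(\<lambda>n. (1 / (2 * e n)) *\<^sub>R (G (x + e n) - G (x - e n)) - g) \<longlonglongrightarrow> 0"
  proof (rule Lim_null_comparison[rotated], intro always_eventually allI)
    fix n
    have en: "e n > 0" by fact
    have "(1 / (2 * e n)) *\<^sub>R (G (x + e n) - G (x - e n)) - g
      = (1 / (2 * e n)) *\<^sub>R ((G (x + e n) - G x - e n *\<^sub>R g) - (G (x + (- e n)) - G x - (- e n) *\<^sub>R g))"
      using en by (simp add: algebra_simps) (simp flip: scaleR_add_left)
    also have "norm \<dots> \<le> (1 / (2 * e n)) * (norm (G (x + e n) - G x - e n *\<^sub>R g) + norm (G (x + (- e n)) - G x - (- e n) *\<^sub>R g))"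
      unfolding norm_scaleR using en by (intro mult_mono norm_triangle_ineq4) auto
    also have "\<dots> = (r (e n) + r (- e n)) / 2"
      using en by (simp add: r_def field_simps)
    also have "\<dots> \<le> r (e n) + r (- e n)"
    proof -
      have "r h \<ge> 0" for h by (simp add: r_def)
      from this[of "e n"] this[of "- e n"] show ?thesis by argo
    qed
    finally show "norm ((1 / (2 * e n)) *\<^sub>R (G (x + e n) - G (x - e n)) - g) \<le> r (e n) + r (- e n)" .
  qed
  then show ?thesis by (simp add: LIM_zero_iff)
qed

lemma vector_derivative_lipschitz:
  fixes G :: "real \<Rightarrow> 'v::real_normed_vector"
  assumes "\<And>x. (G has_vector_derivative g x) (at x)" "\<And>x. norm (g x) \<le> K"
  shows "norm (G x - G y) \<le> K * \<bar>x - y\<bar>"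
proof -
  have "norm (G x - G y) \<le> K * norm (x - y)"
  proof (rule differentiable_bound[of UNIV])
    show "(G has_derivative (\<lambda>h. h *\<^sub>R g z)) (at z within UNIV)" for z
      using assms(1)[of z] by (simp add: has_vector_derivative_def)
    show "onorm (\<lambda>h. h *\<^sub>R g z) \<le> K" for z
    proof (rule onorm_le)
      fix h :: real
      show "norm (h *\<^sub>R g z) \<le> K * norm h"
        using mult_left_mono[OF assms(2)[of z] abs_ge_zero[of h]] by (simp add: mult.commute)
    qed
  qed auto
  then show ?thesis by simp
qed

lemma mean_value_increment:
  fixes f :: "real \<Rightarrow> real"
  assumes "\<And>x. (f has_real_derivative f' x) (at x)"
  obtains \<xi> where "\<bar>\<xi> - x\<bar> \<le> \<bar>t\<bar>" "f (x + t) - f x = t * f' \<xi>"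
proof (cases t "0::real" rule: linorder_cases)
  case less
  then obtain z where "z > x + t" "z < x" "f x - f (x + t) = (x - (x + t)) * f' z"
    using MVT2[of "x + t" x f f'] assms by auto
  then show ?thesis by (intro that[of z]) auto
next
  case greater
  then obtain z where "z > x" "z < x + t" "f (x + t) - f x = (x + t - x) * f' z"
    using MVT2[of x "x + t" f f'] assms by auto
  then show ?thesis by (intro that[of z]) auto
qed (use that[of x] in auto)

text \<open>Averaging over \<open>{x - e..x + e}\<close>, written with the antiderivatives
  \<open>U\<close> and \<open>\<Gamma>\<close>, makes a bounded derivative Lipschitz: the average of
  \<open>u'\<close> is a difference quotient of the Lipschitz function \<open>u\<close>. The
  constant grows like \<open>K / e\<close>, which is harmless because
  \<open>gaussian_inequality_lipschitz\<close> has no constant in its conclusion.\<close>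

lemma box_mollification_lipschitz_data:
  fixes u u' U :: "real \<Rightarrow> real" and F \<Gamma> :: "real \<Rightarrow> 'v::euclidean_space"
  assumes u': "\<And>x. (u has_real_derivative u' x) (at x)" "\<And>x. \<bar>u' x\<bar> \<le> K"
    and U: "\<And>x. (U has_real_derivative u x) (at x)"
    and \<Gamma>: "\<And>x. (\<Gamma> has_vector_derivative F x) (at x)" "\<And>x. norm (F x) \<le> K"
    and e: "e > 0"
  shows "lipschitz_data (K / e + K) (\<lambda>x. (U (x + e) - U (x - e)) / (2 * e)) (\<lambda>x. (u (x + e) - u (x - e)) / (2 * e))
    (\<lambda>x. (1 / (2 * e)) *\<^sub>R (\<Gamma> (x + e) - \<Gamma> (x - e)))"
proof -
  have K: "K \<ge> 0" using u'(2)[of 0] by simp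
  have ul: "\<bar>u x - u y\<bar> \<le> K * \<bar>x - y\<bar>" for x y
    using vector_derivative_lipschitz[of u u' K] u' by (simp add: has_real_derivative_iff_has_vector_derivative)
  have Gl: "norm (\<Gamma> x - \<Gamma> y) \<le> K * \<bar>x - y\<bar>" for x y
    using vector_derivative_lipschitz[OF \<Gamma>] .
  define un where "un = (\<lambda>x. (U (x + e) - U (x - e)) / (2 * e))"
  define vn where "vn = (\<lambda>x. (u (x + e) - u (x - e)) / (2 * e))"
  define Fn where "Fn = (\<lambda>x. (1 / (2 * e)) *\<^sub>R (\<Gamma> (x + e) - \<Gamma> (x - e)))"
  have dun: "(un has_real_derivative vn x) (at x)" for x
  proof -
    have "((\<lambda>x. U (x + c)) has_real_derivative u (x + c)) (at x)" for c
      using U[of "x + c"] by (simp add: DERIV_shift)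
    from DERIV_cdivide[OF DERIV_diff[OF this[of e] this[of "- e"]], of "2 * e"]
    show ?thesis by (simp add: un_def vn_def)
  qed
  have vnK: "\<bar>vn x\<bar> \<le> K" for x
    using ul[of "x + e" "x - e"] e by (simp add: vn_def abs_divide divide_le_eq)
  have vnl: "\<bar>vn (x + t) - vn x\<bar> \<le> K / e * \<bar>t\<bar>" for x t
  proof -
    have "vn (x + t) - vn x = ((u (x + t + e) - u (x + e)) - (u (x + t - e) - u (x - e))) / (2 * e)"
      by (simp add: vn_def diff_divide_distrib)
    then have "\<bar>vn (x + t) - vn x\<bar> = \<bar>(u (x + t + e) - u (x + e)) - (u (x + t - e) - u (x - e))\<bar> / (2 * e)"
      using e by (simp add: abs_divide)
    moreover have "\<bar>(u (x + t + e) - u (x + e)) - (u (x + t - e) - u (x - e))\<bar> \<le> 2 * (K * \<bar>t\<bar>)"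
      using ul[of "x + t + e" "x + e"] ul[of "x + t - e" "x - e"] by simp
    ultimately have "\<bar>vn (x + t) - vn x\<bar> \<le> 2 * (K * \<bar>t\<bar>) / (2 * e)"
      using divide_right_mono[of _ "2 * (K * \<bar>t\<bar>)" "2 * e"] e by (simp only:)
    then show ?thesis by simp
  qed
  have KK: "K \<le> K / e + K" "K / e \<le> K / e + K" using K e by auto
  have sc: "B * y \<le> (K / e + K) * y" if "B \<le> K / e + K" "y \<ge> 0" for B y using that by (rule mult_right_mono)
  have "lipschitz_data (K / e + K) un vn Fn"
    unfolding lipschitz_data_def
  proof (intro conjI allI)
    fix x t :: real
    show "\<bar>vn x\<bar> \<le> K / e + K" using vnK[of x] KK by linarith
    have "norm (Fn x) \<le> K" using Gl[of "x + e" "x - e"] e by (simp add: Fn_def divide_le_eq)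
    then show "norm (Fn x) \<le> K / e + K" using KK by linarith
    show "\<bar>un (x + t) - un x\<bar> \<le> (K / e + K) * \<bar>t\<bar>"
      using vector_derivative_lipschitz[of un vn K "x + t" x] dun vnK sc[OF KK(1), of "\<bar>t\<bar>"]
      by (simp add: has_real_derivative_iff_has_vector_derivative)
    show "\<bar>vn (x + t) - vn x\<bar> \<le> (K / e + K) * \<bar>t\<bar>"
      using vnl[of x t] sc[OF KK(2), of "\<bar>t\<bar>"] by simp
    obtain \<xi> where \<xi>: "\<bar>\<xi> - x\<bar> \<le> \<bar>t\<bar>" "un (x + t) - un x = t * vn \<xi>"
      using mean_value_increment[OF dun] by blast
    have "\<bar>un (x + t) - un x - t * vn x\<bar> = \<bar>t\<bar> * \<bar>vn (x + (\<xi> - x)) - vn x\<bar>"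
      unfolding \<xi>(2) by (simp add: abs_mult[symmetric] algebra_simps)
    also have "\<dots> \<le> \<bar>t\<bar> * (K / e * \<bar>\<xi> - x\<bar>)" using vnl[of x "\<xi> - x"] by (intro mult_left_mono) auto
    also have "\<dots> \<le> \<bar>t\<bar> * (K / e * \<bar>t\<bar>)" using \<xi>(1) K e by (intro mult_left_mono) auto
    also have "\<dots> = K / e * t\<^sup>2" by (simp add: power2_eq_square)
    also have "\<dots> \<le> (K / e + K) * t\<^sup>2" using sc[OF KK(2)] by simp
    finally show "\<bar>un (x + t) - un x - t * vn x\<bar> \<le> (K / e + K) * t\<^sup>2" .
    have "Fn (x + t) - Fn x = (1 / (2 * e)) *\<^sub>R ((\<Gamma> (x + t + e) - \<Gamma> (x + e)) - (\<Gamma> (x + t - e) - \<Gamma> (x - e)))"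
      by (simp add: Fn_def algebra_simps)
    then have "norm (Fn (x + t) - Fn x) = norm ((\<Gamma> (x + t + e) - \<Gamma> (x + e)) - (\<Gamma> (x + t - e) - \<Gamma> (x - e))) / (2 * e)"
      using e by simp
    moreover have "norm ((\<Gamma> (x + t + e) - \<Gamma> (x + e)) - (\<Gamma> (x + t - e) - \<Gamma> (x - e))) \<le> K * \<bar>t\<bar> + K * \<bar>t\<bar>"
      using norm_triangle_ineq4[of "\<Gamma> (x + t + e) - \<Gamma> (x + e)" "\<Gamma> (x + t - e) - \<Gamma> (x - e)"]
        Gl[of "x + t + e" "x + e"] Gl[of "x + t - e" "x - e"] by simp
    ultimately have "norm (Fn (x + t) - Fn x) \<le> (K * \<bar>t\<bar> + K * \<bar>t\<bar>) / (2 * e)"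
      using divide_right_mono[of _ "K * \<bar>t\<bar> + K * \<bar>t\<bar>" "2 * e"] e by (simp only:)
    then have "norm (Fn (x + t) - Fn x) \<le> K / e * \<bar>t\<bar>" by simp
    then show "norm (Fn (x + t) - Fn x) \<le> (K / e + K) * \<bar>t\<bar>" using sc[OF KK(2), of "\<bar>t\<bar>"] by simp
  qed
  then show ?thesis by (simp add: un_def vn_def Fn_def)
qed

context bellman begin

lemma N_bounded: obtains B where "\<And>p. p \<in> {a..b} \<times> {0..W} \<Longrightarrow> \<bar>N p\<bar> \<le> B"
proof -
  have "continuous_on ({a..b} \<times> {0..W}) N"
    using cont_N by (rule continuous_on_subset) (auto simp: S_def)
  then have "bounded (N ` ({a..b} \<times> {0..W}))"
    by (intro compact_imp_bounded compact_continuous_image compact_Times compact_Icc)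
  then show ?thesis using that unfolding bounded_iff real_norm_def by blast
qed

lemma continuous_on_N_compose:
  assumes "continuous_on A f" "continuous_on A g" "\<And>x. x \<in> A \<Longrightarrow> f x \<in> {a..b}" "\<And>x. x \<in> A \<Longrightarrow> g x \<ge> 0"
  shows "continuous_on A (\<lambda>x. N (f x, g x))"
  by (rule continuous_on_compose2[OF cont_N]) (use assms in \<open>auto intro!: continuous_intros simp: S_def\<close>)

text \<open>The inequality holds for the box averages of every width. As the width tends to 0 they
  converge pointwise and their values stay in one compact set, so bounded convergence applies on
  both sides.\<close>

lemma gaussian_inequality:
  fixes F :: "real \<Rightarrow> 'v::euclidean_space"
  assumes u: "\<And>x. u x \<in> {a..b}"
    and u': "\<And>x. (u has_real_derivative u' x) (at x)" "continuous_on UNIV u'" "\<And>x. \<bar>u' x\<bar> \<le> K"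
    and F: "continuous_on UNIV F" "\<And>x. norm (F x) \<le> K"
  shows "(\<integral>y. N (u y, (norm (F y))\<^sup>2 + (u' y)\<^sup>2) \<partial>std_normal_distribution)
    \<le> N (\<integral>y. u y \<partial>std_normal_distribution, (norm (\<integral>y. F y \<partial>std_normal_distribution))\<^sup>2)"
proof -
  interpret real_distribution std_normal_distribution by (rule real_dist_normal_dist)
  have contu: "continuous_on UNIV u" using u'(1) by (meson DERIV_isCont continuous_at_imp_continuous_on)
  obtain U where U: "\<And>x. (U has_vector_derivative u x) (at x)" using antiderivative_exists[OF contu] by blast
  obtain \<Gamma> where \<Gamma>: "\<And>x. (\<Gamma> has_vector_derivative F x) (at x)" using antiderivative_exists[OF F(1)] by blast
  define e where "e n = inverse (real (Suc n))" for n
  have e: "e \<longlonglongrightarrow> 0" "\<And>n. e n > 0" unfolding e_def by (rule LIMSEQ_inverse_real_of_nat) simp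
  define un where "un n = (\<lambda>x. (U (x + e n) - U (x - e n)) / (2 * e n))" for n
  define vn where "vn n = (\<lambda>x. (u (x + e n) - u (x - e n)) / (2 * e n))" for n
  define Fn where "Fn n = (\<lambda>x. (1 / (2 * e n)) *\<^sub>R (\<Gamma> (x + e n) - \<Gamma> (x - e n)))" for n
  have data: "lipschitz_data (K / e n + K) (un n) (vn n) (Fn n)" for n
    unfolding un_def vn_def Fn_def
    by (rule box_mollification_lipschitz_data) (use u' U \<Gamma> F e in \<open>auto simp: has_real_derivative_iff_has_vector_derivative\<close>)
  \<comment> \<open>A box average is a value of \<open>u\<close> by the mean value theorem, so it
    remains in the interval.\<close>
  have unin: "un n x \<in> {a..b}" for n x
  proof -
    obtain z where "U (x + e n) - U (x - e n) = (x + e n - (x - e n)) * u z"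
      using MVT2[of "x - e n" "x + e n" U u] U e(2)[of n] by (auto simp: has_real_derivative_iff_has_vector_derivative)
    then have "un n x = u z" using e(2)[of n] by (simp add: un_def)
    then show ?thesis using u by simp
  qed
  have vnK: "\<bar>vn n x\<bar> \<le> K" for n x
    using vector_derivative_lipschitz[of u u' K "x + e n" "x - e n"] u' e(2)[of n]
    by (simp add: vn_def has_real_derivative_iff_has_vector_derivative abs_divide divide_le_eq)
  have FnK: "norm (Fn n x) \<le> K" for n x
    using vector_derivative_lipschitz[OF \<Gamma> F(2), of "x + e n" "x - e n"] e(2)[of n]
    by (simp add: Fn_def divide_le_eq)
  have unl: "(\<lambda>n. un n x) \<longlonglongrightarrow> u x" for x
    using symmetric_difference_quotient_tendsto[OF U e] by (simp add: un_def)
  have vnl: "(\<lambda>n. vn n x) \<longlonglongrightarrow> u' x" for x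
    using symmetric_difference_quotient_tendsto[OF _ e, of u "u' x" x] u'
    by (simp add: vn_def has_real_derivative_iff_has_vector_derivative)
  have Fnl: "(\<lambda>n. Fn n x) \<longlonglongrightarrow> F x" for x
    using symmetric_difference_quotient_tendsto[OF \<Gamma> e] by (simp add: Fn_def)
  have contU: "continuous_on A U" and cont\<Gamma>: "continuous_on A \<Gamma>" for A
    using U \<Gamma> by (meson has_vector_derivative_continuous continuous_at_imp_continuous_on)+
  have contA: "continuous_on A u" for A using contu by (rule continuous_on_subset) simp
  have cn: "continuous_on UNIV (un n)" "continuous_on UNIV (vn n)" "continuous_on UNIV (Fn n)" for n
    unfolding un_def vn_def Fn_def using e(2)[of n]
    by (auto intro!: continuous_intros continuous_on_compose2[OF contU] continuous_on_compose2[OF contA] continuous_on_compose2[OF cont\<Gamma>])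
  have K: "K \<ge> 0" using u'(3)[of 0] by simp
  obtain B where B: "\<And>p. p \<in> {a..b} \<times> {0..2 * K\<^sup>2} \<Longrightarrow> \<bar>N p\<bar> \<le> B" using N_bounded by blast
  have range: "norm y ^ 2 + z\<^sup>2 \<in> {0..2 * K\<^sup>2}" if "norm y \<le> K" "\<bar>z\<bar> \<le> K" for y :: 'v and z
    using power_mono[OF that(1), of 2] power_mono[OF that(2), of 2] by simp
  have m: "(\<lambda>y. N (f y, (norm (G y))\<^sup>2 + (g y)\<^sup>2)) \<in> borel_measurable borel"
    if "continuous_on UNIV f" "continuous_on UNIV g" "continuous_on UNIV G" "\<And>x. f x \<in> {a..b}" for f g and G :: "real \<Rightarrow> 'v"
    by (intro borel_measurable_continuous_onI continuous_on_N_compose continuous_intros that) auto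
  have ub: "\<bar>x\<bar> \<le> \<bar>a\<bar> + \<bar>b\<bar>" if "x \<in> {a..b}" for x using that by (rule abs_le_interval)
  have L: "(\<lambda>n. \<integral>y. N (un n y, (norm (Fn n y))\<^sup>2 + (vn n y)\<^sup>2) \<partial>std_normal_distribution)
     \<longlonglongrightarrow> (\<integral>y. N (u y, (norm (F y))\<^sup>2 + (u' y)\<^sup>2) \<partial>std_normal_distribution)"
  proof (rule integral_dominated_convergence[where w = "\<lambda>_. B"])
    show "AE y in std_normal_distribution. (\<lambda>n. N (un n y, (norm (Fn n y))\<^sup>2 + (vn n y)\<^sup>2)) \<longlonglongrightarrow> N (u y, (norm (F y))\<^sup>2 + (u' y)\<^sup>2)"
    proof (rule AE_I2)
      fix y show "(\<lambda>n. N (un n y, (norm (Fn n y))\<^sup>2 + (vn n y)\<^sup>2)) \<longlonglongrightarrow> N (u y, (norm (F y))\<^sup>2 + (u' y)\<^sup>2)"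
        by (rule continuous_on_tendsto_compose[OF cont_N])
          (use unin u in \<open>auto intro!: tendsto_intros unl vnl Fnl simp: S_def\<close>)
    qed
    show "AE y in std_normal_distribution. norm (N (un n y, (norm (Fn n y))\<^sup>2 + (vn n y)\<^sup>2)) \<le> B" for n
      unfolding real_norm_def by (intro AE_I2 B SigmaI unin range FnK vnK)
  qed (use m[OF contu u'(2) F(1) u] m[OF cn unin] in auto)
  have L2: "(\<lambda>n. \<integral>y. un n y \<partial>std_normal_distribution) \<longlonglongrightarrow> (\<integral>y. u y \<partial>std_normal_distribution)"
    by (rule integral_dominated_convergence[where w = "\<lambda>_. \<bar>a\<bar> + \<bar>b\<bar>"])
      (use unl ub[OF unin] cn contu in \<open>auto intro!: borel_measurable_continuous_onI\<close>)
  have L3: "(\<lambda>n. \<integral>y. Fn n y \<partial>std_normal_distribution) \<longlonglongrightarrow> (\<integral>y. F y \<partial>std_normal_distribution)"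
    by (rule integral_dominated_convergence[where w = "\<lambda>_. K"])
      (use Fnl FnK cn F in \<open>auto intro!: borel_measurable_continuous_onI\<close>)
  have int_in: "(\<integral>y. f y \<partial>std_normal_distribution) \<in> {a..b}" if "continuous_on UNIV f" "\<And>x. f x \<in> {a..b}" for f
  proof -
    have i: "integrable std_normal_distribution f"
      by (rule integrable_const_bound[where B = "\<bar>a\<bar> + \<bar>b\<bar>"])
        (use ub[OF that(2)] that(1) in \<open>auto intro!: borel_measurable_continuous_onI\<close>)
    have "(\<integral>y. a \<partial>std_normal_distribution) \<le> (\<integral>y. f y \<partial>std_normal_distribution)"
      by (rule integral_mono) (use i that(2) in auto)
    moreover have "(\<integral>y. f y \<partial>std_normal_distribution) \<le> (\<integral>y. b \<partial>std_normal_distribution)"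
      by (rule integral_mono) (use i that(2) in auto)
    ultimately show ?thesis using prob_space by simp
  qed
  have R: "(\<lambda>n. N (\<integral>y. un n y \<partial>std_normal_distribution, (norm (\<integral>y. Fn n y \<partial>std_normal_distribution))\<^sup>2))
     \<longlonglongrightarrow> N (\<integral>y. u y \<partial>std_normal_distribution, (norm (\<integral>y. F y \<partial>std_normal_distribution))\<^sup>2)"
    by (rule continuous_on_tendsto_compose[OF cont_N])
      (use int_in[OF cn(1) unin] int_in[OF contu u] in \<open>auto intro!: tendsto_intros L2 L3 simp: S_def\<close>)
  show ?thesis
    by (intro LIMSEQ_le[OF L R] exI allI impI gaussian_inequality_lipschitz[OF data unin])
qed

end

section \<open>Gaussian averages in Euclidean space\<close>

text \<open>The bounds are parameters because averaging preserves both, while the proximal map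
  shrinks \<open>L\<close>; that shrinking drives the convergence of the chain.\<close>

definition C1_bdd :: "real \<Rightarrow> real \<Rightarrow> ('a::euclidean_space \<Rightarrow> real) \<Rightarrow> ('a \<Rightarrow> 'a) \<Rightarrow> bool" where
  "C1_bdd B L f G \<longleftrightarrow> (\<forall>x. (f has_derivative (\<lambda>h. G x \<bullet> h)) (at x)) \<and> continuous_on UNIV G \<and>
     (\<forall>x. \<bar>f x\<bar> \<le> B) \<and> (\<forall>x. norm (G x) \<le> L)"

lemma C1_bddD:
  assumes "C1_bdd B L f G"
  shows "(f has_derivative (\<lambda>h. G x \<bullet> h)) (at x)" "continuous_on A G" "\<bar>f x\<bar> \<le> B" "norm (G x) \<le> L"
    "continuous_on A f" "f \<in> borel_measurable borel" "G \<in> borel_measurable borel"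
proof -
  show 1: "(f has_derivative (\<lambda>h. G x \<bullet> h)) (at x)" for x using assms by (simp add: C1_bdd_def)
  have 2: "continuous_on UNIV G" using assms by (simp add: C1_bdd_def)
  show "continuous_on A G" for A using 2 by (rule continuous_on_subset) simp
  have 3: "continuous_on UNIV f" using 1 by (meson continuous_at_imp_continuous_on has_derivative_continuous)
  show "continuous_on A f" for A using 3 by (rule continuous_on_subset) simp
  show "f \<in> borel_measurable borel" "G \<in> borel_measurable borel"
    using 2 3 by (auto intro: borel_measurable_continuous_onI)
qed (use assms in \<open>auto simp: C1_bdd_def\<close>)

lemma C1_bdd_lipschitz:
  assumes "C1_bdd B L f G" shows "\<bar>f x - f y\<bar> \<le> L * norm (x - y)"
proof -
  have "norm (f x - f y) \<le> L * norm (x - y)"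
  proof (rule differentiable_bound[of UNIV])
    show "(f has_derivative (\<lambda>h. G z \<bullet> h)) (at z within UNIV)" for z
      using C1_bddD(1)[OF assms] by simp
    show "onorm (\<lambda>h. G z \<bullet> h) \<le> L" for z
    proof (rule onorm_le)
      fix h
      show "norm (G z \<bullet> h) \<le> L * norm h"
        using Cauchy_Schwarz_ineq2[of "G z" h] mult_right_mono[OF C1_bddD(4)[OF assms, of z] norm_ge_zero[of h]] by simp
    qed
  qed auto
  then show ?thesis by simp
qed

text \<open>Differentiation under the integral. The remainder quotients are dominated by
  \<open>2 * L\<close> through the Lipschitz bound, so dominated convergence works without a modulus
  of continuity of \<open>G\<close>.\<close>

lemma C1_bdd_average:
  fixes f :: "'a::euclidean_space \<Rightarrow> real" and \<Gamma> :: "'a measure"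
  assumes f: "C1_bdd B L f G" and "prob_space \<Gamma>" and sets: "sets \<Gamma> = sets borel"
  shows "C1_bdd B L (\<lambda>x. \<integral>v. f (x + \<sigma> *\<^sub>R v) \<partial>\<Gamma>) (\<lambda>x. \<integral>v. G (x + \<sigma> *\<^sub>R v) \<partial>\<Gamma>)"
proof -
  interpret prob_space \<Gamma> by fact
  note [measurable_cong] = sets
  note [measurable] = C1_bddD(6,7)[OF f]
  have bdf: "norm (f x) \<le> B" and bdG: "norm (G x) \<le> L" for x using C1_bddD(3,4)[OF f] by auto
  have if': "integrable \<Gamma> (\<lambda>v. f (x + \<sigma> *\<^sub>R v))" for x
    by (rule integrable_const_bound[where B = B]) (use bdf in auto)
  have iG: "integrable \<Gamma> (\<lambda>v. G (x + \<sigma> *\<^sub>R v))" for x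
    by (rule integrable_const_bound[where B = L]) (use bdG in auto)
  have le_const: "norm (\<integral>v. h v \<partial>\<Gamma>) \<le> c" if "integrable \<Gamma> h" "\<And>v. norm (h v) \<le> c" for h :: "'a \<Rightarrow> 'b::{banach, second_countable_topology}" and c
  proof -
    have "norm (\<integral>v. h v \<partial>\<Gamma>) \<le> (\<integral>v. norm (h v) \<partial>\<Gamma>)" by (rule integral_norm_bound)
    also have "\<dots> \<le> (\<integral>v. c \<partial>\<Gamma>)" using that by (intro integral_mono) auto
    finally show ?thesis using prob_space by simp
  qed
  show ?thesis unfolding C1_bdd_def
  proof (intro conjI allI)
    fix x
    show "\<bar>\<integral>v. f (x + \<sigma> *\<^sub>R v) \<partial>\<Gamma>\<bar> \<le> B" using le_const[OF if'] bdf by simp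
    show "norm (\<integral>v. G (x + \<sigma> *\<^sub>R v) \<partial>\<Gamma>) \<le> L" by (rule le_const[OF iG bdG])
    let ?F = "\<lambda>x. \<integral>v. f (x + \<sigma> *\<^sub>R v) \<partial>\<Gamma>" and ?H = "\<lambda>x. \<integral>v. G (x + \<sigma> *\<^sub>R v) \<partial>\<Gamma>"
    show "(?F has_derivative (\<lambda>h. ?H x \<bullet> h)) (at x)"
      unfolding has_derivative_at
    proof (intro conjI)
      show "bounded_linear (\<lambda>h. ?H x \<bullet> h)" by (rule bounded_linear_inner_right)
      show "(\<lambda>h. norm (?F (x + h) - ?F x - ?H x \<bullet> h) / norm h) \<midarrow>0\<rightarrow> 0"
        unfolding LIMSEQ_SEQ_conv[symmetric]
      proof (intro allI impI, elim conjE)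
        fix h :: "nat \<Rightarrow> 'a" assume h0: "\<forall>n. h n \<noteq> 0" and h: "h \<longlonglongrightarrow> 0"
        let ?q = "\<lambda>n v. (f (x + \<sigma> *\<^sub>R v + h n) - f (x + \<sigma> *\<^sub>R v) - G (x + \<sigma> *\<^sub>R v) \<bullet> h n) / norm (h n)"
        have eq: "?F (x + h n) - ?F x - ?H x \<bullet> h n = norm (h n) * (\<integral>v. ?q n v \<partial>\<Gamma>)" for n
        proof -
          have "?F (x + h n) - ?F x - ?H x \<bullet> h n = (\<integral>v. f (x + \<sigma> *\<^sub>R v + h n) - f (x + \<sigma> *\<^sub>R v) - G (x + \<sigma> *\<^sub>R v) \<bullet> h n \<partial>\<Gamma>)"
            using if'[of "x + h n"] if'[of x] iG[of x] by (simp add: ac_simps)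
          also have "\<dots> = (\<integral>v. norm (h n) * ?q n v \<partial>\<Gamma>)" using h0 by simp
          finally show ?thesis by simp
        qed
        have "(\<lambda>n. \<integral>v. ?q n v \<partial>\<Gamma>) \<longlonglongrightarrow> (\<integral>v. 0 \<partial>\<Gamma>)"
        proof (rule integral_dominated_convergence[where w = "\<lambda>_. 2 * L"])
          show "AE v in \<Gamma>. (\<lambda>n. ?q n v) \<longlonglongrightarrow> 0"
          proof (rule AE_I2)
            fix v
            have "(\<lambda>h. norm (f (x + \<sigma> *\<^sub>R v + h) - f (x + \<sigma> *\<^sub>R v) - G (x + \<sigma> *\<^sub>R v) \<bullet> h) / norm h) \<midarrow>0\<rightarrow> 0"
              using C1_bddD(1)[OF f, of "x + \<sigma> *\<^sub>R v"] unfolding has_derivative_at by blast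
            then have "(\<lambda>n. norm (f (x + \<sigma> *\<^sub>R v + h n) - f (x + \<sigma> *\<^sub>R v) - G (x + \<sigma> *\<^sub>R v) \<bullet> h n) / norm (h n)) \<longlonglongrightarrow> 0"
              unfolding LIMSEQ_SEQ_conv[symmetric] using h0 h by blast
            then have "(\<lambda>n. norm (?q n v)) \<longlonglongrightarrow> 0" by simp
            then show "(\<lambda>n. ?q n v) \<longlonglongrightarrow> 0" by (simp only: tendsto_norm_zero_iff)
          qed
          show "AE v in \<Gamma>. norm (?q n v) \<le> 2 * L" for n
          proof (rule AE_I2)
            fix v
            have 1: "\<bar>f (x + \<sigma> *\<^sub>R v + h n) - f (x + \<sigma> *\<^sub>R v)\<bar> \<le> L * norm (h n)"
              using C1_bdd_lipschitz[OF f, of "x + \<sigma> *\<^sub>R v + h n" "x + \<sigma> *\<^sub>R v"] by simp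
            have 2: "\<bar>G (x + \<sigma> *\<^sub>R v) \<bullet> h n\<bar> \<le> L * norm (h n)"
              using Cauchy_Schwarz_ineq2[of "G (x + \<sigma> *\<^sub>R v)" "h n"] mult_right_mono[OF bdG[of "x + \<sigma> *\<^sub>R v"] norm_ge_zero[of "h n"]] by linarith
            have "\<bar>f (x + \<sigma> *\<^sub>R v + h n) - f (x + \<sigma> *\<^sub>R v) - G (x + \<sigma> *\<^sub>R v) \<bullet> h n\<bar> \<le> 2 * L * norm (h n)"
              using 1 2 by linarith
            then show "norm (?q n v) \<le> 2 * L" using h0 by (simp add: divide_le_eq)
          qed
        qed auto
        then have lim: "(\<lambda>n. \<integral>v. ?q n v \<partial>\<Gamma>) \<longlonglongrightarrow> 0" by (simp only: integral_zero)
        have e2: "norm (norm (h n) * c) / norm (h n) = norm c" for c :: real and n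
          using h0 by (simp add: abs_mult)
        show "(\<lambda>n. norm (?F (x + h n) - ?F x - ?H x \<bullet> h n) / norm (h n)) \<longlonglongrightarrow> 0"
          unfolding eq e2 by (rule tendsto_norm_zero[OF lim])
      qed
    qed
  next
    show "continuous_on UNIV (\<lambda>x. \<integral>v. G (x + \<sigma> *\<^sub>R v) \<partial>\<Gamma>)"
      unfolding continuous_on_sequentially
    proof (intro allI ballI impI)
      fix s x assume "(x :: 'a) \<in> UNIV" "(\<forall>n::nat. s n \<in> UNIV) \<and> s \<longlonglongrightarrow> x"
      then have s: "s \<longlonglongrightarrow> x" by simp
      show "((\<lambda>x. \<integral>v. G (x + \<sigma> *\<^sub>R v) \<partial>\<Gamma>) \<circ> s) \<longlonglongrightarrow> (\<integral>v. G (x + \<sigma> *\<^sub>R v) \<partial>\<Gamma>)"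
        unfolding o_def
      proof (rule integral_dominated_convergence[where w = "\<lambda>_. L"])
        show "AE v in \<Gamma>. (\<lambda>n. G (s n + \<sigma> *\<^sub>R v)) \<longlonglongrightarrow> G (x + \<sigma> *\<^sub>R v)"
          by (intro AE_I2 continuous_on_tendsto_compose[OF C1_bddD(2)[OF f, of UNIV]] tendsto_intros s) auto
      qed (use bdG in auto)
    qed
  qed
qed

section \<open>Gaussian vectors built one direction at a time\<close>

text \<open>The law of a sum of the listed vectors with independent standard normal coefficients. As
  a recursion it lets statements in Euclidean space follow from one-dimensional ones by induction on
  the list.\<close>

primrec gauss_list :: "'a::euclidean_space list \<Rightarrow> 'a measure" where
  "gauss_list [] = return borel 0"
| "gauss_list (b # bs) = distr (std_normal_distribution \<Otimes>\<^sub>M gauss_list bs) borel (\<lambda>p. fst p *\<^sub>R b + snd p)"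

lemma sets_gauss_list [simp, measurable_cong]: "sets (gauss_list bs) = sets borel"
  by (cases bs) auto

lemma space_gauss_list [simp]: "space (gauss_list bs) = UNIV"
  using sets_eq_imp_space_eq[OF sets_gauss_list, of bs] by simp

lemma prob_space_gauss_list: "prob_space (gauss_list bs)"
proof (induction bs)
  case Nil
  show ?case by (simp add: prob_space_return)
next
  case (Cons b bs)
  interpret real_distribution std_normal_distribution by (rule real_dist_normal_dist)
  interpret G: prob_space "gauss_list bs" by fact
  interpret P: pair_prob_space std_normal_distribution "gauss_list bs" ..
  show ?case by (auto intro!: P.prob_space_distr)
qed

interpretation std_normal: real_distribution std_normal_distribution
  by (rule real_dist_normal_dist)

interpretation gauss_list: prob_space "gauss_list bs" for bs
  by (rule prob_space_gauss_list)

interpretation normal_gauss: pair_prob_space std_normal_distribution "gauss_list bs" for bs ..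

lemma integrable_gauss_list_Cons:
  fixes f :: "'a::euclidean_space \<Rightarrow> 'b::{banach, second_countable_topology}"
  assumes [measurable]: "f \<in> borel_measurable borel"
  shows "integrable (gauss_list (b # bs)) f \<longleftrightarrow> integrable (std_normal_distribution \<Otimes>\<^sub>M gauss_list bs) (\<lambda>p. f (fst p *\<^sub>R b + snd p))"
  unfolding gauss_list.simps by (subst integrable_distr_eq) auto

lemma integral_gauss_list_Cons:
  fixes f :: "'a::euclidean_space \<Rightarrow> 'b::{banach, second_countable_topology}"
  assumes "integrable (gauss_list (b # bs)) f" and [measurable]: "f \<in> borel_measurable borel"
  shows "(\<integral>v. f v \<partial>gauss_list (b # bs)) = (\<integral>y. (\<integral>w. f (y *\<^sub>R b + w) \<partial>gauss_list bs) \<partial>std_normal_distribution)"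
proof -
  have "(\<integral>v. f v \<partial>gauss_list (b # bs)) = (\<integral>p. f (fst p *\<^sub>R b + snd p) \<partial>(std_normal_distribution \<Otimes>\<^sub>M gauss_list bs))"
    unfolding gauss_list.simps by (subst integral_distr) auto
  also have "\<dots> = (\<integral>y. (\<integral>w. f (y *\<^sub>R b + w) \<partial>gauss_list bs) \<partial>std_normal_distribution)"
    using normal_gauss.integral_fst'[OF assms(1)[unfolded integrable_gauss_list_Cons[OF assms(2)]]] by simp
  finally show ?thesis .
qed

lemma integrable_bounded_gauss:
  fixes f :: "'a::euclidean_space \<Rightarrow> 'b::{banach, second_countable_topology}"
  assumes "f \<in> borel_measurable borel" "\<And>x. norm (f x) \<le> B"
  shows "integrable (gauss_list bs) f"
  by (rule gauss_list.integrable_const_bound[where B = B]) (use assms in auto)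

lemma integrable_fst_normal:
  fixes f :: "real \<Rightarrow> 'b::{banach, second_countable_topology}"
  assumes "integrable std_normal_distribution f"
  shows "integrable (std_normal_distribution \<Otimes>\<^sub>M gauss_list bs) (\<lambda>p. f (fst p))"
proof -
  have "integrable (distr (std_normal_distribution \<Otimes>\<^sub>M gauss_list bs) std_normal_distribution fst) f"
    using assms by (simp only: gauss_list.distr_pair_fst)
  then show ?thesis by (subst (asm) integrable_distr_eq) (use assms in auto)
qed

lemma integrable_snd_normal:
  fixes f :: "'a::euclidean_space \<Rightarrow> 'b::{banach, second_countable_topology}"
  assumes "integrable (gauss_list bs) f"
  shows "integrable (std_normal_distribution \<Otimes>\<^sub>M gauss_list bs) (\<lambda>p. f (snd p))"
proof -
  interpret Q: pair_prob_space "gauss_list bs" std_normal_distribution ..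
  have "integrable (distr (gauss_list bs \<Otimes>\<^sub>M std_normal_distribution) (gauss_list bs) fst) f"
    using assms by (simp only: std_normal.distr_pair_fst)
  then have "integrable (gauss_list bs \<Otimes>\<^sub>M std_normal_distribution) (\<lambda>p. f (fst p))"
    by (subst (asm) integrable_distr_eq) (use assms in auto)
  from Q.integrable_product_swap[OF this] show ?thesis by (simp add: split_beta')
qed

lemma integrable_normal_power: "integrable std_normal_distribution (\<lambda>y. y ^ k)"
  by (rule integrable_std_normal_distribution_moment)

lemma integrable_gauss_list_square: "integrable (gauss_list bs) (\<lambda>v. (norm v)\<^sup>2)"
proof (induction bs)
  case Nil
  show ?case by (simp add: integrable_iff_bounded nn_integral_return)
next
  case (Cons b bs)
  have "integrable (std_normal_distribution \<Otimes>\<^sub>M gauss_list bs) (\<lambda>p. (norm (fst p *\<^sub>R b + snd p))\<^sup>2)"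
  proof (rule Bochner_Integration.integrable_bound)
    have 1: "integrable (std_normal_distribution \<Otimes>\<^sub>M gauss_list bs) (\<lambda>p. (fst p)\<^sup>2)"
      using integrable_fst_normal[OF integrable_normal_power[of 2]] .
    have 2: "integrable (std_normal_distribution \<Otimes>\<^sub>M gauss_list bs) (\<lambda>p. (norm (snd p))\<^sup>2)"
      using integrable_snd_normal[OF Cons.IH] .
    show "integrable (std_normal_distribution \<Otimes>\<^sub>M gauss_list bs) (\<lambda>p. 2 * (norm b)\<^sup>2 * (fst p)\<^sup>2 + 2 * (norm (snd p))\<^sup>2)"
      by (intro Bochner_Integration.integrable_add integrable_mult_right 1 2)
    show "AE p in std_normal_distribution \<Otimes>\<^sub>M gauss_list bs. norm ((norm (fst p *\<^sub>R b + snd p))\<^sup>2) \<le> norm (2 * (norm b)\<^sup>2 * (fst p)\<^sup>2 + 2 * (norm (snd p))\<^sup>2)"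
    proof (rule AE_I2)
      fix p :: "real \<times> 'a"
      have "(norm (fst p *\<^sub>R b + snd p))\<^sup>2 \<le> (norm (fst p *\<^sub>R b) + norm (snd p))\<^sup>2"
        by (intro power_mono norm_triangle_ineq) auto
      also have "\<dots> \<le> 2 * (norm (fst p *\<^sub>R b))\<^sup>2 + 2 * (norm (snd p))\<^sup>2"
using sum_squares_bound[of "norm (fst p *\<^sub>R b)" "norm (snd p)"] by (simp add: power2_sum)
      finally show "norm ((norm (fst p *\<^sub>R b + snd p))\<^sup>2) \<le> norm (2 * (norm b)\<^sup>2 * (fst p)\<^sup>2 + 2 * (norm (snd p))\<^sup>2)"
        by (simp add: power_mult_distrib mult_ac)
    qed
  qed simp
  then show ?case by (subst integrable_gauss_list_Cons) auto
qed


lemma integrable_gauss_list_norm: "integrable (gauss_list bs) (\<lambda>v. norm v)"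
proof (rule Bochner_Integration.integrable_bound)
  show "integrable (gauss_list bs) (\<lambda>v. 1 + (norm v)\<^sup>2)"
    using integrable_gauss_list_square by (intro Bochner_Integration.integrable_add) auto
  show "AE v in gauss_list bs. norm (norm v) \<le> norm (1 + (norm v)\<^sup>2)"
  proof (rule AE_I2)
    fix v :: 'a
    have "0 \<le> (norm v - 1)\<^sup>2" by simp
    then have "2 * norm v \<le> 1 + (norm v)\<^sup>2" unfolding power2_diff by simp
    then have "norm v \<le> 1 + (norm v)\<^sup>2" using norm_ge_zero[of v] by linarith
    then show "norm (norm v) \<le> norm (1 + (norm v)\<^sup>2)" by simp
  qed
qed simp

section \<open>Gaussian integration by parts and symmetry\<close>

lemma std_normal_density_deriv:
  "(std_normal_density has_real_derivative - x * std_normal_density x) (at x)"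
  unfolding std_normal_density_def by (auto intro!: derivative_eq_intros simp: field_simps)

text \<open>Stein's identity: the density satisfies \<open>\<phi>' = - y \<phi>\<close>, so the two
  sides differ by the Lebesgue integral of the derivative of \<open>- \<phi> f\<close>, a function
  that vanishes at both ends.\<close>

lemma normal_integration_by_parts:
  fixes f f' :: "real \<Rightarrow> real"
  assumes f: "\<And>x. (f has_real_derivative f' x) (at x)" "continuous_on UNIV f'"
    and bdd: "\<And>x. \<bar>f x\<bar> \<le> B" "\<And>x. \<bar>f' x\<bar> \<le> B'"
  shows "(\<integral>y. y * f y \<partial>std_normal_distribution) = (\<integral>y. f' y \<partial>std_normal_distribution)"
proof -
  have contf: "continuous_on UNIV f" using f(1) by (meson DERIV_isCont continuous_at_imp_continuous_on)
  have [measurable]: "f \<in> borel_measurable borel" "f' \<in> borel_measurable borel"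
    using contf f(2) by (auto intro: borel_measurable_continuous_onI)
  define F where "F y = - (std_normal_density y * f y)" for y
  define F' where "F' y = std_normal_density y * (y * f y) - std_normal_density y * f' y" for y
  have i1: "integrable std_normal_distribution (\<lambda>y. y * f y)"
  proof (rule Bochner_Integration.integrable_bound)
    show "integrable std_normal_distribution (\<lambda>y. B * y)"
      using integrable_normal_power[of 1] by simp
    show "AE y in std_normal_distribution. norm (y * f y) \<le> norm (B * y)"
      using order_trans[OF bdd(1) abs_ge_self] by (intro AE_I2) (auto simp: abs_mult mult.commute intro!: mult_left_mono)
  qed simp
  have i2: "integrable std_normal_distribution f'"
    by (rule std_normal.integrable_const_bound[where B = B']) (use bdd in auto)
  have j1: "integrable lborel (\<lambda>y. std_normal_density y * (y * f y))"
    using i1 by (subst (asm) integrable_density) auto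
  have j2: "integrable lborel (\<lambda>y. std_normal_density y * f' y)"
    using i2 by (subst (asm) integrable_density) auto
  have iF': "integrable lborel F'" unfolding F'_def using j1 j2 by simp
  have lim: "(std_normal_density \<longlongrightarrow> 0) at_top" "(std_normal_density \<longlongrightarrow> 0) at_bot"
    unfolding std_normal_density_def by real_asymp+
  have Flim: "(F \<longlongrightarrow> 0) Z" if "(std_normal_density \<longlongrightarrow> 0) Z" for Z
  proof (rule Lim_null_comparison)
    show "\<forall>\<^sub>F y in Z. norm (F y) \<le> std_normal_density y * B"
      using bdd(1) by (auto simp: F_def abs_mult intro!: always_eventually mult_left_mono)
    show "((\<lambda>y. std_normal_density y * B) \<longlongrightarrow> 0) Z"
      using tendsto_mult_right[OF that, of B] by simp
  qed
  have "(LBINT y=-\<infinity>..\<infinity>. F' y) = 0 - 0"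
  proof (rule interval_integral_FTC_integrable)
    show "(F has_vector_derivative F' y) (at y)" for y
      unfolding F_def F'_def has_real_derivative_iff_has_vector_derivative[symmetric]
      by (auto intro!: derivative_eq_intros std_normal_density_deriv f(1) simp: algebra_simps)
    have "continuous_on UNIV F'" unfolding F'_def
      by (intro continuous_intros contf f(2)) (auto simp: std_normal_density_def intro!: continuous_intros)
    then show "isCont F' y" for y by (simp add: continuous_on_eq_continuous_at)
    show "set_integrable lborel (einterval (-\<infinity>) \<infinity>) F'"
      using iF' by (simp add: set_integrable_def einterval_def)
    show "((F \<circ> real_of_ereal) \<longlongrightarrow> 0) (at_right (- \<infinity>))" "((F \<circ> real_of_ereal) \<longlongrightarrow> 0) (at_left \<infinity>)"
      using Flim lim by (auto simp: ereal_tendsto_simps)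
  qed simp
  then have "(\<integral>y. F' y \<partial>lborel) = 0"
    by (simp add: interval_lebesgue_integral_def set_lebesgue_integral_def einterval_def)
  then have "(\<integral>y. std_normal_density y * (y * f y) \<partial>lborel) = (\<integral>y. std_normal_density y * f' y \<partial>lborel)"
    unfolding F'_def using j1 j2 by simp
  then show ?thesis by (simp add: integral_density)
qed

lemma distr_uminus_std_normal: "distr std_normal_distribution borel uminus = std_normal_distribution"
proof -
  have "distributed std_normal_distribution lborel (\<lambda>x. x) (normal_density 0 1)"
    unfolding distributed_def by (auto simp: distr_id2)
  from std_normal.normal_density_affine[OF this, of "-1" 0]
  have "distributed std_normal_distribution lborel (\<lambda>x. - x) std_normal_density" by simp
  then have "distr std_normal_distribution lborel uminus = std_normal_distribution"
    unfolding distributed_def by simp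
  moreover have "distr std_normal_distribution lborel uminus = distr std_normal_distribution borel uminus"
    by (rule distr_cong) auto
  ultimately show ?thesis by simp
qed

lemma distr_uminus_gauss_list: "distr (gauss_list bs) borel uminus = gauss_list (bs :: 'a::euclidean_space list)"
proof (induction bs)
  case Nil
  show ?case by (simp add: distr_return)
next
  case (Cons b bs)
  let ?N = std_normal_distribution and ?G = "gauss_list bs"
  have "distr ?N borel uminus \<Otimes>\<^sub>M distr ?G borel uminus = distr (?N \<Otimes>\<^sub>M ?G) (borel \<Otimes>\<^sub>M borel) (\<lambda>(x, y). (- x, - y))"
    by (rule pair_measure_distr) (auto simp: Cons.IH intro: gauss_list.sigma_finite_measure_axioms)
  then have e: "?N \<Otimes>\<^sub>M ?G = distr (?N \<Otimes>\<^sub>M ?G) (borel \<Otimes>\<^sub>M borel) (\<lambda>(x, y). (- x, - y))"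
    by (simp only: Cons.IH distr_uminus_std_normal)
  have "distr (distr (?N \<Otimes>\<^sub>M ?G) (borel \<Otimes>\<^sub>M borel) (\<lambda>(x, y). (- x, - y))) borel (\<lambda>p. fst p *\<^sub>R b + snd p)
      = distr (?N \<Otimes>\<^sub>M ?G) borel ((\<lambda>p. fst p *\<^sub>R b + snd p) \<circ> (\<lambda>(x, y). (- x, - y)))"
    by (rule distr_distr) auto
  also have "\<dots> = distr (?N \<Otimes>\<^sub>M ?G) borel (uminus \<circ> (\<lambda>p. fst p *\<^sub>R b + snd p))"
    by (rule distr_cong) (auto simp: o_def)
  also have "\<dots> = distr (gauss_list (b # bs)) borel uminus"
    unfolding gauss_list.simps by (rule distr_distr[symmetric]) auto
  finally show ?case unfolding e[symmetric] gauss_list.simps by simp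
qed

lemma integral_gauss_list_uminus:
  fixes f :: "'a::euclidean_space \<Rightarrow> 'b::{banach, second_countable_topology}"
  assumes [measurable]: "f \<in> borel_measurable borel"
  shows "(\<integral>v. f (- v) \<partial>gauss_list bs) = (\<integral>v. f v \<partial>gauss_list bs)"
proof -
  have "(\<integral>v. f (- v) \<partial>gauss_list bs) = (\<integral>v. f v \<partial>distr (gauss_list bs) borel uminus)"
    by (subst integral_distr) auto
  then show ?thesis by (simp only: distr_uminus_gauss_list)
qed

text \<open>Stein's identity in each direction of the list. The sum on the right is the covariance
  operator of \<open>gauss_list bs\<close> applied to \<open>u\<close>; for an orthonormal basis it
  is \<open>u\<close> itself.\<close>

lemma gauss_list_integration_by_parts:
  fixes f :: "'a::euclidean_space \<Rightarrow> real"
  assumes f: "C1_bdd B L f G"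
  shows "(\<integral>v. f (x + \<sigma> *\<^sub>R v) * (v \<bullet> u) \<partial>gauss_list bs)
    = \<sigma> * ((\<integral>v. G (x + \<sigma> *\<^sub>R v) \<partial>gauss_list bs) \<bullet> (\<Sum>b\<leftarrow>bs. (b \<bullet> u) *\<^sub>R b))"
proof (induction bs arbitrary: x)
  case Nil
  note [measurable] = C1_bddD(6,7)[OF f]
  show ?case by (simp add: integral_return)
next
  case (Cons b bs)
  note [measurable] = C1_bddD(6,7)[OF f]
  let ?N = std_normal_distribution and ?G = "gauss_list bs"
  let ?P = "\<Sum>b\<leftarrow>bs. (b \<bullet> u) *\<^sub>R b"
  let ?X = "\<lambda>p. x + \<sigma> *\<^sub>R (fst p *\<^sub>R b + snd p)"
  have B: "0 \<le> B" using C1_bddD(3)[OF f, of 0] by linarith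
  have i0: "integrable (gauss_list (b # bs)) (\<lambda>v. f (x + \<sigma> *\<^sub>R v) * (v \<bullet> u))"
  proof (rule Bochner_Integration.integrable_bound)
    show "integrable (gauss_list (b # bs)) (\<lambda>v. B * norm u * norm v)"
      using integrable_gauss_list_norm by (rule integrable_mult_right)
    show "AE v in gauss_list (b # bs). norm (f (x + \<sigma> *\<^sub>R v) * (v \<bullet> u)) \<le> norm (B * norm u * norm v)"
    proof (rule AE_I2)
      fix v
      have "\<bar>f (x + \<sigma> *\<^sub>R v)\<bar> * \<bar>v \<bullet> u\<bar> \<le> B * (norm v * norm u)"
        using C1_bddD(3)[OF f] Cauchy_Schwarz_ineq2 B by (intro mult_mono) auto
      then show "norm (f (x + \<sigma> *\<^sub>R v) * (v \<bullet> u)) \<le> norm (B * norm u * norm v)"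
        using B by (simp add: abs_mult mult_ac)
    qed
  qed simp
  have iA: "integrable (?N \<Otimes>\<^sub>M ?G) (\<lambda>p. fst p * f (?X p))"
  proof (rule Bochner_Integration.integrable_bound)
    show "integrable (?N \<Otimes>\<^sub>M ?G) (\<lambda>p. B * fst p)"
      using integrable_normal_power[of 1] by (intro integrable_mult_right integrable_fst_normal[of "\<lambda>x. x"]) simp
    show "AE p in ?N \<Otimes>\<^sub>M ?G. norm (fst p * f (?X p)) \<le> norm (B * fst p)"
      using order_trans[OF C1_bddD(3)[OF f] abs_ge_self] by (intro AE_I2) (auto simp: abs_mult mult.commute intro!: mult_left_mono)
  qed simp
  have iB: "integrable (?N \<Otimes>\<^sub>M ?G) (\<lambda>p. f (?X p) * (snd p \<bullet> u))"
  proof (rule Bochner_Integration.integrable_bound)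
    show "integrable (?N \<Otimes>\<^sub>M ?G) (\<lambda>p. B * norm u * norm (snd p))"
      by (intro integrable_mult_right integrable_snd_normal integrable_gauss_list_norm)
    show "AE p in ?N \<Otimes>\<^sub>M ?G. norm (f (?X p) * (snd p \<bullet> u)) \<le> norm (B * norm u * norm (snd p))"
    proof (rule AE_I2)
      fix p
      have "\<bar>f (?X p)\<bar> * \<bar>snd p \<bullet> u\<bar> \<le> B * (norm (snd p) * norm u)"
        using C1_bddD(3)[OF f] Cauchy_Schwarz_ineq2 B by (intro mult_mono) auto
      then show "norm (f (?X p) * (snd p \<bullet> u)) \<le> norm (B * norm u * norm (snd p))"
        using B by (simp add: abs_mult mult_ac)
    qed
  qed simp
  have iG: "integrable (?N \<Otimes>\<^sub>M ?G) (\<lambda>p. G (?X p))"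
    by (rule normal_gauss.integrable_const_bound[where B = L]) (use C1_bddD(4)[OF f] in auto)
  have iG1: "integrable ?N (\<lambda>y. G (z + \<sigma> *\<^sub>R (y *\<^sub>R b)))" for z
    by (rule std_normal.integrable_const_bound[where B = L]) (use C1_bddD(4)[OF f] in auto)
  have A: "(\<integral>p. fst p * f (?X p) \<partial>(?N \<Otimes>\<^sub>M ?G)) = \<sigma> * ((\<integral>p. G (?X p) \<partial>(?N \<Otimes>\<^sub>M ?G)) \<bullet> b)"
  proof -
    have "(\<integral>p. fst p * f (?X p) \<partial>(?N \<Otimes>\<^sub>M ?G)) = (\<integral>w. (\<integral>y. y * f (x + \<sigma> *\<^sub>R (y *\<^sub>R b + w)) \<partial>?N) \<partial>?G)"
      using normal_gauss.integral_snd[of bs "\<lambda>y w. y * f (x + \<sigma> *\<^sub>R (y *\<^sub>R b + w))"] iA by (simp add: split_beta')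
    also have "(\<lambda>w. \<integral>y. y * f (x + \<sigma> *\<^sub>R (y *\<^sub>R b + w)) \<partial>?N) = (\<lambda>w. \<integral>y. \<sigma> * (G (x + \<sigma> *\<^sub>R (y *\<^sub>R b + w)) \<bullet> b) \<partial>?N)"
    proof
      fix w
      show "(\<integral>y. y * f (x + \<sigma> *\<^sub>R (y *\<^sub>R b + w)) \<partial>?N) = (\<integral>y. \<sigma> * (G (x + \<sigma> *\<^sub>R (y *\<^sub>R b + w)) \<bullet> b) \<partial>?N)"
      proof (rule normal_integration_by_parts[where B = B and B' = "\<bar>\<sigma>\<bar> * (L * norm b)"])
        fix y
        have "((\<lambda>y. x + \<sigma> *\<^sub>R (y *\<^sub>R b + w)) has_derivative (\<lambda>h. h *\<^sub>R (\<sigma> *\<^sub>R b))) (at y)"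
          by (auto intro!: derivative_eq_intros simp: algebra_simps)
        from has_derivative_compose[OF this C1_bddD(1)[OF f]]
        show "((\<lambda>y. f (x + \<sigma> *\<^sub>R (y *\<^sub>R b + w))) has_real_derivative \<sigma> * (G (x + \<sigma> *\<^sub>R (y *\<^sub>R b + w)) \<bullet> b)) (at y)"
          by (simp add: has_field_derivative_def mult_ac mult_commute_abs)
        show "\<bar>f (x + \<sigma> *\<^sub>R (y *\<^sub>R b + w))\<bar> \<le> B" by (rule C1_bddD(3)[OF f])
        have "\<bar>G (x + \<sigma> *\<^sub>R (y *\<^sub>R b + w)) \<bullet> b\<bar> \<le> L * norm b"
          by (rule order_trans[OF Cauchy_Schwarz_ineq2]) (use C1_bddD(4)[OF f] in \<open>auto intro: mult_right_mono\<close>)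
        then show "\<bar>\<sigma> * (G (x + \<sigma> *\<^sub>R (y *\<^sub>R b + w)) \<bullet> b)\<bar> \<le> \<bar>\<sigma>\<bar> * (L * norm b)"
          unfolding abs_mult by (rule mult_left_mono) simp
      next
        show "continuous_on UNIV (\<lambda>y. \<sigma> * (G (x + \<sigma> *\<^sub>R (y *\<^sub>R b + w)) \<bullet> b))"
          by (intro continuous_intros continuous_on_compose2[OF C1_bddD(2)[OF f, of UNIV]]) auto
      qed
    qed
    also have "(\<integral>w. (\<integral>y. \<sigma> * (G (x + \<sigma> *\<^sub>R (y *\<^sub>R b + w)) \<bullet> b) \<partial>?N) \<partial>?G) = (\<integral>p. \<sigma> * (G (?X p) \<bullet> b) \<partial>(?N \<Otimes>\<^sub>M ?G))"
      using normal_gauss.integral_snd[of bs "\<lambda>y w. \<sigma> * (G (x + \<sigma> *\<^sub>R (y *\<^sub>R b + w)) \<bullet> b)"] iG by (simp add: split_beta')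
    finally show ?thesis using iG by simp
  qed
  have C: "(\<integral>p. f (?X p) * (snd p \<bullet> u) \<partial>(?N \<Otimes>\<^sub>M ?G)) = \<sigma> * ((\<integral>p. G (?X p) \<partial>(?N \<Otimes>\<^sub>M ?G)) \<bullet> ?P)"
  proof -
    have "(\<integral>p. f (?X p) * (snd p \<bullet> u) \<partial>(?N \<Otimes>\<^sub>M ?G)) = (\<integral>y. (\<integral>w. f ((x + \<sigma> *\<^sub>R (y *\<^sub>R b)) + \<sigma> *\<^sub>R w) * (w \<bullet> u) \<partial>?G) \<partial>?N)"
      using normal_gauss.integral_fst'[OF iB] by (simp add: algebra_simps)
    also have "\<dots> = (\<integral>y. \<sigma> * ((\<integral>w. G ((x + \<sigma> *\<^sub>R (y *\<^sub>R b)) + \<sigma> *\<^sub>R w) \<partial>?G) \<bullet> ?P) \<partial>?N)"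
      unfolding Cons.IH ..
    also have "\<dots> = \<sigma> * ((\<integral>y. (\<integral>w. G ((x + \<sigma> *\<^sub>R (y *\<^sub>R b)) + \<sigma> *\<^sub>R w) \<partial>?G) \<partial>?N) \<bullet> ?P)"
      using normal_gauss.integrable_fst'[OF iG] by (simp add: algebra_simps)
    also have "(\<integral>y. (\<integral>w. G ((x + \<sigma> *\<^sub>R (y *\<^sub>R b)) + \<sigma> *\<^sub>R w) \<partial>?G) \<partial>?N) = (\<integral>p. G (?X p) \<partial>(?N \<Otimes>\<^sub>M ?G))"
      using normal_gauss.integral_fst'[OF iG] by (simp add: algebra_simps)
    finally show ?thesis .
  qed
  have "(\<integral>v. f (x + \<sigma> *\<^sub>R v) * (v \<bullet> u) \<partial>gauss_list (b # bs)) = (\<integral>p. f (?X p) * ((fst p *\<^sub>R b + snd p) \<bullet> u) \<partial>(?N \<Otimes>\<^sub>M ?G))"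
    unfolding gauss_list.simps by (subst integral_distr) auto
  also have "\<dots> = (\<integral>p. (b \<bullet> u) * (fst p * f (?X p)) + f (?X p) * (snd p \<bullet> u) \<partial>(?N \<Otimes>\<^sub>M ?G))"
    by (intro Bochner_Integration.integral_cong refl) (simp add: inner_add_left algebra_simps)
  also have "\<dots> = (b \<bullet> u) * (\<sigma> * ((\<integral>p. G (?X p) \<partial>(?N \<Otimes>\<^sub>M ?G)) \<bullet> b)) + \<sigma> * ((\<integral>p. G (?X p) \<partial>(?N \<Otimes>\<^sub>M ?G)) \<bullet> ?P)"
    using iA iB by (simp only: Bochner_Integration.integral_add integrable_mult_right integral_mult_right_zero A C)
  also have "(\<integral>p. G (?X p) \<partial>(?N \<Otimes>\<^sub>M ?G)) = (\<integral>v. G (x + \<sigma> *\<^sub>R v) \<partial>gauss_list (b # bs))"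
    unfolding gauss_list.simps by (subst integral_distr) auto
  finally show ?case by (simp add: inner_add_right algebra_simps)
qed

section \<open>Gradients with coordinate weights\<close>

text \<open>A Gaussian direction changes the weight of its own coordinate only, so the intermediate
  stages of the induction need a diagonal form and not just a multiple of the squared norm.\<close>

definition weighted_square :: "('a::euclidean_space \<Rightarrow> real) \<Rightarrow> 'a \<Rightarrow> real" where
  "weighted_square c g = (\<Sum>e\<in>Basis. c e * (g \<bullet> e)\<^sup>2)"

text \<open>A linear image of \<open>g\<close> with squared norm \<open>weighted_square c g\<close>
  for nonnegative weights; being linear, it commutes with integration and can serve as
  \<open>F\<close> in the one-dimensional inequality.\<close>

definition weighted_vector :: "('a::euclidean_space \<Rightarrow> real) \<Rightarrow> 'a \<Rightarrow> 'a" where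
  "weighted_vector c g = (\<Sum>e\<in>Basis. (sqrt (c e) * (g \<bullet> e)) *\<^sub>R e)"

lemma weighted_vector_norm:
  assumes "\<And>e. c e \<ge> 0"
  shows "(norm (weighted_vector c g))\<^sup>2 = weighted_square c g"
proof -
  have "(norm (weighted_vector c g))\<^sup>2 = (\<Sum>e\<in>Basis. (weighted_vector c g \<bullet> e) * (weighted_vector c g \<bullet> e))"
    by (simp only: power2_norm_eq_inner euclidean_inner[of "weighted_vector c g" "weighted_vector c g"])
  also have "\<dots> = weighted_square c g"
    unfolding weighted_square_def
    by (intro sum.cong refl) (use assms in \<open>simp add: weighted_vector_def inner_sum_left_Basis power2_eq_square algebra_simps\<close>)
  finally show ?thesis .
qed

lemma bounded_linear_weighted_vector: "bounded_linear (weighted_vector c)"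
  unfolding weighted_vector_def
  by (intro bounded_linear_sum bounded_linear_scaleR_const bounded_linear_const_mult bounded_linear_inner_left)

lemma continuous_on_weighted_square [continuous_intros]:
  "continuous_on A g \<Longrightarrow> continuous_on A (\<lambda>x. weighted_square c (g x))"
  unfolding weighted_square_def by (intro continuous_intros)

lemma weighted_square_nonneg: "(\<And>e. c e \<ge> 0) \<Longrightarrow> weighted_square c g \<ge> 0"
  unfolding weighted_square_def by (intro sum_nonneg) auto

lemma weighted_square_le:
  assumes "\<And>e. c e \<ge> 0" "norm g \<le> L"
  shows "weighted_square c g \<le> (\<Sum>e\<in>Basis. c e) * L\<^sup>2"
  unfolding weighted_square_def sum_distrib_right
proof (intro sum_mono mult_left_mono assms)
  fix e :: 'a assume "e \<in> Basis"
  then have "\<bar>g \<bullet> e\<bar> \<le> L" using Basis_le_norm[of e g] assms(2) by linarith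
  then show "(g \<bullet> e)\<^sup>2 \<le> L\<^sup>2" using power_mono[of "\<bar>g \<bullet> e\<bar>" L 2] by simp
qed

lemma weighted_square_add_basis:
  assumes "b \<in> Basis"
  shows "weighted_square (\<lambda>e. c e + (if e = b then s else 0)) g = weighted_square c g + s * (g \<bullet> b)\<^sup>2"
  unfolding weighted_square_def using assms by (simp add: distrib_right sum.distrib if_distrib[of "\<lambda>x. x * _"] sum.delta cong: if_cong)

lemma integral_in_interval:
  fixes f :: "'x \<Rightarrow> real"
  assumes "prob_space P" "f \<in> borel_measurable P" "\<And>x. f x \<in> {a..b}"
  shows "(\<integral>x. f x \<partial>P) \<in> {a..b}"
proof -
  interpret prob_space P by fact
  have i: "integrable P f"
    by (rule integrable_const_bound[where B = "\<bar>a\<bar> + \<bar>b\<bar>"]) (use abs_le_interval[OF assms(3)] assms(2) in auto)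
  have "(\<integral>x. a \<partial>P) \<le> (\<integral>x. f x \<partial>P)" by (rule integral_mono) (use i assms(3) in auto)
  moreover have "(\<integral>x. f x \<partial>P) \<le> (\<integral>x. b \<partial>P)" by (rule integral_mono) (use i assms(3) in auto)
  ultimately show ?thesis using prob_space by simp
qed

context bellman begin

text \<open>The Gaussian in the direction \<open>d\<close> is the outer integral. The induction
  hypothesis, with the weight of \<open>d\<close> already raised, treats the inner average. Then the
  one-dimensional inequality, with the derivative along \<open>\<sigma> *\<^sub>R d\<close> as
  \<open>u'\<close> and the weighted gradient as \<open>F\<close>, takes
  \<open>\<sigma>\<^sup>2\<close> off the weight of \<open>d\<close>.\<close>

lemma gauss_list_inequality:
  fixes f :: "'a::euclidean_space \<Rightarrow> real"
  assumes f: "C1_bdd B L f G" and fin: "\<And>x. f x \<in> {a..b}" and bs: "set bs \<subseteq> Basis" "distinct bs" and c: "\<And>e. c e \<ge> 0"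
  shows "(\<integral>v. N (f (x + \<sigma> *\<^sub>R v), weighted_square (\<lambda>e. c e + (if e \<in> set bs then \<sigma>\<^sup>2 else 0)) (G (x + \<sigma> *\<^sub>R v))) \<partial>gauss_list bs)
    \<le> N (\<integral>v. f (x + \<sigma> *\<^sub>R v) \<partial>gauss_list bs, weighted_square c (\<integral>v. G (x + \<sigma> *\<^sub>R v) \<partial>gauss_list bs))"
  using bs c
proof (induction bs arbitrary: c x)
  case Nil
  have [measurable]: "f \<in> borel_measurable borel" "G \<in> borel_measurable borel" using C1_bddD(6,7)[OF f] .
  have [measurable]: "(\<lambda>v. N (f (x + \<sigma> *\<^sub>R v), weighted_square c (G (x + \<sigma> *\<^sub>R v)))) \<in> borel_measurable borel"
    by (intro borel_measurable_continuous_onI continuous_on_N_compose continuous_intros fin weighted_square_nonneg Nil.prems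
        continuous_on_compose2[OF C1_bddD(2)[OF f, of UNIV]] continuous_on_compose2[OF C1_bddD(5)[OF f, of UNIV]]) auto
  show ?case by (simp add: integral_return)
next
  case (Cons d bs)
  let ?N = std_normal_distribution and ?G = "gauss_list bs"
  have d: "d \<in> Basis" "d \<notin> set bs" and bs: "set bs \<subseteq> Basis" "distinct bs" using Cons.prems by auto
  have [measurable]: "f \<in> borel_measurable borel" "G \<in> borel_measurable borel" using C1_bddD(6,7)[OF f] .
  define c' where "c' = (\<lambda>e. c e + (if e = d then \<sigma>\<^sup>2 else 0))"
  define c'' where "c'' = (\<lambda>e. c' e + (if e \<in> set bs then \<sigma>\<^sup>2 else 0))"
  have ceq: "(\<lambda>e. c e + (if e \<in> set (d # bs) then \<sigma>\<^sup>2 else 0)) = c''" using d by (auto simp: c'_def c''_def)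
  have c'0: "c' e \<ge> 0" "c'' e \<ge> 0" "c e \<ge> 0" for e using Cons.prems(3) by (auto simp: c'_def c''_def)
  define f1 where "f1 = (\<lambda>z. \<integral>w. f (z + \<sigma> *\<^sub>R w) \<partial>?G)"
  define G1 where "G1 = (\<lambda>z. \<integral>w. G (z + \<sigma> *\<^sub>R w) \<partial>?G)"
  have f1: "C1_bdd B L f1 G1" unfolding f1_def G1_def
    by (rule C1_bdd_average[OF f prob_space_gauss_list]) simp
  have [measurable]: "f1 \<in> borel_measurable borel" "G1 \<in> borel_measurable borel" using C1_bddD(6,7)[OF f1] .
  have f1in: "f1 z \<in> {a..b}" for z
    unfolding f1_def by (rule integral_in_interval[OF prob_space_gauss_list]) (use fin in auto)
  define W where "W = (\<Sum>e\<in>Basis. c'' e) * L\<^sup>2 + (\<Sum>e\<in>Basis. c' e) * L\<^sup>2"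
  obtain BN where BN: "\<And>p. p \<in> {a..b} \<times> {0..W} \<Longrightarrow> \<bar>N p\<bar> \<le> BN" using N_bounded by blast
  have sums: "0 \<le> (\<Sum>e\<in>Basis. c'' e) * L\<^sup>2" "0 \<le> (\<Sum>e\<in>Basis. c' e) * L\<^sup>2"
    using c'0 by (auto intro!: mult_nonneg_nonneg sum_nonneg)
  have bN: "\<bar>N (f z, weighted_square c'' (G z))\<bar> \<le> BN" for z
    using weighted_square_le[of c'', OF c'0(2) C1_bddD(4)[OF f]] weighted_square_nonneg[of c'', OF c'0(2)] sums fin
    by (intro BN) (auto simp: W_def add_increasing2)
  have bN1: "\<bar>N (f1 z, weighted_square c' (G1 z))\<bar> \<le> BN" for z
    using weighted_square_le[of c', OF c'0(1) C1_bddD(4)[OF f1]] weighted_square_nonneg[of c', OF c'0(1)] sums f1in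
    by (intro BN) (auto simp: W_def add_increasing)
  have mN[measurable]: "(\<lambda>z. N (f z, weighted_square c'' (G z))) \<in> borel_measurable borel"
    by (intro borel_measurable_continuous_onI continuous_on_N_compose continuous_on_weighted_square C1_bddD(2,5)[OF f] fin weighted_square_nonneg c'0)
  have mN1[measurable]: "(\<lambda>z. N (f1 z, weighted_square c' (G1 z))) \<in> borel_measurable borel"
    by (intro borel_measurable_continuous_onI continuous_on_N_compose continuous_on_weighted_square C1_bddD(2,5)[OF f1] f1in weighted_square_nonneg c'0)
  have iN: "integrable (gauss_list (d # bs)) (\<lambda>v. N (f (x + \<sigma> *\<^sub>R v), weighted_square c'' (G (x + \<sigma> *\<^sub>R v))))"
    by (rule integrable_bounded_gauss[where B = BN]) (use bN in auto)
  have "(\<integral>v. N (f (x + \<sigma> *\<^sub>R v), weighted_square c'' (G (x + \<sigma> *\<^sub>R v))) \<partial>gauss_list (d # bs))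
      = (\<integral>y. (\<integral>w. N (f ((x + \<sigma> *\<^sub>R (y *\<^sub>R d)) + \<sigma> *\<^sub>R w), weighted_square c'' (G ((x + \<sigma> *\<^sub>R (y *\<^sub>R d)) + \<sigma> *\<^sub>R w))) \<partial>?G) \<partial>?N)"
    by (subst integral_gauss_list_Cons[OF iN]) (auto simp: scaleR_add_right add.assoc)
  also have "\<dots> \<le> (\<integral>y. N (f1 (x + \<sigma> *\<^sub>R (y *\<^sub>R d)), weighted_square c' (G1 (x + \<sigma> *\<^sub>R (y *\<^sub>R d)))) \<partial>?N)"
  proof (rule integral_mono)
    have "integrable (?N \<Otimes>\<^sub>M ?G) (\<lambda>p. N (f ((x + \<sigma> *\<^sub>R (fst p *\<^sub>R d)) + \<sigma> *\<^sub>R snd p), weighted_square c'' (G ((x + \<sigma> *\<^sub>R (fst p *\<^sub>R d)) + \<sigma> *\<^sub>R snd p))))"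
      by (rule normal_gauss.integrable_const_bound[where B = BN]) (use bN in auto)
    from normal_gauss.integrable_fst'[OF this]
    show "integrable ?N (\<lambda>y. \<integral>w. N (f ((x + \<sigma> *\<^sub>R (y *\<^sub>R d)) + \<sigma> *\<^sub>R w), weighted_square c'' (G ((x + \<sigma> *\<^sub>R (y *\<^sub>R d)) + \<sigma> *\<^sub>R w))) \<partial>?G)"
      by simp
    show "integrable ?N (\<lambda>y. N (f1 (x + \<sigma> *\<^sub>R (y *\<^sub>R d)), weighted_square c' (G1 (x + \<sigma> *\<^sub>R (y *\<^sub>R d)))))"
      by (rule std_normal.integrable_const_bound[where B = BN]) (use bN1 in auto)
    fix y
    show "(\<integral>w. N (f ((x + \<sigma> *\<^sub>R (y *\<^sub>R d)) + \<sigma> *\<^sub>R w), weighted_square c'' (G ((x + \<sigma> *\<^sub>R (y *\<^sub>R d)) + \<sigma> *\<^sub>R w))) \<partial>?G)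
        \<le> N (f1 (x + \<sigma> *\<^sub>R (y *\<^sub>R d)), weighted_square c' (G1 (x + \<sigma> *\<^sub>R (y *\<^sub>R d))))"
      unfolding f1_def G1_def c''_def by (rule Cons.IH[OF bs c'0(1)])
  qed
  also have "\<dots> = (\<integral>y. N (f1 (x + \<sigma> *\<^sub>R (y *\<^sub>R d)), (norm (weighted_vector c (G1 (x + \<sigma> *\<^sub>R (y *\<^sub>R d)))))\<^sup>2 + (\<sigma> * (G1 (x + \<sigma> *\<^sub>R (y *\<^sub>R d)) \<bullet> d))\<^sup>2) \<partial>?N)"
    unfolding c'_def weighted_square_add_basis[OF d(1)] weighted_vector_norm[OF c'0(3)] by (simp add: power_mult_distrib)
  also have "\<dots> \<le> N (\<integral>y. f1 (x + \<sigma> *\<^sub>R (y *\<^sub>R d)) \<partial>?N, (norm (\<integral>y. weighted_vector c (G1 (x + \<sigma> *\<^sub>R (y *\<^sub>R d))) \<partial>?N))\<^sup>2)"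
  proof -
    interpret W: bounded_linear "weighted_vector c" by (rule bounded_linear_weighted_vector)
    obtain K' where K': "K' \<ge> 0" "\<And>z. norm (weighted_vector c z) \<le> norm z * K'" using W.nonneg_bounded by blast
    have L: "0 \<le> L" using C1_bddD(4)[OF f1, of 0] norm_ge_zero order_trans by blast
    show ?thesis
    proof (rule gaussian_inequality[where K = "\<bar>\<sigma>\<bar> * L + L * K'"])
      fix y
      show "f1 (x + \<sigma> *\<^sub>R (y *\<^sub>R d)) \<in> {a..b}" by (rule f1in)
      have "((\<lambda>y. x + \<sigma> *\<^sub>R (y *\<^sub>R d)) has_derivative (\<lambda>h. h *\<^sub>R (\<sigma> *\<^sub>R d))) (at y)"
        by (auto intro!: derivative_eq_intros simp: algebra_simps)
      from has_derivative_compose[OF this C1_bddD(1)[OF f1]]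
      show "((\<lambda>y. f1 (x + \<sigma> *\<^sub>R (y *\<^sub>R d))) has_real_derivative \<sigma> * (G1 (x + \<sigma> *\<^sub>R (y *\<^sub>R d)) \<bullet> d)) (at y)"
        by (simp add: has_field_derivative_def mult_ac mult_commute_abs)
      have "\<bar>G1 (x + \<sigma> *\<^sub>R (y *\<^sub>R d)) \<bullet> d\<bar> \<le> L"
        using Basis_le_norm[OF d(1), of "G1 (x + \<sigma> *\<^sub>R (y *\<^sub>R d))"] C1_bddD(4)[OF f1, of "x + \<sigma> *\<^sub>R (y *\<^sub>R d)"] by linarith
      then have "\<bar>\<sigma>\<bar> * \<bar>G1 (x + \<sigma> *\<^sub>R (y *\<^sub>R d)) \<bullet> d\<bar> \<le> \<bar>\<sigma>\<bar> * L" by (rule mult_left_mono) simp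
      then show "\<bar>\<sigma> * (G1 (x + \<sigma> *\<^sub>R (y *\<^sub>R d)) \<bullet> d)\<bar> \<le> \<bar>\<sigma>\<bar> * L + L * K'"
        using mult_nonneg_nonneg[OF L K'(1)] unfolding abs_mult by linarith
      have "norm (weighted_vector c (G1 (x + \<sigma> *\<^sub>R (y *\<^sub>R d)))) \<le> L * K'"
        using K'(2)[of "G1 (x + \<sigma> *\<^sub>R (y *\<^sub>R d))"] mult_right_mono[OF C1_bddD(4)[OF f1, of "x + \<sigma> *\<^sub>R (y *\<^sub>R d)"] K'(1)] by linarith
      then show "norm (weighted_vector c (G1 (x + \<sigma> *\<^sub>R (y *\<^sub>R d)))) \<le> \<bar>\<sigma>\<bar> * L + L * K'"
        using mult_nonneg_nonneg[OF abs_ge_zero[of \<sigma>] L] by linarith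
    next
      have *: "continuous_on UNIV (\<lambda>y. G1 (x + \<sigma> *\<^sub>R (y *\<^sub>R d)))"
        by (intro continuous_on_compose2[OF C1_bddD(2)[OF f1, of UNIV]] continuous_intros) auto
      show "continuous_on UNIV (\<lambda>y. \<sigma> * (G1 (x + \<sigma> *\<^sub>R (y *\<^sub>R d)) \<bullet> d))"
        by (intro continuous_intros *)
      show "continuous_on UNIV (\<lambda>y. weighted_vector c (G1 (x + \<sigma> *\<^sub>R (y *\<^sub>R d))))"
        by (rule W.continuous_on[OF *])
    qed
  qed
  also have "(\<integral>y. weighted_vector c (G1 (x + \<sigma> *\<^sub>R (y *\<^sub>R d))) \<partial>?N) = weighted_vector c (\<integral>y. G1 (x + \<sigma> *\<^sub>R (y *\<^sub>R d)) \<partial>?N)"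
    by (rule integral_bounded_linear[OF bounded_linear_weighted_vector], rule std_normal.integrable_const_bound[where B = L])
      (use C1_bddD(4)[OF f1] in auto)
  also have "(\<integral>y. f1 (x + \<sigma> *\<^sub>R (y *\<^sub>R d)) \<partial>?N) = (\<integral>v. f (x + \<sigma> *\<^sub>R v) \<partial>gauss_list (d # bs))"
    unfolding f1_def
    by (subst integral_gauss_list_Cons[OF integrable_bounded_gauss[where B = B]])
      (use C1_bddD(3)[OF f] in \<open>auto simp: scaleR_add_right add.assoc simp del: gauss_list.simps\<close>)
  also have "(\<integral>y. G1 (x + \<sigma> *\<^sub>R (y *\<^sub>R d)) \<partial>?N) = (\<integral>v. G (x + \<sigma> *\<^sub>R v) \<partial>gauss_list (d # bs))"
    unfolding G1_def
    by (subst integral_gauss_list_Cons[OF integrable_bounded_gauss[where B = L]])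
      (use C1_bddD(4)[OF f] in \<open>auto simp: scaleR_add_right add.assoc simp del: gauss_list.simps\<close>)
  finally show ?case unfolding ceq weighted_vector_norm[OF c'0(3)] .
qed

end

section \<open>Proximal map and Langevin step\<close>

definition std_gauss :: "'a::euclidean_space measure" where
  "std_gauss = gauss_list (SOME bs. set bs = Basis \<and> distinct bs)"

lemma std_gauss_list:
  obtains bs where "std_gauss = gauss_list bs" "set bs = (Basis :: 'a::euclidean_space set)" "distinct bs"
proof -
  have "\<exists>bs. set bs = (Basis :: 'a set) \<and> distinct bs" using finite_distinct_list[OF finite_Basis] by blast
  then have "set (SOME bs. set bs = (Basis :: 'a set) \<and> distinct bs) = Basis \<and> distinct (SOME bs. set bs = (Basis :: 'a set) \<and> distinct bs)"
    by (rule someI_ex)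
  then show ?thesis using that unfolding std_gauss_def by blast
qed

lemma prob_space_std_gauss: "prob_space std_gauss"
  unfolding std_gauss_def by (rule prob_space_gauss_list)

interpretation std_gauss: prob_space std_gauss
  by (rule prob_space_std_gauss)

lemma sets_std_gauss [simp, measurable_cong]: "sets std_gauss = sets borel"
  unfolding std_gauss_def by simp

lemma space_std_gauss [simp]: "space std_gauss = UNIV"
  unfolding std_gauss_def by simp

text \<open>\<open>HU x v\<close> is the derivative of the gradient \<open>DU\<close> at
  \<open>x\<close> in the direction \<open>v\<close>. Continuity is asked for each fixed
  \<open>v\<close>, the form in which iterated directional derivatives supply it.\<close>

locale convex_potential =
  fixes U :: "'a::euclidean_space \<Rightarrow> real" and DU :: "'a \<Rightarrow> 'a" and HU :: "'a \<Rightarrow> 'a \<Rightarrow> 'a" and R :: real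
  assumes R: "R > 0"
    and dU: "\<And>x. (U has_derivative (\<lambda>h. DU x \<bullet> h)) (at x)"
    and dDU: "\<And>x. (DU has_derivative HU x) (at x)"
    and contHU: "\<And>v. continuous_on UNIV (\<lambda>x. HU x v)"
    and HU_ge: "\<And>x v. R * (v \<bullet> v) \<le> HU x v \<bullet> v"
begin

lemma linear_HU: "bounded_linear (HU x)"
  using dDU by (rule has_derivative_bounded_linear)

lemma contDU: "continuous_on A DU" and contU: "continuous_on A U"
  using dDU dU by (meson continuous_at_imp_continuous_on has_derivative_continuous)+

lemma DU_strongly_monotone: "R * (norm (x - y))\<^sup>2 \<le> (DU x - DU y) \<bullet> (x - y)"
proof -
  let ?v = "x - y"
  have "\<exists>t\<in>{0<..<1}. DU (y + 1 *\<^sub>R ?v) \<bullet> ?v - DU (y + 0 *\<^sub>R ?v) \<bullet> ?v = (1 - 0) * (HU (y + t *\<^sub>R ?v) ?v \<bullet> ?v)"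
  proof (rule mvt_simple)
    fix t :: real
    interpret bounded_linear "HU (y + t *\<^sub>R ?v)" by (rule linear_HU)
    have "((\<lambda>t. y + t *\<^sub>R ?v) has_derivative (\<lambda>h. h *\<^sub>R ?v)) (at t within {0..1})"
      by (auto intro!: derivative_eq_intros)
    from has_derivative_compose[OF this dDU]
    show "((\<lambda>t. DU (y + t *\<^sub>R ?v) \<bullet> ?v) has_derivative (\<lambda>h. h * (HU (y + t *\<^sub>R ?v) ?v \<bullet> ?v))) (at t within {0..1})"
      by (auto intro!: derivative_eq_intros simp: scaleR)
  qed simp
  then obtain t where "DU x \<bullet> ?v - DU y \<bullet> ?v = HU (y + t *\<^sub>R ?v) ?v \<bullet> ?v" by auto
  then show ?thesis using HU_ge[of ?v "y + t *\<^sub>R ?v"] by (simp add: inner_diff_left power2_norm_eq_inner)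
qed

text \<open>Along the segment from \<open>x\<close> to \<open>y\<close>, the function minus its
  tangent and minus the quadratic term has nonnegative derivative by strong monotonicity of
  \<open>DU\<close>.\<close>

lemma U_tangent: "U x + DU x \<bullet> (y - x) + R / 2 * (norm (y - x))\<^sup>2 \<le> U y"
proof -
  let ?v = "y - x"
  let ?\<psi> = "\<lambda>t. U (x + t *\<^sub>R ?v) - t * (DU x \<bullet> ?v) - R / 2 * t\<^sup>2 * (norm ?v)\<^sup>2"
  let ?\<psi>' = "\<lambda>t. DU (x + t *\<^sub>R ?v) \<bullet> ?v - DU x \<bullet> ?v - R * t * (norm ?v)\<^sup>2"
  have "\<exists>t\<in>{0<..<1}. ?\<psi> 1 - ?\<psi> 0 = (1 - 0) * ?\<psi>' t"
  proof (rule mvt_simple)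
    fix t :: real
    have "((\<lambda>t. x + t *\<^sub>R ?v) has_derivative (\<lambda>h. h *\<^sub>R ?v)) (at t within {0..1})"
      by (auto intro!: derivative_eq_intros)
    from has_derivative_compose[OF this dU]
    show "(?\<psi> has_derivative (\<lambda>h. h * ?\<psi>' t)) (at t within {0..1})"
      by (auto intro!: derivative_eq_intros simp: algebra_simps)
  qed simp
  then obtain t where t: "0 < t" "t < 1" "?\<psi> 1 - ?\<psi> 0 = ?\<psi>' t" by auto
  have "R * (norm (t *\<^sub>R ?v))\<^sup>2 \<le> (DU (x + t *\<^sub>R ?v) - DU x) \<bullet> (t *\<^sub>R ?v)"
    using DU_strongly_monotone[of "x + t *\<^sub>R ?v" x] by simp
  then have "t * (R * t * (norm ?v)\<^sup>2) \<le> t * ((DU (x + t *\<^sub>R ?v) - DU x) \<bullet> ?v)"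
    by (simp add: power_mult_distrib power2_eq_square mult_ac)
  then have "0 \<le> ?\<psi>' t" using t(1) by (simp add: inner_diff_left)
  then have "?\<psi> 0 \<le> ?\<psi> 1" using t(3) by linarith
  then show ?thesis by simp
qed

text \<open>The tangent bound at 0 dominates a quadratic in \<open>norm x\<close> with leading
  coefficient \<open>R / 2\<close>; completing the square gives its minimum.\<close>

lemma U_bounded_below: obtains m where "\<And>x. m \<le> U x"
proof
  fix x
  have "- (norm (DU 0) * norm x) \<le> DU 0 \<bullet> x" using Cauchy_Schwarz_ineq2[of "DU 0" x] by linarith
  moreover have "0 \<le> R / 2 * (norm x - norm (DU 0) / R)\<^sup>2" using R by simp
  moreover have "R / 2 * (norm x - norm (DU 0) / R)\<^sup>2 = R / 2 * (norm x)\<^sup>2 - norm (DU 0) * norm x + (norm (DU 0))\<^sup>2 / (2 * R)"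
    using R by (simp add: power2_diff field_simps power2_eq_square)
  ultimately show "U 0 - (norm (DU 0))\<^sup>2 / (2 * R) \<le> U x" using U_tangent[of 0 x] unfolding diff_0_right by linarith
qed

section \<open>The implicit gradient step\<close>

definition prox_inv :: "real \<Rightarrow> 'a \<Rightarrow> 'a" where "prox_inv h x = x + h *\<^sub>R DU x"

text \<open>The value \<open>z\<close> solves \<open>z + h *\<^sub>R DU z = x\<close>, the critical
  point equation of \<open>U z + (norm (z - x))\<^sup>2 / (2 * h)\<close>, whence the name. It is an
  implicit Euler step of the gradient flow.\<close>

definition prox :: "real \<Rightarrow> 'a \<Rightarrow> 'a" where "prox h = inv (prox_inv h)"

context
  fixes h :: real assumes h: "h > 0"
begin

lemma hR: "1 + h * R > 0" "1 + h * R \<ge> 1"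
  using h R by (auto simp: add_pos_pos)

text \<open>Strong monotonicity bounds the inner product of the image difference with
  \<open>x - y\<close> from below; Cauchy-Schwarz turns this into expansion.\<close>

lemma prox_inv_expanding: "(1 + h * R) * norm (x - y) \<le> norm (prox_inv h x - prox_inv h y)"
proof (cases "x = y")
  case False
  have "(1 + h * R) * (norm (x - y))\<^sup>2 \<le> (prox_inv h x - prox_inv h y) \<bullet> (x - y)"
  proof -
    have "h * (R * (norm (x - y))\<^sup>2) \<le> h * ((DU x - DU y) \<bullet> (x - y))"
      using DU_strongly_monotone h by (intro mult_left_mono) auto
    moreover have "prox_inv h x - prox_inv h y = (x - y) + h *\<^sub>R (DU x - DU y)"
      by (simp add: prox_inv_def algebra_simps)
    then have "(prox_inv h x - prox_inv h y) \<bullet> (x - y) = (norm (x - y))\<^sup>2 + h * ((DU x - DU y) \<bullet> (x - y))"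
      by (simp only: inner_add_left inner_scaleR_left power2_norm_eq_inner)
    ultimately show ?thesis by (simp add: distrib_right)
  qed
  also have "\<dots> \<le> norm (prox_inv h x - prox_inv h y) * norm (x - y)" by (rule norm_cauchy_schwarz)
  finally have "((1 + h * R) * norm (x - y)) * norm (x - y) \<le> norm (prox_inv h x - prox_inv h y) * norm (x - y)"
    by (simp add: power2_eq_square mult.assoc)
  then show ?thesis using False by simp
qed simp

lemma norm_le_prox_inv: "norm (x - y) \<le> norm (prox_inv h x - prox_inv h y)"
  using prox_inv_expanding[of x y] mult_right_mono[OF hR(2) norm_ge_zero[of "x - y"]] by simp

lemma inj_prox_inv: "inj (prox_inv h)"
proof (rule injI)
  fix x y assume "prox_inv h x = prox_inv h y"
  then show "x = y" using norm_le_prox_inv[of x y] by simp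
qed

lemma continuous_prox_inv: "continuous_on A (prox_inv h)"
  unfolding prox_inv_def by (intro continuous_intros contDU)

text \<open>The range is open by invariance of domain and closed because the map is expanding, so
  that preimages of a convergent sequence form a Cauchy sequence; the space is connected.\<close>

lemma surj_prox_inv: "surj (prox_inv h)"
proof -
  have "open (range (prox_inv h))"
    by (rule invariance_of_domain[OF continuous_prox_inv open_UNIV inj_prox_inv])
  moreover have "closed (range (prox_inv h))"
    unfolding closed_sequential_limits
  proof (intro allI impI, elim conjE)
    fix s l assume s: "\<forall>n. s n \<in> range (prox_inv h)" "s \<longlonglongrightarrow> l"
    define x where "x n = inv (prox_inv h) (s n)" for n
    have x: "s n = prox_inv h (x n)" for n
      using s(1) by (simp add: x_def f_inv_into_f)
    have "Cauchy x"
    proof (rule metric_CauchyI)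
      fix e :: real assume "e > 0"
      from metric_CauchyD[OF LIMSEQ_imp_Cauchy[OF s(2)] this]
      obtain M where M: "\<forall>m\<ge>M. \<forall>n\<ge>M. dist (s m) (s n) < e" by blast
      have "dist (x m) (x n) \<le> dist (s m) (s n)" for m n
        unfolding x dist_norm by (rule norm_le_prox_inv)
      then show "\<exists>M. \<forall>m\<ge>M. \<forall>n\<ge>M. dist (x m) (x n) < e"
        using M by (intro exI[of _ M] allI impI) (metis order_le_less_trans)
    qed
    then obtain y where "x \<longlonglongrightarrow> y" using Cauchy_convergent_iff convergent_def by blast
    then have "s \<longlonglongrightarrow> prox_inv h y" unfolding x
      by (intro continuous_on_tendsto_compose[OF continuous_prox_inv[of UNIV]]) auto
    then show "l \<in> range (prox_inv h)" using s(2) LIMSEQ_unique by blast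
  qed
  ultimately have "range (prox_inv h) = {} \<or> range (prox_inv h) = UNIV"
    using clopen[of "range (prox_inv h)"] by blast
  then show ?thesis by auto
qed

lemma prox_inv_prox [simp]: "prox_inv h (prox h x) = x"
  unfolding prox_def by (rule surj_f_inv_f[OF surj_prox_inv])

lemma prox_prox_inv [simp]: "prox h (prox_inv h x) = x"
  unfolding prox_def by (rule inv_f_f[OF inj_prox_inv])

lemma prox_nonexpansive: "norm (prox h x - prox h y) \<le> norm (x - y)"
  using norm_le_prox_inv[of "prox h x" "prox h y"] by simp

lemma continuous_prox: "continuous_on A (prox h)"
proof -
  have "1-lipschitz_on A (prox h)"
    using prox_nonexpansive by (intro lipschitz_onI) (auto simp: dist_norm)
  then show ?thesis by (rule lipschitz_on_continuous_on)
qed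

lemma prox_eq: "prox h x = x - h *\<^sub>R DU (prox h x)"
  using prox_inv_prox[of x] unfolding prox_inv_def by (simp add: algebra_simps)

text \<open>\<open>x\<close> is the image of \<open>prox_inv h x\<close>, a point at distance
  \<open>h * norm (DU x)\<close> from \<open>x\<close>. A bound by \<open>DU x\<close>, and not by
  the gradient at the moved point, is one that can later be integrated against
  \<open>\<mu>\<close>.\<close>

lemma prox_displacement: "norm (prox h x - x) \<le> h * norm (DU x)"
proof -
  have "norm (prox h x - x) = norm (prox h x - prox h (prox_inv h x))" by simp
  also have "\<dots> \<le> norm (x - prox_inv h x)" by (rule prox_nonexpansive)
  also have "\<dots> = h * norm (DU x)" using h by (simp add: prox_inv_def)
  finally show ?thesis .
qed

text \<open>The inverse of the derivative of \<open>prox_inv h\<close> at the point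
  \<open>prox h x\<close>, as the rule for inverse functions predicts.\<close>

definition prox_deriv :: "'a \<Rightarrow> 'a \<Rightarrow> 'a" where
  "prox_deriv x = inv (\<lambda>v. v + h *\<^sub>R HU (prox h x) v)"

lemma prox_inv_deriv_expanding: "(1 + h * R) * norm v \<le> norm (v + h *\<^sub>R HU x v)"
proof (cases "v = 0")
  case False
  have "(1 + h * R) * (norm v)\<^sup>2 \<le> (v + h *\<^sub>R HU x v) \<bullet> v"
    using mult_left_mono[OF HU_ge[of v x], of h] h by (simp add: inner_add_left power2_norm_eq_inner algebra_simps)
  also have "\<dots> \<le> norm (v + h *\<^sub>R HU x v) * norm v" by (rule norm_cauchy_schwarz)
  finally have "((1 + h * R) * norm v) * norm v \<le> norm (v + h *\<^sub>R HU x v) * norm v"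
    by (simp add: power2_eq_square mult.assoc)
  then show ?thesis using False by simp
qed (use linear_HU[of x] in \<open>simp add: linear_simps\<close>)

lemma linear_prox_inv_deriv: "linear (\<lambda>v. v + h *\<^sub>R HU x v)"
  by (intro linear_compose_add linear_ident linear_compose_scale_right bounded_linear.linear[OF linear_HU])

lemma bij_prox_inv_deriv: "bij (\<lambda>v. v + h *\<^sub>R HU x v)"
proof -
  have "inj (\<lambda>v. v + h *\<^sub>R HU x v)"
  proof (subst linear_injective_0[OF linear_prox_inv_deriv], intro allI impI)
    fix v assume "v + h *\<^sub>R HU x v = 0"
    then show "v = 0" using prox_inv_deriv_expanding[of v x] hR by (simp add: mult_le_0_iff)
  qed
  then show ?thesis using linear_injective_imp_surjective[OF linear_prox_inv_deriv] by (simp add: bij_def)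
qed

lemma prox_deriv_right: "prox_deriv x v + h *\<^sub>R HU (prox h x) (prox_deriv x v) = v"
  unfolding prox_deriv_def using bij_is_surj[OF bij_prox_inv_deriv] by (rule surj_f_inv_f)

lemma prox_deriv_left: "prox_deriv x (v + h *\<^sub>R HU (prox h x) v) = v"
  unfolding prox_deriv_def using bij_is_inj[OF bij_prox_inv_deriv] by (rule inv_f_f)

lemma prox_deriv_bound: "(1 + h * R) * norm (prox_deriv x v) \<le> norm v"
  using prox_inv_deriv_expanding[of "prox_deriv x v" "prox h x"] unfolding prox_deriv_right .

lemma bounded_linear_prox_deriv: "bounded_linear (prox_deriv x)"
proof -
  have "linear (prox_deriv x)"
  proof (rule linearI)
    fix v w c
    let ?A = "\<lambda>v. v + h *\<^sub>R HU (prox h x) v"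
    interpret A: linear ?A by (rule linear_prox_inv_deriv)
    have "prox_deriv x (?A (prox_deriv x v + prox_deriv x w)) = prox_deriv x v + prox_deriv x w" by (rule prox_deriv_left)
    then show "prox_deriv x (v + w) = prox_deriv x v + prox_deriv x w" unfolding A.add prox_deriv_right .
    have "prox_deriv x (?A (c *\<^sub>R prox_deriv x v)) = c *\<^sub>R prox_deriv x v" by (rule prox_deriv_left)
    then show "prox_deriv x (c *\<^sub>R v) = c *\<^sub>R prox_deriv x v" unfolding A.scale prox_deriv_right .
  qed
  then show ?thesis by (rule linear_conv_bounded_linear[THEN iffD1])
qed

lemma has_derivative_prox: "(prox h has_derivative prox_deriv x) (at x)"
proof (rule has_derivative_inverse_basic[where T = UNIV and f = "prox_inv h" and f' = "\<lambda>v. v + h *\<^sub>R HU (prox h x) v"])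
  show "(prox_inv h has_derivative (\<lambda>v. v + h *\<^sub>R HU (prox h x) v)) (at (prox h x))"
    unfolding prox_inv_def by (rule has_derivative_add[OF has_derivative_ident has_derivative_scaleR_right[OF dDU]])
  show "prox_deriv x \<circ> (\<lambda>v. v + h *\<^sub>R HU (prox h x) v) = id" by (auto simp: prox_deriv_left)
  show "continuous (at x) (prox h)" using continuous_prox[of UNIV] by (simp add: continuous_on_eq_continuous_at)
qed (auto simp: bounded_linear_prox_deriv)

text \<open>The resolvent identity: two inverses at \<open>v\<close> differ by an inverse applied to
  the difference of the operators at the fixed vector \<open>prox_deriv x v\<close>, and the
  inverses have norm at most 1. Hence continuity of \<open>HU\<close> for each fixed direction
  suffices.\<close>

lemma continuous_prox_deriv: "continuous_on UNIV (\<lambda>x. prox_deriv x v)"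
  unfolding continuous_on_sequentially
proof (intro allI ballI impI)
  fix s x assume "(x :: 'a) \<in> UNIV" "(\<forall>n::nat. s n \<in> UNIV) \<and> s \<longlonglongrightarrow> x"
  then have s: "s \<longlonglongrightarrow> x" by simp
  let ?w = "prox_deriv x v"
  have "(\<lambda>n. prox h (s n)) \<longlonglongrightarrow> prox h x"
    by (rule continuous_on_tendsto_compose[OF continuous_prox[of UNIV] s]) auto
  then have "(\<lambda>n. HU (prox h (s n)) ?w) \<longlonglongrightarrow> HU (prox h x) ?w"
    by (intro continuous_on_tendsto_compose[OF contHU]) auto
  then have "(\<lambda>n. h * norm (HU (prox h x) ?w - HU (prox h (s n)) ?w)) \<longlonglongrightarrow> h * norm (HU (prox h x) ?w - HU (prox h x) ?w)"
    by (intro tendsto_intros)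
  then have lim: "(\<lambda>n. h * norm (HU (prox h x) ?w - HU (prox h (s n)) ?w)) \<longlonglongrightarrow> 0" by simp
  have "(\<lambda>n. prox_deriv (s n) v - ?w) \<longlonglongrightarrow> 0"
  proof (rule Lim_null_comparison[OF always_eventually lim], intro allI)
    fix n
    let ?p = "prox_deriv (s n) v"
    interpret H: bounded_linear "HU (prox h (s n))" by (rule linear_HU)
    have "(?p - ?w) + h *\<^sub>R HU (prox h (s n)) (?p - ?w) = h *\<^sub>R (HU (prox h x) ?w - HU (prox h (s n)) ?w)"
      using prox_deriv_right[of "s n" v] prox_deriv_right[of x v] by (simp add: H.diff algebra_simps)
    then have "(1 + h * R) * norm (?p - ?w) \<le> h * norm (HU (prox h x) ?w - HU (prox h (s n)) ?w)"
      using prox_inv_deriv_expanding[of "?p - ?w" "prox h (s n)"] h by simp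
    then show "norm (?p - ?w) \<le> h * norm (HU (prox h x) ?w - HU (prox h (s n)) ?w)"
      using mult_right_mono[OF hR(2) norm_ge_zero[of "?p - ?w"]] by simp
  qed
  then show "((\<lambda>x. prox_deriv x v) \<circ> s) \<longlonglongrightarrow> ?w" by (simp add: o_def LIM_zero_iff)
qed

text \<open>The transpose of \<open>prox_deriv x\<close> applied to \<open>G (prox h x)\<close>, in
  coordinates. If \<open>G\<close> is the gradient of \<open>f\<close>, this is the gradient of the
  composition of \<open>f\<close> with \<open>prox h\<close>.\<close>

definition prox_pullback :: "('a \<Rightarrow> 'a) \<Rightarrow> 'a \<Rightarrow> 'a" where
  "prox_pullback G x = (\<Sum>b\<in>Basis. (G (prox h x) \<bullet> prox_deriv x b) *\<^sub>R b)"

lemma prox_pullback_inner: "prox_pullback G x \<bullet> v = G (prox h x) \<bullet> prox_deriv x v"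
proof -
  interpret bounded_linear "prox_deriv x" by (rule bounded_linear_prox_deriv)
  have "G (prox h x) \<bullet> prox_deriv x v = G (prox h x) \<bullet> prox_deriv x (\<Sum>b\<in>Basis. (v \<bullet> b) *\<^sub>R b)"
    by (simp add: euclidean_representation)
  then show ?thesis unfolding prox_pullback_def
    by (simp add: sum scaleR inner_sum_left inner_sum_right inner_commute mult.commute)
qed

text \<open>A transpose inherits the norm bound of the map: the pullback is tested against
  itself.\<close>

lemma norm_prox_pullback: "(1 + h * R) * norm (prox_pullback G x) \<le> norm (G (prox h x))"
proof (cases "prox_pullback G x = 0")
  case False
  let ?w = "prox_pullback G x"
  have "(norm ?w)\<^sup>2 = G (prox h x) \<bullet> prox_deriv x ?w" by (simp add: power2_norm_eq_inner prox_pullback_inner)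
  also have "\<dots> \<le> norm (G (prox h x)) * norm (prox_deriv x ?w)" by (rule norm_cauchy_schwarz)
  finally have "(1 + h * R) * (norm ?w)\<^sup>2 \<le> (1 + h * R) * (norm (G (prox h x)) * norm (prox_deriv x ?w))"
    using hR by (simp add: mult_left_mono)
  also have "\<dots> = norm (G (prox h x)) * ((1 + h * R) * norm (prox_deriv x ?w))" by simp
  also have "\<dots> \<le> norm (G (prox h x)) * norm ?w" by (intro mult_left_mono prox_deriv_bound) simp
  finally have "((1 + h * R) * norm ?w) * norm ?w \<le> norm (G (prox h x)) * norm ?w"
    by (simp add: power2_eq_square mult.assoc)
  then show ?thesis using False by simp
qed simp

lemma C1_bdd_prox:
  assumes "C1_bdd B L f G"
  shows "C1_bdd B (L / (1 + h * R)) (\<lambda>x. f (prox h x)) (prox_pullback G)"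
  unfolding C1_bdd_def
proof (intro conjI allI)
  fix x
  show "((\<lambda>x. f (prox h x)) has_derivative (\<lambda>v. prox_pullback G x \<bullet> v)) (at x)"
    unfolding prox_pullback_inner by (rule has_derivative_compose[OF has_derivative_prox C1_bddD(1)[OF assms]])
  show "\<bar>f (prox h x)\<bar> \<le> B" by (rule C1_bddD(3)[OF assms])
  have "(1 + h * R) * norm (prox_pullback G x) \<le> L"
    using norm_prox_pullback C1_bddD(4)[OF assms] by (rule order_trans)
  then show "norm (prox_pullback G x) \<le> L / (1 + h * R)" using hR by (simp add: field_simps)
next
  show "continuous_on UNIV (prox_pullback G)" unfolding prox_pullback_def
    by (intro continuous_intros continuous_on_compose2[OF C1_bddD(2)[OF assms, of UNIV]] continuous_prox continuous_prox_deriv) auto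
qed

text \<open>The factor is \<open>sqrt (2 * h)\<close> because the heat flow of the Laplacian,
  without a factor 1/2, has covariance \<open>2 * h\<close> times the identity at time
  \<open>h\<close>.\<close>

definition heat :: "('a \<Rightarrow> 'b::{banach, second_countable_topology}) \<Rightarrow> 'a \<Rightarrow> 'b" where
  "heat f x = (\<integral>v. f (x + sqrt (2 * h) *\<^sub>R v) \<partial>std_gauss)"

definition step :: "('a \<Rightarrow> real) \<Rightarrow> 'a \<Rightarrow> real" where
  "step f x = heat f (prox h x)"

definition step_grad :: "('a \<Rightarrow> 'a) \<Rightarrow> 'a \<Rightarrow> 'a" where
  "step_grad G = prox_pullback (heat G)"

lemma C1_bdd_heat: "C1_bdd B L f G \<Longrightarrow> C1_bdd B L (heat f) (heat G)"
  using C1_bdd_average[OF _ prob_space_std_gauss, of B L f G "sqrt (2 * h)"]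
  by (simp add: heat_def[abs_def])

lemma C1_bdd_step: "C1_bdd B L f G \<Longrightarrow> C1_bdd B (L / (1 + h * R)) (step f) (step_grad G)"
  unfolding step_def[abs_def] step_grad_def by (intro C1_bdd_prox C1_bdd_heat)

lemma C1_bdd_step_funpow: "C1_bdd B L f G \<Longrightarrow> C1_bdd B (L / (1 + h * R) ^ k) ((step ^^ k) f) ((step_grad ^^ k) G)"
proof (induction k)
  case (Suc k)
  then show ?case using C1_bdd_step[of B "L / (1 + h * R) ^ k" "(step ^^ k) f" "(step_grad ^^ k) G"]
    by (simp add: mult.commute)
qed simp

lemma step_in_interval:
  assumes "f \<in> borel_measurable borel" "\<And>x. f x \<in> {a..b}" shows "step f x \<in> {a..b}"
  unfolding step_def heat_def by (rule integral_in_interval[OF prob_space_std_gauss]) (use assms in auto)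

lemma step_mono:
  assumes "f \<in> borel_measurable borel" "g \<in> borel_measurable borel" "\<And>x. \<bar>f x\<bar> \<le> B" "\<And>x. \<bar>g x\<bar> \<le> B'" "\<And>x. f x \<le> g x"
  shows "step f x \<le> step g x"
  unfolding step_def heat_def
proof (rule integral_mono)
  show "integrable std_gauss (\<lambda>v. f (prox h x + sqrt (2 * h) *\<^sub>R v))"
    by (rule std_gauss.integrable_const_bound[where B = B]) (use assms in auto)
  show "integrable std_gauss (\<lambda>v. g (prox h x + sqrt (2 * h) *\<^sub>R v))"
    by (rule std_gauss.integrable_const_bound[where B = B']) (use assms in auto)
qed (use assms in auto)

end

end

lemma weighted_square_const: "weighted_square (\<lambda>_. c) g = c * (norm g)\<^sup>2"
proof -
  have "(norm g)\<^sup>2 = (\<Sum>e\<in>Basis. (g \<bullet> e)\<^sup>2)"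
    unfolding power2_norm_eq_inner euclidean_inner[of g g] by (simp add: power2_eq_square)
  then show ?thesis by (simp add: weighted_square_def sum_distrib_left)
qed

section \<open>The functional inequality along the chain\<close>

locale bellman_potential = bellman a b N Nx Ny Nxx Nxy Nyx Nyy S + convex_potential U DU HU R
  for a b N Nx Ny Nxx Nxy Nyx Nyy S and U :: "'a::euclidean_space \<Rightarrow> real" and DU HU R
begin

text \<open>The weight that one step reproduces; \<open>weight_eq\<close> records its two
  descriptions, one for the Gaussian average and one for the contraction.\<close>

definition weight :: "real \<Rightarrow> real" where "weight h = (1 + h * R)\<^sup>2 / (R + h * R\<^sup>2 / 2)"

lemma weight_eq:
  assumes "h > 0"
  shows "weight h = 1 / (R + h * R\<^sup>2 / 2) + 2 * h" "weight h \<ge> 0" "weight h = (1 / (R + h * R\<^sup>2 / 2)) * (1 + h * R)\<^sup>2"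
proof -
  have pos: "R + h * R\<^sup>2 / 2 > 0" using assms R by (auto intro!: add_pos_nonneg)
  show "weight h = 1 / (R + h * R\<^sup>2 / 2) + 2 * h" unfolding weight_def using pos
    by (simp add: field_simps power2_eq_square)
  show "weight h \<ge> 0" unfolding weight_def using pos by simp
  show "weight h = (1 / (R + h * R\<^sup>2 / 2)) * (1 + h * R)\<^sup>2" by (simp add: weight_def)
qed

text \<open>The Gaussian average lowers the weight from \<open>\<alpha> + 2 * h\<close> to
  \<open>\<alpha>\<close>. The proximal map shrinks gradients, so weight \<open>\<alpha>\<close>
  before it dominates weight \<open>\<alpha> * (1 + h * R)\<^sup>2\<close> after it, and
  \<open>N\<close> decreases in its second argument.\<close>

lemma step_inequality:
  assumes h: "h > 0" and f: "C1_bdd B L f G" and fin: "\<And>x. f x \<in> {a..b}"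
  shows "step h (\<lambda>x. N (f x, weight h * (norm (G x))\<^sup>2)) x \<le> N (step h f x, weight h * (norm (step_grad h G x))\<^sup>2)"
proof -
  define \<alpha> where "\<alpha> = 1 / (R + h * R\<^sup>2 / 2)"
  have \<alpha>: "\<alpha> \<ge> 0" using h R by (simp add: \<alpha>_def)
  note w = weight_eq[OF h, folded \<alpha>_def]
  obtain bs where bs: "std_gauss = gauss_list bs" "set bs = (Basis :: 'a set)" "distinct bs"
    by (rule std_gauss_list)
  have ws: "weighted_square (\<lambda>e. \<alpha> + (if e \<in> set bs then (sqrt (2 * h))\<^sup>2 else 0)) g = weight h * (norm g)\<^sup>2" for g :: 'a
  proof -
    have "weighted_square (\<lambda>e. \<alpha> + (if e \<in> set bs then (sqrt (2 * h))\<^sup>2 else 0)) g = weighted_square (\<lambda>_. \<alpha> + 2 * h) g"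
      unfolding weighted_square_def using h by (intro sum.cong refl) (simp add: bs)
    then show ?thesis by (simp add: weighted_square_const w(1))
  qed
  have "step h (\<lambda>x. N (f x, weight h * (norm (G x))\<^sup>2)) x \<le> N (heat h f (prox h x), \<alpha> * (norm (heat h G (prox h x)))\<^sup>2)"
    using gauss_list_inequality[OF f fin _ bs(3), of "\<lambda>_. \<alpha>" "prox h x" "sqrt (2 * h)"] \<alpha> bs(2)
    unfolding ws unfolding step_def[OF h] heat_def[OF h] weighted_square_const bs(1) by simp
  also have "\<dots> \<le> N (heat h f (prox h x), weight h * (norm (step_grad h G x))\<^sup>2)"
  proof (rule N_antimono)
    show "heat h f (prox h x) \<in> {a..b}"
      using step_in_interval[OF h C1_bddD(6)[OF f] fin, of x] by (simp add: step_def[OF h])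
    show "0 \<le> weight h * (norm (step_grad h G x))\<^sup>2" using w(2) by simp
    have "((1 + h * R) * norm (step_grad h G x))\<^sup>2 \<le> (norm (heat h G (prox h x)))\<^sup>2"
      unfolding step_grad_def[OF h] using norm_prox_pullback[OF h] hR[OF h] by (intro power_mono) auto
    then have "\<alpha> * ((1 + h * R) * norm (step_grad h G x))\<^sup>2 \<le> \<alpha> * (norm (heat h G (prox h x)))\<^sup>2"
      using \<alpha> by (rule mult_left_mono)
    then show "weight h * (norm (step_grad h G x))\<^sup>2 \<le> \<alpha> * (norm (heat h G (prox h x)))\<^sup>2"
      by (simp add: w(3) power_mult_distrib mult.assoc)
  qed
  finally show ?thesis by (simp add: step_def[OF h])
qed

lemma step_funpow_in_interval:
  assumes h: "h > 0" and f: "C1_bdd B L f G" and fin: "\<And>x. f x \<in> {a..b}"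
  shows "(step h ^^ k) f x \<in> {a..b}"
proof (induction k arbitrary: x)
  case (Suc k)
  show ?case unfolding funpow.simps o_apply
    by (rule step_in_interval[OF h C1_bddD(6)[OF C1_bdd_step_funpow[OF h f]] Suc.IH])
qed (use fin in simp)

text \<open>Induction through the monotonicity of \<open>step\<close>. The hypothesis
  \<open>\<Phi>\<close> keeps the iterates on the left bounded and measurable.\<close>

lemma step_funpow_inequality:
  assumes h: "h > 0" and f: "C1_bdd B L f G" and fin: "\<And>x. f x \<in> {a..b}"
    and \<Phi>: "C1_bdd B' L' (\<lambda>x. N (f x, weight h * (norm (G x))\<^sup>2)) G'"
  shows "(step h ^^ k) (\<lambda>x. N (f x, weight h * (norm (G x))\<^sup>2)) x
    \<le> N ((step h ^^ k) f x, weight h * (norm ((step_grad h ^^ k) G x))\<^sup>2)"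
proof (induction k arbitrary: x)
  case (Suc k)
  let ?fk = "(step h ^^ k) f" and ?Gk = "(step_grad h ^^ k) G"
  note fk = C1_bdd_step_funpow[OF h f, of k]
  let ?Lk = "L / (1 + h * R) ^ k"
  have fkin: "?fk x \<in> {a..b}" for x by (rule step_funpow_in_interval[OF h f fin])
  obtain BN where BN: "\<And>p. p \<in> {a..b} \<times> {0..weight h * ?Lk\<^sup>2} \<Longrightarrow> \<bar>N p\<bar> \<le> BN" using N_bounded by blast
  have "step h ((step h ^^ k) (\<lambda>x. N (f x, weight h * (norm (G x))\<^sup>2))) x \<le> step h (\<lambda>x. N (?fk x, weight h * (norm (?Gk x))\<^sup>2)) x"
  proof (rule step_mono[OF h, where B = B' and B' = BN])
    show "(step h ^^ k) (\<lambda>x. N (f x, weight h * (norm (G x))\<^sup>2)) \<in> borel_measurable borel"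
      by (rule C1_bddD(6)[OF C1_bdd_step_funpow[OF h \<Phi>]])
    show "\<bar>(step h ^^ k) (\<lambda>x. N (f x, weight h * (norm (G x))\<^sup>2)) x\<bar> \<le> B'" for x
      by (rule C1_bddD(3)[OF C1_bdd_step_funpow[OF h \<Phi>]])
    show "(\<lambda>x. N (?fk x, weight h * (norm (?Gk x))\<^sup>2)) \<in> borel_measurable borel"
      by (intro borel_measurable_continuous_onI continuous_on_N_compose continuous_intros C1_bddD(2,5)[OF fk] fkin)
        (use weight_eq(2)[OF h] in simp)
    show "\<bar>N (?fk x, weight h * (norm (?Gk x))\<^sup>2)\<bar> \<le> BN" for x
      using fkin[of x] weight_eq(2)[OF h] power_mono[OF C1_bddD(4)[OF fk, of x] norm_ge_zero, of 2]
      by (intro BN) (simp add: mult_left_mono)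
  qed (rule Suc.IH)
  also have "\<dots> \<le> N (step h ?fk x, weight h * (norm (step_grad h ?Gk x))\<^sup>2)"
    by (rule step_inequality[OF h fk fkin])
  finally show ?case by simp
qed simp

end

section \<open>The log-concave measure and its gradient\<close>

lemma nn_integral_lborel_shift:
  fixes f :: "'a::euclidean_space \<Rightarrow> ennreal"
  assumes [measurable]: "f \<in> borel_measurable borel"
  shows "(\<integral>\<^sup>+x. f (x + c) \<partial>lborel) = (\<integral>\<^sup>+x. f x \<partial>lborel)"
proof -
  have "(\<integral>\<^sup>+x. f x \<partial>distr lborel borel ((+) c)) = (\<integral>\<^sup>+x. f (c + x) \<partial>lborel)"
    by (subst nn_integral_distr) auto
  then show ?thesis by (simp only: lborel_distr_plus add.commute)
qed

lemma integral_lborel_shift: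
  fixes f :: "'a::euclidean_space \<Rightarrow> 'b::{banach, second_countable_topology}"
  assumes [measurable]: "f \<in> borel_measurable borel"
  shows "(\<integral>x. f (x + c) \<partial>lborel) = (\<integral>x. f x \<partial>lborel)"
    and "integrable lborel (\<lambda>x. f (x + c)) \<longleftrightarrow> integrable lborel f"
proof -
  have "(\<integral>x. f x \<partial>distr lborel borel ((+) c)) = (\<integral>x. f (c + x) \<partial>lborel)"
    by (subst integral_distr) auto
  then show "(\<integral>x. f (x + c) \<partial>lborel) = (\<integral>x. f x \<partial>lborel)" by (simp only: lborel_distr_plus add.commute)
  have "integrable (distr lborel borel ((+) c)) f \<longleftrightarrow> integrable lborel (\<lambda>x. f (c + x))"
    by (subst integrable_distr_eq) auto
  then show "integrable lborel (\<lambda>x. f (x + c)) \<longleftrightarrow> integrable lborel f" by (simp only: lborel_distr_plus add.commute)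
qed

lemma nn_integral_lborel_scale:
  fixes f :: "'a::euclidean_space \<Rightarrow> ennreal"
  assumes [measurable]: "f \<in> borel_measurable borel" and c: "c > 0"
  shows "(\<integral>\<^sup>+x. f x \<partial>lborel) = ennreal (c ^ DIM('a)) * (\<integral>\<^sup>+x. f (c *\<^sub>R x) \<partial>lborel)"
proof -
  have "(\<integral>\<^sup>+x. f x \<partial>lborel) = (\<integral>\<^sup>+x. f x \<partial>density (distr lborel borel (\<lambda>x::'a. 0 + c *\<^sub>R x)) (\<lambda>_. \<bar>c\<bar>^DIM('a)))"
    using c by (subst lborel_affine[of c 0]) auto
  also have "\<dots> = ennreal (c ^ DIM('a)) * (\<integral>\<^sup>+x. f (c *\<^sub>R x) \<partial>lborel)"
    using c by (simp add: nn_integral_density nn_integral_distr nn_integral_cmult)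
  finally show ?thesis .
qed

locale log_concave = convex_potential U DU HU R for U :: "'a::euclidean_space \<Rightarrow> real" and DU HU R +
  assumes mass: "(\<integral>x. exp (- U x) \<partial>lborel) = 1"
begin

definition \<rho> :: "'a \<Rightarrow> real" where "\<rho> x = exp (- U x)"

definition \<mu> :: "'a measure" where "\<mu> = density lborel (\<lambda>x. ennreal (\<rho> x))"

lemma \<rho>_pos: "\<rho> x > 0" by (simp add: \<rho>_def)

lemma cont_\<rho>: "continuous_on A \<rho>"
  unfolding \<rho>_def by (intro continuous_intros contU)

lemma measurable_U [measurable]: "\<rho> \<in> borel_measurable borel" "U \<in> borel_measurable borel" "DU \<in> borel_measurable borel"
  using cont_\<rho> contU contDU by (auto intro: borel_measurable_continuous_onI)

lemma integrable_\<rho>: "integrable lborel \<rho>"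
  \<comment> \<open>The Bochner integral of a function that is not integrable is 0, so the value 1
    forces integrability.\<close>
  using mass not_integrable_integral_eq[of lborel \<rho>] unfolding \<rho>_def by fastforce

lemma integral_\<rho>: "(\<integral>x. \<rho> x \<partial>lborel) = 1"
  using mass by (simp add: \<rho>_def)

lemma nn_integral_\<rho>: "(\<integral>\<^sup>+x. ennreal (\<rho> x) \<partial>lborel) = 1"
  using nn_integral_eq_integral[OF integrable_\<rho>] integral_\<rho> \<rho>_pos by (simp add: less_imp_le)

lemma sets_\<mu> [simp, measurable_cong]: "sets \<mu> = sets borel" and space_\<mu> [simp]: "space \<mu> = UNIV"
  by (auto simp: \<mu>_def)

lemma prob_space_\<mu>: "prob_space \<mu>"
  by (rule prob_spaceI) (simp add: \<mu>_def emeasure_density nn_integral_\<rho>)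

sublocale \<mu>: prob_space \<mu> by (rule prob_space_\<mu>)

lemma integrable_\<mu>:
  fixes f :: "'a \<Rightarrow> 'b::{banach, second_countable_topology}"
  assumes "f \<in> borel_measurable borel"
  shows "integrable \<mu> f \<longleftrightarrow> integrable lborel (\<lambda>x. \<rho> x *\<^sub>R f x)"
  unfolding \<mu>_def using assms \<rho>_pos by (subst integrable_density) (auto simp: less_imp_le)

lemma integral_\<mu>:
  fixes f :: "'a \<Rightarrow> 'b::{banach, second_countable_topology}"
  assumes "f \<in> borel_measurable borel"
  shows "(\<integral>x. f x \<partial>\<mu>) = (\<integral>x. \<rho> x *\<^sub>R f x \<partial>lborel)"
  unfolding \<mu>_def using assms \<rho>_pos by (subst integral_density) (auto simp: less_imp_le)

section \<open>Integrability of the gradient of the potential\<close>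

lemma dilation_quotient_tendsto:
  "(\<lambda>n. (\<rho> x - \<rho> ((1 + inverse (real (Suc n))) *\<^sub>R x)) / inverse (real (Suc n))) \<longlonglongrightarrow> \<rho> x * (DU x \<bullet> x)"
proof -
  have "((\<lambda>t. x + t *\<^sub>R x) has_derivative (\<lambda>h. h *\<^sub>R x)) (at 0)" by (auto intro!: derivative_eq_intros)
  from has_derivative_compose[OF this, of U, OF dU]
  have "((\<lambda>t. U (x + t *\<^sub>R x)) has_derivative (\<lambda>h. DU x \<bullet> (h *\<^sub>R x))) (at 0)" by simp
  then have "((\<lambda>t. U (x + t *\<^sub>R x)) has_real_derivative (DU x \<bullet> x)) (at 0)"
    by (simp add: has_field_derivative_def mult_commute_abs)
  then have "((\<lambda>t. - \<rho> (x + t *\<^sub>R x)) has_real_derivative \<rho> x * (DU x \<bullet> x)) (at 0)"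
    unfolding \<rho>_def by (auto intro!: derivative_eq_intros)
  then have "(\<lambda>h. (- \<rho> (x + h *\<^sub>R x) - - \<rho> x) / h) \<midarrow>0\<rightarrow> \<rho> x * (DU x \<bullet> x)"
    unfolding DERIV_def by simp
  then have "(\<lambda>n. (- \<rho> (x + inverse (real (Suc n)) *\<^sub>R x) - - \<rho> x) / inverse (real (Suc n))) \<longlonglongrightarrow> \<rho> x * (DU x \<bullet> x)"
    unfolding LIMSEQ_SEQ_conv[symmetric] using LIMSEQ_inverse_real_of_nat by auto
  then show ?thesis by (simp add: scaleR_add_left)
qed

text \<open>Integrating the difference quotients of dilations bounds the integral of the radial derivative.\<close>

lemma integrable_radial: "integrable lborel (\<lambda>x. \<rho> x * (DU x \<bullet> x))"
proof -
  obtain m where m: "\<And>x. m \<le> U x" using U_bounded_below by blast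
  \<comment> \<open>Chosen to make \<open>g n x + C * \<rho> x\<close> nonnegative; it comes from
    \<open>exp t \<le> 1 + t * exp t\<close> with \<open>t\<close> between 0 and
    \<open>U 0 - m\<close>.\<close>
  define C where "C = (U 0 - m) * exp (U 0 - m)"
  have m0: "U 0 - m \<ge> 0" using m[of 0] by simp
  have C: "C \<ge> 0" using m0 by (simp add: C_def)
  \<comment> \<open>The tangent plane at \<open>x\<close>, evaluated at 0.\<close>
  have lower: "DU x \<bullet> x \<ge> - (U 0 - m)" for x
  proof -
    have "0 \<le> R / 2 * (norm (0 - x))\<^sup>2" using R by simp
    then show ?thesis using U_tangent[of x 0] m[of x] by simp
  qed
  define l where "l n = inverse (real (Suc n))" for n
  have l: "0 < l n" "l n \<le> 1" for n by (auto simp: l_def field_simps)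
  define g where "g n x = (\<rho> x - \<rho> ((1 + l n) *\<^sub>R x)) / l n" for n x
  have g_lower: "g n x \<ge> - (C * \<rho> x)" for x n
  proof -
    have "0 \<le> R / 2 * (norm ((1 + l n) *\<^sub>R x - x))\<^sup>2" using R by simp
    then have "U x + l n * (DU x \<bullet> x) \<le> U ((1 + l n) *\<^sub>R x)"
      using U_tangent[of x "(1 + l n) *\<^sub>R x"] by (simp add: algebra_simps)
    moreover have "l n * - (U 0 - m) \<le> l n * (DU x \<bullet> x)" using lower[of x] l[of n] by (intro mult_left_mono) auto
    ultimately have "\<rho> ((1 + l n) *\<^sub>R x) \<le> exp (- U x + l n * (U 0 - m))"
      unfolding \<rho>_def exp_le_cancel_iff mult_minus_right by linarith
    also have "\<dots> = \<rho> x * exp (l n * (U 0 - m))" unfolding \<rho>_def exp_add ..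
    also have "exp (l n * (U 0 - m)) \<le> 1 + l n * C"
    proof -
      let ?t = "l n * (U 0 - m)"
      have t: "0 \<le> ?t" "?t \<le> U 0 - m" using l[of n] m0 by (auto simp: mult_left_le_one_le)
      have "1 - ?t \<le> exp (- ?t)" using exp_ge_add_one_self[of "- ?t"] by simp
      then have "(1 - ?t) * exp ?t \<le> exp (- ?t) * exp ?t" by (intro mult_right_mono) auto
      then have "exp ?t \<le> 1 + ?t * exp ?t" by (simp add: algebra_simps flip: exp_add)
      also have "?t * exp ?t \<le> ?t * exp (U 0 - m)" using t by (intro mult_left_mono) auto
      finally show ?thesis by (simp add: C_def mult.assoc)
    qed
    finally have "\<rho> ((1 + l n) *\<^sub>R x) \<le> \<rho> x * (1 + l n * C)" using \<rho>_pos[of x] by (simp add: mult_left_mono)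
    then show ?thesis unfolding g_def using l[of n] by (simp add: field_simps)
  qed
  \<comment> \<open>By scaling of Lebesgue measure the mass of the dilated density is explicit;
    Bernoulli's inequality then bounds the integral of \<open>g n\<close> by the dimension,
    uniformly in \<open>n\<close>.\<close>
  have int_scaled: "integrable lborel (\<lambda>x. \<rho> ((1 + l n) *\<^sub>R x))" "(\<integral>x. \<rho> ((1 + l n) *\<^sub>R x) \<partial>lborel) = 1 / (1 + l n) ^ DIM('a)" for n
  proof -
    define D where "D = (1 + l n) ^ DIM('a)"
    have p: "D > 0" unfolding D_def using l[of n] by (intro zero_less_power) simp
    have "1 = ennreal D * (\<integral>\<^sup>+x. ennreal (\<rho> ((1 + l n) *\<^sub>R x)) \<partial>lborel)"
      using nn_integral_lborel_scale[of "\<lambda>x. ennreal (\<rho> x)" "1 + l n"] l[of n] by (simp add: nn_integral_\<rho> D_def)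
    then have "ennreal (1 / D) * 1 = ennreal (1 / D) * (ennreal D * (\<integral>\<^sup>+x. ennreal (\<rho> ((1 + l n) *\<^sub>R x)) \<partial>lborel))"
      by simp
    also have "\<dots> = ennreal (1 / D * D) * (\<integral>\<^sup>+x. ennreal (\<rho> ((1 + l n) *\<^sub>R x)) \<partial>lborel)"
      using p by (subst ennreal_mult) (auto simp: mult.assoc)
    also have "\<dots> = (\<integral>\<^sup>+x. ennreal (\<rho> ((1 + l n) *\<^sub>R x)) \<partial>lborel)" using p by simp
    finally have e: "(\<integral>\<^sup>+x. ennreal (\<rho> ((1 + l n) *\<^sub>R x)) \<partial>lborel) = ennreal (1 / D)" by simp
    have "has_bochner_integral lborel (\<lambda>x. \<rho> ((1 + l n) *\<^sub>R x)) (1 / D)"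
      by (rule has_bochner_integral_nn_integral[OF _ _ _ e]) (use \<rho>_pos p in \<open>auto simp: less_imp_le\<close>)
    then show "integrable lborel (\<lambda>x. \<rho> ((1 + l n) *\<^sub>R x))" "(\<integral>x. \<rho> ((1 + l n) *\<^sub>R x) \<partial>lborel) = 1 / (1 + l n) ^ DIM('a)"
      unfolding D_def by (auto simp: has_bochner_integral_iff)
  qed
  have int_g: "integrable lborel (\<lambda>x. g n x + C * \<rho> x)" for n
    unfolding g_def using int_scaled(1) integrable_\<rho> by simp
  have bound: "(\<integral>\<^sup>+x. ennreal (g n x + C * \<rho> x) \<partial>lborel) \<le> ennreal (DIM('a) + C)" for n
  proof -
    have "(\<integral>\<^sup>+x. ennreal (g n x + C * \<rho> x) \<partial>lborel) = ennreal (\<integral>x. g n x + C * \<rho> x \<partial>lborel)"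
    proof (rule nn_integral_eq_integral[OF int_g], rule AE_I2)
      fix x show "0 \<le> g n x + C * \<rho> x" using g_lower[of x n] by linarith
    qed
    also have "(\<integral>x. g n x + C * \<rho> x \<partial>lborel) = (1 - 1 / (1 + l n) ^ DIM('a)) / l n + C"
      unfolding g_def using int_scaled integrable_\<rho> integral_\<rho> by simp
    also have "\<dots> \<le> DIM('a) + C"
    proof -
      let ?y = "1 / (1 + l n)"
      have "1 + real DIM('a) * (?y - 1) \<le> (1 + (?y - 1)) ^ DIM('a)"
        by (rule Bernoulli_inequality) (use l[of n] in \<open>auto simp: field_simps\<close>)
      then have "1 - 1 / (1 + l n) ^ DIM('a) \<le> real DIM('a) * (1 - ?y)" by (simp add: power_one_over algebra_simps)
      also have "\<dots> \<le> real DIM('a) * l n" using l[of n] by (intro mult_left_mono) (auto simp: field_simps)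
      finally show ?thesis using l[of n] by (simp add: divide_le_eq)
    qed
    finally show ?thesis by (simp add: ennreal_leI)
  qed
  have "(\<integral>\<^sup>+x. ennreal (\<rho> x * (DU x \<bullet> x) + C * \<rho> x) \<partial>lborel) = (\<integral>\<^sup>+x. liminf (\<lambda>n. ennreal (g n x + C * \<rho> x)) \<partial>lborel)"
  proof (rule nn_integral_cong)
    fix x
    have "(\<lambda>n. ennreal (g n x + C * \<rho> x)) \<longlonglongrightarrow> ennreal (\<rho> x * (DU x \<bullet> x) + C * \<rho> x)"
      unfolding g_def l_def by (intro tendsto_intros dilation_quotient_tendsto)
    then show "ennreal (\<rho> x * (DU x \<bullet> x) + C * \<rho> x) = liminf (\<lambda>n. ennreal (g n x + C * \<rho> x))"
      by (simp add: lim_imp_Liminf)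
  qed
  \<comment> \<open>Fatou's lemma: an upper bound for the integral of the limit is all that
    integrability asks for.\<close>
  also have "\<dots> \<le> liminf (\<lambda>n. \<integral>\<^sup>+x. ennreal (g n x + C * \<rho> x) \<partial>lborel)"
    by (rule nn_integral_liminf) (simp add: g_def)
  also have "\<dots> \<le> liminf (\<lambda>n::nat. ennreal (DIM('a) + C))"
    by (rule Liminf_mono) (use bound in auto)
  also have "\<dots> < \<infinity>" by (simp add: Liminf_const)
  finally have fin: "(\<integral>\<^sup>+x. ennreal (\<rho> x * (DU x \<bullet> x) + C * \<rho> x) \<partial>lborel) < \<infinity>" .
  have "integrable lborel (\<lambda>x. \<rho> x * (DU x \<bullet> x) + C * \<rho> x)"
  proof (rule integrableI_nonneg)
    show "AE x in lborel. 0 \<le> \<rho> x * (DU x \<bullet> x) + C * \<rho> x"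
    proof (rule AE_I2)
      fix x
      have "U 0 - m \<le> C" unfolding C_def using m0 mult_left_mono[of 1 "exp (U 0 - m)" "U 0 - m"] by simp
      then have "0 \<le> \<rho> x * (DU x \<bullet> x + C)" using lower[of x] \<rho>_pos[of x] by (intro mult_nonneg_nonneg) auto
      then show "0 \<le> \<rho> x * (DU x \<bullet> x) + C * \<rho> x" by (simp add: algebra_simps)
    qed
  qed (use fin in auto)
  then have "integrable lborel (\<lambda>x. (\<rho> x * (DU x \<bullet> x) + C * \<rho> x) - C * \<rho> x)"
    using integrable_\<rho> by (intro Bochner_Integration.integrable_diff) auto
  then show ?thesis by simp
qed

text \<open>The tangent plane at x, evaluated on the unit ball in the direction of the gradient, controls
  the norm of the gradient by its radial part.\<close>

lemma integrable_DU: "integrable lborel (\<lambda>x. \<rho> x * norm (DU x))"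
proof -
  obtain m where m: "\<And>x. m \<le> U x" using U_bounded_below by blast
  have "compact (U ` cball 0 1)" by (intro compact_continuous_image contU compact_cball)
  then obtain C where C: "\<And>w. norm w \<le> 1 \<Longrightarrow> U w \<le> C"
    using compact_imp_bounded[of "U ` cball 0 1"] unfolding bounded_iff by (force simp: abs_le_iff)
  have le: "norm (DU x) \<le> (C - m) + DU x \<bullet> x" for x
  proof -
    let ?w = "DU x /\<^sub>R norm (DU x)"
    \<comment> \<open>If \<open>DU x = 0\<close>, then \<open>?w\<close> is 0, since the inverse of
      0 is 0, and both claims still hold.\<close>
    have w: "norm ?w \<le> 1" "DU x \<bullet> ?w = norm (DU x)"
      by (cases "DU x = 0"; simp add: dot_square_norm power2_eq_square)+
    have "0 \<le> R / 2 * (norm (?w - x))\<^sup>2" using R by simp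
    then have "U x + DU x \<bullet> (?w - x) \<le> U ?w" using U_tangent[of x ?w] by linarith
    then show ?thesis using C[OF w(1)] m[of x] w(2) by (simp add: inner_diff_right)
  qed
  show ?thesis
  proof (rule Bochner_Integration.integrable_bound)
    show "integrable lborel (\<lambda>x. (C - m) * \<rho> x + \<rho> x * (DU x \<bullet> x))"
      using integrable_\<rho> integrable_radial by simp
    show "AE x in lborel. norm (\<rho> x * norm (DU x)) \<le> norm ((C - m) * \<rho> x + \<rho> x * (DU x \<bullet> x))"
    proof (rule AE_I2)
      fix x
      have "\<rho> x * norm (DU x) \<le> \<rho> x * ((C - m) + DU x \<bullet> x)" using le \<rho>_pos[of x] by (intro mult_left_mono) auto
      also have "\<dots> = (C - m) * \<rho> x + \<rho> x * (DU x \<bullet> x)" by (simp add: algebra_simps)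
      finally show "norm (\<rho> x * norm (DU x)) \<le> norm ((C - m) * \<rho> x + \<rho> x * (DU x \<bullet> x))"
        using \<rho>_pos[of x] by (simp add: abs_mult)
    qed
  qed simp
qed

lemma integrable_\<mu>_DU: "integrable \<mu> (\<lambda>x. norm (DU x))"
  using integrable_DU by (subst integrable_\<mu>) auto

section \<open>Translations of the density in \<open>L^1\<close>\<close>

text \<open>The \<open>L^1\<close> norm of the gradient of \<open>\<rho>\<close>, which is
  \<open>- \<rho> x *\<^sub>R DU x\<close>.\<close>

definition grad_mass :: real where "grad_mass = (\<integral>x. \<rho> x * norm (DU x) \<partial>lborel)"

lemma has_derivative_\<rho>: "(\<rho> has_derivative (\<lambda>h. - (\<rho> x * (DU x \<bullet> h)))) (at x)"
  unfolding \<rho>_def by (auto intro!: derivative_eq_intros dU simp: algebra_simps)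

text \<open>The difference is the integral of the derivative along a segment; the integrals are
  exchanged and the translation is undone. Nonnegative integrals make the exchange unconditional.
  The bound is exactly \<open>s\<close> times the \<open>L^1\<close> norm of the directional
  derivative, with no further constant, as the application of Scheffe's lemma requires.\<close>

lemma nn_integral_translation_difference:
  assumes s: "s \<ge> 0"
  shows "(\<integral>\<^sup>+x. ennreal \<bar>\<rho> x - \<rho> (x + s *\<^sub>R \<xi>)\<bar> \<partial>lborel) \<le> ennreal s * (\<integral>\<^sup>+x. ennreal \<bar>\<rho> x * (DU x \<bullet> \<xi>)\<bar> \<partial>lborel)"
proof -
  let ?k = "\<lambda>x. \<rho> x * (DU x \<bullet> \<xi>)"
  have ck: "continuous_on UNIV ?k" by (intro continuous_intros cont_\<rho> contDU)
  have pt: "ennreal \<bar>\<rho> x - \<rho> (x + s *\<^sub>R \<xi>)\<bar> \<le> (\<integral>\<^sup>+q. ennreal (indicator {0..s} q * \<bar>?k (x + q *\<^sub>R \<xi>)\<bar>) \<partial>lborel)" for x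
  proof -
    have cont: "continuous_on {0..s} (\<lambda>q. ?k (x + q *\<^sub>R \<xi>))"
      by (rule continuous_on_compose2[OF ck]) (auto intro!: continuous_intros)
    have "((\<lambda>q. - \<rho> (x + q *\<^sub>R \<xi>)) has_vector_derivative ?k (x + q *\<^sub>R \<xi>)) (at q within {0..s})" for q
    proof -
      have "((\<lambda>q. x + q *\<^sub>R \<xi>) has_derivative (\<lambda>h. h *\<^sub>R \<xi>)) (at q within {0..s})" by (auto intro!: derivative_eq_intros)
      from has_derivative_minus[OF has_derivative_compose[OF this has_derivative_\<rho>]]
      show ?thesis by (simp add: has_vector_derivative_def mult_ac)
    qed
    then have "(\<integral>q. indicator {0..s} q *\<^sub>R ?k (x + q *\<^sub>R \<xi>) \<partial>lborel) = - \<rho> (x + s *\<^sub>R \<xi>) - - \<rho> (x + 0 *\<^sub>R \<xi>)"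
      using s cont by (intro integral_FTC_atLeastAtMost) auto
    then have "ennreal \<bar>\<rho> x - \<rho> (x + s *\<^sub>R \<xi>)\<bar> = ennreal (norm (\<integral>q. indicator {0..s} q *\<^sub>R ?k (x + q *\<^sub>R \<xi>) \<partial>lborel))" by simp
    also have "\<dots> \<le> (\<integral>\<^sup>+q. ennreal (norm (indicator {0..s} q *\<^sub>R ?k (x + q *\<^sub>R \<xi>))) \<partial>lborel)"
      using borel_integrable_atLeastAtMost'[OF cont] unfolding set_integrable_def by (rule integral_norm_bound_ennreal)
    finally show ?thesis by (simp add: abs_mult)
  qed
  have "(\<integral>\<^sup>+x. ennreal \<bar>\<rho> x - \<rho> (x + s *\<^sub>R \<xi>)\<bar> \<partial>lborel) \<le> (\<integral>\<^sup>+x. (\<integral>\<^sup>+q. ennreal (indicator {0..s} q * \<bar>?k (x + q *\<^sub>R \<xi>)\<bar>) \<partial>lborel) \<partial>lborel)"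
    by (intro nn_integral_mono pt)
  also have "\<dots> = (\<integral>\<^sup>+q. (\<integral>\<^sup>+x. ennreal (indicator {0..s} q * \<bar>?k (x + q *\<^sub>R \<xi>)\<bar>) \<partial>lborel) \<partial>lborel)"
    by (rule lborel_pair.Fubini'[symmetric]) (unfold split_beta', measurable)
  also have "\<dots> = (\<integral>\<^sup>+q. ennreal (indicator {0..s} (q::real)) * (\<integral>\<^sup>+x. ennreal \<bar>?k x\<bar> \<partial>lborel) \<partial>lborel)"
  proof (rule nn_integral_cong)
    fix q :: real
    have "(\<integral>\<^sup>+x. ennreal (indicator {0..s} q * \<bar>?k (x + q *\<^sub>R \<xi>)\<bar>) \<partial>lborel) = ennreal (indicator {0..s} q) * (\<integral>\<^sup>+x. ennreal \<bar>?k (x + q *\<^sub>R \<xi>)\<bar> \<partial>lborel)"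
      by (subst nn_integral_cmult[symmetric]) (auto simp: ennreal_mult)
    also have "(\<integral>\<^sup>+x. ennreal \<bar>?k (x + q *\<^sub>R \<xi>)\<bar> \<partial>lborel) = (\<integral>\<^sup>+x. ennreal \<bar>?k x\<bar> \<partial>lborel)"
      by (rule nn_integral_lborel_shift) simp
    finally show "(\<integral>\<^sup>+x. ennreal (indicator {0..s} q * \<bar>?k (x + q *\<^sub>R \<xi>)\<bar>) \<partial>lborel) = ennreal (indicator {0..s} q) * (\<integral>\<^sup>+x. ennreal \<bar>?k x\<bar> \<partial>lborel)" .
  qed
  also have "\<dots> = (\<integral>\<^sup>+q. ennreal (indicator {0..s} (q::real)) \<partial>lborel) * (\<integral>\<^sup>+x. ennreal \<bar>?k x\<bar> \<partial>lborel)"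
    by (rule nn_integral_multc) simp
  also have "(\<integral>\<^sup>+q. ennreal (indicator {0..s} (q::real)) \<partial>lborel) = ennreal s"
    using s by (simp add: ennreal_indicator)
  finally show ?thesis .
qed

lemma integrable_k: "integrable lborel (\<lambda>x. \<rho> x * (DU x \<bullet> \<xi>))"
proof (rule Bochner_Integration.integrable_bound)
  show "integrable lborel (\<lambda>x. norm \<xi> * (\<rho> x * norm (DU x)))" using integrable_DU by simp
  show "AE x in lborel. norm (\<rho> x * (DU x \<bullet> \<xi>)) \<le> norm (norm \<xi> * (\<rho> x * norm (DU x)))"
  proof (rule AE_I2)
    fix x
    have "\<rho> x * \<bar>DU x \<bullet> \<xi>\<bar> \<le> \<rho> x * (norm (DU x) * norm \<xi>)"
      using \<rho>_pos[of x] by (intro mult_left_mono Cauchy_Schwarz_ineq2) simp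
    then show "norm (\<rho> x * (DU x \<bullet> \<xi>)) \<le> norm (norm \<xi> * (\<rho> x * norm (DU x)))"
      using \<rho>_pos[of x] by (simp add: abs_mult mult_ac)
  qed
qed simp

lemma integral_k_le: "(\<integral>x. \<bar>\<rho> x * (DU x \<bullet> \<xi>)\<bar> \<partial>lborel) \<le> norm \<xi> * grad_mass"
proof -
  have "(\<integral>x. \<bar>\<rho> x * (DU x \<bullet> \<xi>)\<bar> \<partial>lborel) \<le> (\<integral>x. norm \<xi> * (\<rho> x * norm (DU x)) \<partial>lborel)"
  proof (rule integral_mono)
    fix x
    have "\<rho> x * \<bar>DU x \<bullet> \<xi>\<bar> \<le> \<rho> x * (norm (DU x) * norm \<xi>)"
      using \<rho>_pos[of x] by (intro mult_left_mono Cauchy_Schwarz_ineq2) simp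
    then show "\<bar>\<rho> x * (DU x \<bullet> \<xi>)\<bar> \<le> norm \<xi> * (\<rho> x * norm (DU x))"
      using \<rho>_pos[of x] by (simp add: abs_mult mult_ac)
  qed (use integrable_k integrable_DU in auto)
  then show ?thesis using integrable_DU by (simp add: grad_mass_def)
qed

definition shift_error :: "real \<Rightarrow> 'a \<Rightarrow> real" where
  "shift_error s \<xi> = (\<integral>x. \<bar>\<rho> x - \<rho> (x + s *\<^sub>R \<xi>) - s * (\<rho> x * (DU x \<bullet> \<xi>))\<bar> \<partial>lborel)"

lemma integrable_shift: "integrable lborel (\<lambda>x. \<rho> (x + v))"
  using integrable_\<rho> integral_lborel_shift(2)[of \<rho> v] by simp

lemma integrable_shift_error: "integrable lborel (\<lambda>x. \<bar>\<rho> x - \<rho> (x + s *\<^sub>R \<xi>) - s * (\<rho> x * (DU x \<bullet> \<xi>))\<bar>)"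
  using integrable_shift[of "s *\<^sub>R \<xi>"] integrable_\<rho> integrable_k[of \<xi>] by auto

lemma shift_error_nonneg: "shift_error s \<xi> \<ge> 0"
  unfolding shift_error_def by simp

lemma integral_translation_difference:
  assumes "s \<ge> 0" shows "(\<integral>x. \<bar>\<rho> x - \<rho> (x + s *\<^sub>R \<xi>)\<bar> \<partial>lborel) \<le> s * (\<integral>x. \<bar>\<rho> x * (DU x \<bullet> \<xi>)\<bar> \<partial>lborel)"
proof -
  have "ennreal (\<integral>x. \<bar>\<rho> x - \<rho> (x + s *\<^sub>R \<xi>)\<bar> \<partial>lborel) = (\<integral>\<^sup>+x. ennreal \<bar>\<rho> x - \<rho> (x + s *\<^sub>R \<xi>)\<bar> \<partial>lborel)"
    using integrable_shift[of "s *\<^sub>R \<xi>"] integrable_\<rho> by (intro nn_integral_eq_integral[symmetric]) auto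
  also have "\<dots> \<le> ennreal s * (\<integral>\<^sup>+x. ennreal \<bar>\<rho> x * (DU x \<bullet> \<xi>)\<bar> \<partial>lborel)"
    by (rule nn_integral_translation_difference[OF assms])
  also have "(\<integral>\<^sup>+x. ennreal \<bar>\<rho> x * (DU x \<bullet> \<xi>)\<bar> \<partial>lborel) = ennreal (\<integral>x. \<bar>\<rho> x * (DU x \<bullet> \<xi>)\<bar> \<partial>lborel)"
    using integrable_k by (intro nn_integral_eq_integral) auto
  also have "ennreal s * \<dots> = ennreal (s * (\<integral>x. \<bar>\<rho> x * (DU x \<bullet> \<xi>)\<bar> \<partial>lborel))"
    using assms by (simp add: ennreal_mult)
  finally show ?thesis using assms by (subst (asm) ennreal_le_iff) auto
qed

lemma shift_error_le:
  assumes "s \<ge> 0" shows "shift_error s \<xi> \<le> 2 * s * norm \<xi> * grad_mass"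
proof -
  have "shift_error s \<xi> \<le> (\<integral>x. \<bar>\<rho> x - \<rho> (x + s *\<^sub>R \<xi>)\<bar> + s * \<bar>\<rho> x * (DU x \<bullet> \<xi>)\<bar> \<partial>lborel)"
    unfolding shift_error_def
  proof (rule integral_mono[OF integrable_shift_error])
    show "integrable lborel (\<lambda>x. \<bar>\<rho> x - \<rho> (x + s *\<^sub>R \<xi>)\<bar> + s * \<bar>\<rho> x * (DU x \<bullet> \<xi>)\<bar>)"
      using integrable_shift[of "s *\<^sub>R \<xi>"] integrable_\<rho> integrable_k[of \<xi>] by auto
    fix x show "\<bar>\<rho> x - \<rho> (x + s *\<^sub>R \<xi>) - s * (\<rho> x * (DU x \<bullet> \<xi>))\<bar> \<le> \<bar>\<rho> x - \<rho> (x + s *\<^sub>R \<xi>)\<bar> + s * \<bar>\<rho> x * (DU x \<bullet> \<xi>)\<bar>"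
      using abs_triangle_ineq4[of "\<rho> x - \<rho> (x + s *\<^sub>R \<xi>)" "s * (\<rho> x * (DU x \<bullet> \<xi>))"] assms by (simp add: abs_mult)
  qed
  also have "\<dots> = (\<integral>x. \<bar>\<rho> x - \<rho> (x + s *\<^sub>R \<xi>)\<bar> \<partial>lborel) + s * (\<integral>x. \<bar>\<rho> x * (DU x \<bullet> \<xi>)\<bar> \<partial>lborel)"
    using integrable_shift[of "s *\<^sub>R \<xi>"] integrable_\<rho> integrable_k[of \<xi>] by simp
  also have "\<dots> \<le> 2 * (s * (\<integral>x. \<bar>\<rho> x * (DU x \<bullet> \<xi>)\<bar> \<partial>lborel))"
    using integral_translation_difference[OF assms, of \<xi>] by simp
  also have "\<dots> \<le> 2 * (s * (norm \<xi> * grad_mass))"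
    using assms integral_k_le by (intro mult_left_mono) auto
  finally show ?thesis by (simp add: mult_ac)
qed

text \<open>Scheffe's lemma: the difference quotients of \<open>\<rho>\<close> converge pointwise,
  and their \<open>L^1\<close> norms do not exceed that of the limit, so they converge in
  \<open>L^1\<close>. No second derivative of \<open>\<rho>\<close> has to be integrated.\<close>

lemma shift_error_tendsto:
  assumes s: "s \<longlonglongrightarrow> 0" "\<And>n::nat. s n > 0"
  shows "(\<lambda>n. shift_error (s n) \<xi> / s n) \<longlonglongrightarrow> 0"
proof -
  let ?k = "\<lambda>x. \<rho> x * (DU x \<bullet> \<xi>)"
  let ?F = "\<lambda>n x. (\<rho> x - \<rho> (x + s n *\<^sub>R \<xi>)) / s n"
  have iF: "integrable lborel (?F n)" for n using integrable_shift[of "s n *\<^sub>R \<xi>"] integrable_\<rho> by simp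
  have "(\<lambda>n. \<integral>\<^sup>+x. ennreal (norm (?F n x - ?k x)) \<partial>lborel) \<longlonglongrightarrow> 0"
  proof (rule Scheffe_lemma1[OF iF integrable_k])
    show "AE x in lborel. (\<lambda>n. ?F n x) \<longlonglongrightarrow> ?k x"
    proof (rule AE_I2)
      fix x
      have "((\<lambda>t. x + t *\<^sub>R \<xi>) has_derivative (\<lambda>h. h *\<^sub>R \<xi>)) (at 0)" by (auto intro!: derivative_eq_intros)
      from has_derivative_minus[OF has_derivative_compose[OF this, of \<rho>, OF has_derivative_\<rho>]]
      have "((\<lambda>t. - \<rho> (x + t *\<^sub>R \<xi>)) has_derivative (\<lambda>h. \<rho> x * (DU x \<bullet> (h *\<^sub>R \<xi>)))) (at 0)"
        by simp
      then have "((\<lambda>t. - \<rho> (x + t *\<^sub>R \<xi>)) has_real_derivative ?k x) (at 0)"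
        by (simp add: has_field_derivative_def mult_ac mult_commute_abs)
      then have "(\<lambda>h. (- \<rho> (x + h *\<^sub>R \<xi>) - - \<rho> x) / h) \<midarrow>0\<rightarrow> ?k x"
        unfolding DERIV_def by simp
      then have "(\<lambda>n. (- \<rho> (x + s n *\<^sub>R \<xi>) - - \<rho> x) / s n) \<longlonglongrightarrow> ?k x"
        unfolding LIMSEQ_SEQ_conv[symmetric] using s(1) less_imp_neq[OF s(2), symmetric] by blast
      then show "(\<lambda>n. ?F n x) \<longlonglongrightarrow> ?k x" by simp
    qed
    show "limsup (\<lambda>n. \<integral>\<^sup>+x. ennreal (norm (?F n x)) \<partial>lborel) \<le> (\<integral>\<^sup>+x. ennreal (norm (?k x)) \<partial>lborel)"
    proof (rule Limsup_bounded, rule always_eventually, rule allI)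
      fix n
      have sn: "s n > 0" by (rule s(2))
      have "(\<integral>\<^sup>+x. ennreal (norm (?F n x)) \<partial>lborel) = (\<integral>\<^sup>+x. ennreal (1 / s n) * ennreal \<bar>\<rho> x - \<rho> (x + s n *\<^sub>R \<xi>)\<bar> \<partial>lborel)"
        using sn by (intro nn_integral_cong) (simp add: abs_divide flip: ennreal_mult)
      also have "\<dots> = ennreal (1 / s n) * (\<integral>\<^sup>+x. ennreal \<bar>\<rho> x - \<rho> (x + s n *\<^sub>R \<xi>)\<bar> \<partial>lborel)"
        by (rule nn_integral_cmult) simp
      also have "\<dots> \<le> ennreal (1 / s n) * (ennreal (s n) * (\<integral>\<^sup>+x. ennreal \<bar>?k x\<bar> \<partial>lborel))"
        using sn by (intro mult_left_mono nn_integral_translation_difference) auto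
      also have "\<dots> = (\<integral>\<^sup>+x. ennreal (norm (?k x)) \<partial>lborel)"
        using sn by (simp add: mult.assoc[symmetric] flip: ennreal_mult)
      finally show "(\<integral>\<^sup>+x. ennreal (norm (?F n x)) \<partial>lborel) \<le> (\<integral>\<^sup>+x. ennreal (norm (?k x)) \<partial>lborel)" .
    qed
  qed
  moreover have "(\<integral>\<^sup>+x. ennreal (norm (?F n x - ?k x)) \<partial>lborel) = ennreal (shift_error (s n) \<xi> / s n)" for n
  proof -
    have sn: "s n > 0" by (rule s(2))
    have "(\<integral>\<^sup>+x. ennreal (norm (?F n x - ?k x)) \<partial>lborel) = ennreal (\<integral>x. norm (?F n x - ?k x) \<partial>lborel)"
      by (rule nn_integral_eq_integral) (use iF integrable_k in auto)
    also have "(\<integral>x. norm (?F n x - ?k x) \<partial>lborel) = (\<integral>x. \<bar>\<rho> x - \<rho> (x + s n *\<^sub>R \<xi>) - s n * ?k x\<bar> / s n \<partial>lborel)"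
    proof (rule Bochner_Integration.integral_cong[OF refl])
      fix x
      have "?F n x - ?k x = (\<rho> x - \<rho> (x + s n *\<^sub>R \<xi>) - s n * ?k x) / s n" using sn by (simp add: field_simps)
      then show "norm (?F n x - ?k x) = \<bar>\<rho> x - \<rho> (x + s n *\<^sub>R \<xi>) - s n * ?k x\<bar> / s n" using sn by (simp add: abs_divide)
    qed
    finally show ?thesis by (simp add: shift_error_def)
  qed
  ultimately have "(\<lambda>n. ennreal (shift_error (s n) \<xi> / s n)) \<longlonglongrightarrow> ennreal 0" by simp
  then show ?thesis
    by (rule tendsto_ennrealD) (use shift_error_nonneg s(2) in \<open>auto simp: less_imp_le\<close>)
qed

end

section \<open>Near-invariance under the Langevin step\<close>

lemma integrable_std_gauss_norm: "integrable std_gauss (\<lambda>v. norm v)"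
  and integrable_std_gauss_square: "integrable std_gauss (\<lambda>v. (norm v)\<^sup>2)"
  unfolding std_gauss_def by (rule integrable_gauss_list_norm integrable_gauss_list_square)+

lemma integral_std_gauss_uminus:
  fixes f :: "'a::euclidean_space \<Rightarrow> 'b::{banach, second_countable_topology}"
  assumes "f \<in> borel_measurable borel"
  shows "(\<integral>v. f (- v) \<partial>std_gauss) = (\<integral>v. f v \<partial>std_gauss)"
  unfolding std_gauss_def by (rule integral_gauss_list_uminus[OF assms])

lemma integral_std_gauss_inner: "(\<integral>v. v \<bullet> u \<partial>std_gauss) = 0"
  using integral_std_gauss_uminus[of "\<lambda>v. v \<bullet> u"] by simp

lemma std_gauss_integration_by_parts:
  fixes f :: "'a::euclidean_space \<Rightarrow> real"
  assumes f: "C1_bdd B L f G"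
  shows "(\<integral>v. f (x + \<sigma> *\<^sub>R v) * (v \<bullet> u) \<partial>std_gauss) = \<sigma> * ((\<integral>v. G (x + \<sigma> *\<^sub>R v) \<partial>std_gauss) \<bullet> u)"
proof -
  obtain bs where bs: "std_gauss = gauss_list bs" "set bs = (Basis :: 'a set)" "distinct bs"
    by (rule std_gauss_list)
  have "(\<Sum>b\<leftarrow>bs. (b \<bullet> u) *\<^sub>R b) = (\<Sum>b\<in>Basis. (u \<bullet> b) *\<^sub>R b)"
    using bs by (simp add: sum_list_distinct_conv_sum_set inner_commute)
  also have "\<dots> = u" by (rule euclidean_representation)
  finally show ?thesis using gauss_list_integration_by_parts[OF f, where x = x and \<sigma> = \<sigma> and u = u and bs = bs] bs(1) by simp
qed

text \<open>After subtraction of the linear part at \<open>x\<close> the gradient is at most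
  \<open>M * norm (y - x)\<close> on the ball reaching to \<open>y\<close>. The factor 1/2 of the
  sharp bound is given away.\<close>

lemma C1_bdd_taylor:
  assumes f: "C1_bdd B L f G" and M: "\<And>x y. norm (G x - G y) \<le> M * norm (x - y)"
  shows "\<bar>f y - f x - G x \<bullet> (y - x)\<bar> \<le> M * (norm (y - x))\<^sup>2"
proof (cases "y = x")
  case False
  have M0: "0 \<le> M" using M[of y x] False norm_ge_zero[of "G y - G x"] by (smt (verit) mult_neg_pos zero_less_norm_iff right_minus_eq)
  have "norm ((f y - G x \<bullet> y) - (f x - G x \<bullet> x)) \<le> (M * norm (y - x)) * norm (y - x)"
  proof (rule differentiable_bound[of "cball x (norm (y - x))"])
    fix z assume z: "z \<in> cball x (norm (y - x))"
    show "((\<lambda>z. f z - G x \<bullet> z) has_derivative (\<lambda>h. (G z - G x) \<bullet> h)) (at z within cball x (norm (y - x)))"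
      unfolding inner_diff_left
      by (intro has_derivative_diff has_derivative_at_withinI[OF C1_bddD(1)[OF f]] bounded_linear_imp_has_derivative bounded_linear_inner_right)
    show "onorm (\<lambda>h. (G z - G x) \<bullet> h) \<le> M * norm (y - x)"
    proof (rule onorm_le)
      fix h
      have "norm (G z - G x) \<le> M * norm (y - x)"
        using M[of z x] z M0 by (auto simp: dist_norm norm_minus_commute intro: order_trans mult_left_mono)
      then show "norm ((G z - G x) \<bullet> h) \<le> M * norm (y - x) * norm h"
        using Cauchy_Schwarz_ineq2[of "G z - G x" h] mult_right_mono[of "norm (G z - G x)" "M * norm (y - x)" "norm h"] by simp
    qed
  qed (auto simp: dist_norm norm_minus_commute)
  then show ?thesis by (simp add: inner_diff_right power2_eq_square algebra_simps)
qed simp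

definition gauss_moment :: "'a::euclidean_space itself \<Rightarrow> real" where
  "gauss_moment _ = (\<integral>v. norm v \<partial>(std_gauss :: 'a measure))"

lemma gauss_moment_nonneg: "gauss_moment TYPE('a::euclidean_space) \<ge> 0"
  unfolding gauss_moment_def by simp

text \<open>Integration by parts puts the derivative on the Gaussian and leaves \<open>f\<close>,
  which is Lipschitz; the test direction is the difference \<open>?u\<close> of the two gradients
  itself. The factor \<open>1 / \<sigma>\<close> is affordable: for
  \<open>\<sigma> = sqrt (2 * h)\<close> it meets a squared displacement of order
  \<open>h\<^sup>2\<close>.\<close>

lemma smoothed_gradient_lipschitz:
  fixes f :: "'a::euclidean_space \<Rightarrow> real"
  assumes f: "C1_bdd B L f G" and \<sigma>: "\<sigma> > 0"
  shows "norm ((\<integral>v. G (x + \<sigma> *\<^sub>R v) \<partial>std_gauss) - (\<integral>v. G (y + \<sigma> *\<^sub>R v) \<partial>std_gauss))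
    \<le> (L * gauss_moment TYPE('a) / \<sigma>) * norm (x - y)"
proof -
  let ?H = "\<lambda>x. \<integral>v. G (x + \<sigma> *\<^sub>R v) \<partial>std_gauss"
  let ?u = "?H x - ?H y"
  note [measurable] = C1_bddD(6)[OF f]
  have B: "0 \<le> B" and L: "0 \<le> L" using C1_bddD(3,4)[OF f, of 0] norm_ge_zero[of "G 0"] by linarith+
  have i: "integrable std_gauss (\<lambda>v. f (z + \<sigma> *\<^sub>R v) * (v \<bullet> ?u))" for z
  proof (rule Bochner_Integration.integrable_bound)
    show "integrable std_gauss (\<lambda>v. B * norm ?u * norm v)" by (intro integrable_mult_right integrable_std_gauss_norm)
    show "AE v in std_gauss. norm (f (z + \<sigma> *\<^sub>R v) * (v \<bullet> ?u)) \<le> norm (B * norm ?u * norm v)"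
    proof (rule AE_I2)
      fix v
      have "\<bar>f (z + \<sigma> *\<^sub>R v)\<bar> * \<bar>v \<bullet> ?u\<bar> \<le> B * (norm v * norm ?u)"
        using C1_bddD(3)[OF f] Cauchy_Schwarz_ineq2 B by (intro mult_mono) auto
      then show "norm (f (z + \<sigma> *\<^sub>R v) * (v \<bullet> ?u)) \<le> norm (B * norm ?u * norm v)"
        using B by (simp add: abs_mult mult_ac)
    qed
  qed simp
  have "\<sigma> * (norm ?u)\<^sup>2 = \<sigma> * (?H x \<bullet> ?u) - \<sigma> * (?H y \<bullet> ?u)"
    by (simp add: power2_norm_eq_inner inner_diff_left right_diff_distrib)
  also have "\<dots> = (\<integral>v. f (x + \<sigma> *\<^sub>R v) * (v \<bullet> ?u) \<partial>std_gauss) - (\<integral>v. f (y + \<sigma> *\<^sub>R v) * (v \<bullet> ?u) \<partial>std_gauss)"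
    by (simp only: std_gauss_integration_by_parts[OF f])
  also have "\<dots> = (\<integral>v. (f (x + \<sigma> *\<^sub>R v) - f (y + \<sigma> *\<^sub>R v)) * (v \<bullet> ?u) \<partial>std_gauss)"
    unfolding left_diff_distrib by (rule Bochner_Integration.integral_diff[OF i i, symmetric])
  also have "\<dots> \<le> (\<integral>v. L * norm (x - y) * norm ?u * norm v \<partial>(std_gauss :: 'a measure))"
  proof (rule integral_mono)
    show "integrable std_gauss (\<lambda>v. (f (x + \<sigma> *\<^sub>R v) - f (y + \<sigma> *\<^sub>R v)) * (v \<bullet> ?u))"
      unfolding left_diff_distrib by (rule Bochner_Integration.integrable_diff[OF i i])
    show "integrable (std_gauss :: 'a measure) (\<lambda>v. L * norm (x - y) * norm ?u * norm v)" by (intro integrable_mult_right integrable_std_gauss_norm)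
    fix v
    have "(f (x + \<sigma> *\<^sub>R v) - f (y + \<sigma> *\<^sub>R v)) * (v \<bullet> ?u) \<le> \<bar>f (x + \<sigma> *\<^sub>R v) - f (y + \<sigma> *\<^sub>R v)\<bar> * \<bar>v \<bullet> ?u\<bar>"
      by (metis abs_ge_self abs_mult)
    also have "\<dots> \<le> (L * norm (x - y)) * (norm v * norm ?u)"
      using C1_bdd_lipschitz[OF f, of "x + \<sigma> *\<^sub>R v" "y + \<sigma> *\<^sub>R v"] Cauchy_Schwarz_ineq2 L by (intro mult_mono) auto
    finally show "(f (x + \<sigma> *\<^sub>R v) - f (y + \<sigma> *\<^sub>R v)) * (v \<bullet> ?u) \<le> L * norm (x - y) * norm ?u * norm v" by (simp add: mult_ac)
  qed
  also have "\<dots> = (L * norm (x - y) * gauss_moment TYPE('a)) * norm ?u" by (simp add: gauss_moment_def)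
  finally have le: "norm ?u * (\<sigma> * norm ?u) \<le> norm ?u * (L * norm (x - y) * gauss_moment TYPE('a))"
    by (simp add: power2_eq_square mult_ac)
  have "\<sigma> * norm ?u \<le> L * norm (x - y) * gauss_moment TYPE('a)"
  proof (cases "?u = 0")
    case True
    moreover have "0 \<le> L * norm (x - y) * gauss_moment TYPE('a)" using L gauss_moment_nonneg[where 'a = 'a] by simp
    ultimately show ?thesis by (simp only: norm_zero mult_zero_right)
  next
    case False
    then show ?thesis by (intro mult_left_le_imp_le[OF le]) simp
  qed
  then show ?thesis using \<sigma> by (simp add: field_simps)
qed

section \<open>Invariance error of the heat part\<close>

context log_concave begin

sublocale gauss_\<mu>: pair_prob_space "std_gauss :: 'a measure" \<mu> ..

text \<open>The expected remainder of the density, relative to the step, at the Gaussian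
  displacement. It depends on the measure and on \<open>h\<close>, not on the test function.\<close>

definition heat_error :: "real \<Rightarrow> real" where
  "heat_error h = (\<integral>v. norm v * (shift_error (sqrt (2 * h)) v / sqrt (2 * h)) \<partial>std_gauss)"

lemma measurable_shift_error [measurable]: "shift_error s \<in> borel_measurable borel"
  unfolding shift_error_def[abs_def] by measurable

lemma integrable_heat_error:
  assumes "s > 0" shows "integrable std_gauss (\<lambda>v. norm v * (shift_error s v / s))"
proof (rule Bochner_Integration.integrable_bound)
  show "integrable std_gauss (\<lambda>v. 2 * grad_mass * (norm v)\<^sup>2)" by (intro integrable_mult_right integrable_std_gauss_square)
  show "AE v in std_gauss. norm (norm v * (shift_error s v / s)) \<le> norm (2 * grad_mass * (norm v)\<^sup>2)"
  proof (rule AE_I2)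
    fix v
    have "shift_error s v / s \<le> 2 * norm v * grad_mass" using shift_error_le[of s v] assms by (simp add: divide_le_eq mult_ac)
    then have "norm v * (shift_error s v / s) \<le> norm v * (2 * norm v * grad_mass)" by (rule mult_left_mono) simp
    also have "\<dots> = 2 * grad_mass * (norm v)\<^sup>2" by (simp add: power2_eq_square)
    finally have *: "norm v * (shift_error s v / s) \<le> 2 * grad_mass * (norm v)\<^sup>2" .
    have "0 \<le> norm v * (shift_error s v / s)" using shift_error_nonneg[of s v] assms by simp
    with * show "norm (norm v * (shift_error s v / s)) \<le> norm (2 * grad_mass * (norm v)\<^sup>2)" by simp
  qed
qed simp

text \<open>For each direction the relative remainder tends to 0, and it is at most a multiple of
  \<open>norm v\<close>; the second moment of the Gaussian provides the dominating function.\<close>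

lemma heat_error_tendsto:
  assumes h: "h \<longlonglongrightarrow> 0" "\<And>n::nat. h n > 0"
  shows "(\<lambda>n. heat_error (h n)) \<longlonglongrightarrow> 0"
proof -
  define s where "s n = sqrt (2 * h n)" for n
  have s: "s \<longlonglongrightarrow> 0" "\<And>n. s n > 0"
  proof -
    have "(\<lambda>n. sqrt (2 * h n)) \<longlonglongrightarrow> sqrt (2 * 0)" by (intro tendsto_intros h)
    then show "s \<longlonglongrightarrow> 0" by (simp add: s_def[abs_def])
    show "s n > 0" for n using h(2)[of n] by (simp add: s_def)
  qed
  have "(\<lambda>n. \<integral>v. norm v * (shift_error (s n) v / s n) \<partial>std_gauss) \<longlonglongrightarrow> (\<integral>v. 0 \<partial>(std_gauss :: 'a measure))"
  proof (rule integral_dominated_convergence[where w = "\<lambda>v. 2 * grad_mass * (norm v)\<^sup>2"])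
    show "integrable std_gauss (\<lambda>v::'a. 2 * grad_mass * (norm v)\<^sup>2)" by (intro integrable_mult_right integrable_std_gauss_square)
    show "AE v in std_gauss. (\<lambda>n. norm v * (shift_error (s n) v / s n)) \<longlonglongrightarrow> 0"
    proof (rule AE_I2)
      fix v
      show "(\<lambda>n. norm v * (shift_error (s n) v / s n)) \<longlonglongrightarrow> 0"
        using tendsto_mult[OF tendsto_const[of "norm v"] shift_error_tendsto[OF s]] by simp
    qed
    fix n
    show "AE v in std_gauss. norm (norm v * (shift_error (s n) v / s n)) \<le> 2 * grad_mass * (norm v)\<^sup>2"
    proof (rule AE_I2)
      fix v
      have "shift_error (s n) v / s n \<le> 2 * norm v * grad_mass" using shift_error_le[of "s n" v] s(2)[of n] by (simp add: divide_le_eq mult_ac)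
      then have "norm v * (shift_error (s n) v / s n) \<le> norm v * (2 * norm v * grad_mass)" by (rule mult_left_mono) simp
      also have "\<dots> = 2 * grad_mass * (norm v)\<^sup>2" by (simp add: power2_eq_square)
      finally have *: "norm v * (shift_error (s n) v / s n) \<le> 2 * grad_mass * (norm v)\<^sup>2" .
      have "0 \<le> norm v * (shift_error (s n) v / s n)" using shift_error_nonneg[of "s n" v] s(2)[of n] by simp
      with * show "norm (norm v * (shift_error (s n) v / s n)) \<le> 2 * grad_mass * (norm v)\<^sup>2" by simp
    qed
  qed auto
  then show ?thesis by (simp add: heat_error_def s_def)
qed

text \<open>Summation by parts for translations: shifting the variable in the part with
  \<open>f x - f (x - v)\<close> pairs a first difference of \<open>f\<close> with a first
  difference of \<open>\<rho>\<close>. This is why the Lipschitz constant of \<open>f\<close> is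
  enough in the estimates that follow.\<close>

lemma second_difference_integral:
  assumes f: "C1_bdd B L f G"
  shows "(\<integral>x. f (x + v) + f (x - v) - 2 * f x \<partial>\<mu>) = (\<integral>x. (f (x + v) - f x) * (\<rho> x - \<rho> (x + v)) \<partial>lborel)"
proof -
  note [measurable] = C1_bddD(6)[OF f]
  have bd: "\<bar>f x - f y\<bar> \<le> 2 * B" for x y using C1_bddD(3)[OF f, of x] C1_bddD(3)[OF f, of y] by linarith
  have i: "integrable lborel (\<lambda>x. (f (x + p) - f (x + q)) * \<rho> (x + r))" for p q r
  proof (rule Bochner_Integration.integrable_bound)
    show "integrable lborel (\<lambda>x. 2 * B * \<rho> (x + r))" using integrable_shift by simp
    show "AE x in lborel. norm ((f (x + p) - f (x + q)) * \<rho> (x + r)) \<le> norm (2 * B * \<rho> (x + r))"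
      using order_trans[OF bd abs_ge_self] \<rho>_pos by (intro AE_I2) (auto simp: abs_mult intro!: mult_right_mono)
  qed simp
  have "(\<integral>x. f (x + v) + f (x - v) - 2 * f x \<partial>\<mu>) = (\<integral>x. (f (x + v) - f (x + 0)) * \<rho> (x + 0) - (f (x + 0) - f (x + - v)) * \<rho> (x + 0) \<partial>lborel)"
    by (subst integral_\<mu>) (auto intro!: Bochner_Integration.integral_cong simp: algebra_simps)
  also have "\<dots> = (\<integral>x. (f (x + v) - f (x + 0)) * \<rho> (x + 0) \<partial>lborel) - (\<integral>x. (f (x + 0) - f (x + - v)) * \<rho> (x + 0) \<partial>lborel)"
    by (rule Bochner_Integration.integral_diff[OF i i])
  also have "(\<integral>x. (f (x + 0) - f (x + - v)) * \<rho> (x + 0) \<partial>lborel) = (\<integral>x. (f (x + v) - f (x + 0)) * \<rho> (x + v) \<partial>lborel)"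
    using integral_lborel_shift(1)[of "\<lambda>x. (f x - f (x - v)) * \<rho> x" v] by simp
  also have "(\<integral>x. (f (x + v) - f (x + 0)) * \<rho> (x + 0) \<partial>lborel) - (\<integral>x. (f (x + v) - f (x + 0)) * \<rho> (x + v) \<partial>lborel)
     = (\<integral>x. (f (x + v) - f (x + 0)) * \<rho> (x + 0) - (f (x + v) - f (x + 0)) * \<rho> (x + v) \<partial>lborel)"
    by (rule Bochner_Integration.integral_diff[OF i i, symmetric])
  finally show ?thesis by (simp add: right_diff_distrib)
qed

lemma second_difference_estimate:
  assumes f: "C1_bdd B L f G" and s: "s \<ge> 0"
  shows "\<bar>(\<integral>x. f (x + s *\<^sub>R v) + f (x - s *\<^sub>R v) - 2 * f x \<partial>\<mu>) - (\<integral>x. (f (x + s *\<^sub>R v) - f x) * (s * (DU x \<bullet> v)) \<partial>\<mu>)\<bar>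
    \<le> L * s * norm v * shift_error s v"
proof -
  note [measurable] = C1_bddD(6)[OF f]
  have B: "0 \<le> B" and L: "0 \<le> L" using C1_bddD(3,4)[OF f, of 0] norm_ge_zero[of "G 0"] by linarith+
  have bd: "\<bar>f x - f y\<bar> \<le> 2 * B" for x y using C1_bddD(3)[OF f, of x] C1_bddD(3)[OF f, of y] by linarith
  have mb: "integrable lborel (\<lambda>x. (f (x + s *\<^sub>R v) - f x) * g x)" if g: "integrable lborel g" "g \<in> borel_measurable borel" for g
  proof (rule Bochner_Integration.integrable_bound)
    show "integrable lborel (\<lambda>x. 2 * B * g x)" using g by simp
    show "AE x in lborel. norm ((f (x + s *\<^sub>R v) - f x) * g x) \<le> norm (2 * B * g x)"
      using order_trans[OF bd abs_ge_self] by (intro AE_I2) (auto simp: abs_mult intro!: mult_right_mono)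
  qed (use g(2) in measurable)
  have i1: "integrable lborel (\<lambda>x. \<rho> x - \<rho> (x + s *\<^sub>R v))" using integrable_\<rho> integrable_shift by simp
  have i2: "integrable lborel (\<lambda>x. s * (\<rho> x * (DU x \<bullet> v)))" using integrable_k by simp
  have n1: "(\<lambda>x. \<rho> x - \<rho> (x + s *\<^sub>R v)) \<in> borel_measurable borel" by measurable
  have n2: "(\<lambda>x. s * (\<rho> x * (DU x \<bullet> v))) \<in> borel_measurable borel" by measurable
  have e: "(\<integral>x. (f (x + s *\<^sub>R v) - f x) * (s * (DU x \<bullet> v)) \<partial>\<mu>) = (\<integral>x. (f (x + s *\<^sub>R v) - f x) * (s * (\<rho> x * (DU x \<bullet> v))) \<partial>lborel)"
    by (subst integral_\<mu>) (auto intro!: Bochner_Integration.integral_cong)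
  have eq: "(\<integral>x. f (x + s *\<^sub>R v) + f (x - s *\<^sub>R v) - 2 * f x \<partial>\<mu>) - (\<integral>x. (f (x + s *\<^sub>R v) - f x) * (s * (DU x \<bullet> v)) \<partial>\<mu>)
    = (\<integral>x. (f (x + s *\<^sub>R v) - f x) * (\<rho> x - \<rho> (x + s *\<^sub>R v)) - (f (x + s *\<^sub>R v) - f x) * (s * (\<rho> x * (DU x \<bullet> v))) \<partial>lborel)"
    unfolding second_difference_integral[OF f] e by (rule Bochner_Integration.integral_diff[OF mb[OF i1 n1] mb[OF i2 n2], symmetric])
  have "\<bar>(\<integral>x. f (x + s *\<^sub>R v) + f (x - s *\<^sub>R v) - 2 * f x \<partial>\<mu>) - (\<integral>x. (f (x + s *\<^sub>R v) - f x) * (s * (DU x \<bullet> v)) \<partial>\<mu>)\<bar>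
    \<le> (\<integral>x. \<bar>(f (x + s *\<^sub>R v) - f x) * (\<rho> x - \<rho> (x + s *\<^sub>R v)) - (f (x + s *\<^sub>R v) - f x) * (s * (\<rho> x * (DU x \<bullet> v)))\<bar> \<partial>lborel)"
    unfolding eq by (rule integral_abs_bound)
  also have "\<dots> \<le> (\<integral>x. L * s * norm v * \<bar>\<rho> x - \<rho> (x + s *\<^sub>R v) - s * (\<rho> x * (DU x \<bullet> v))\<bar> \<partial>lborel)"
  proof (rule integral_mono)
    show "integrable lborel (\<lambda>x. \<bar>(f (x + s *\<^sub>R v) - f x) * (\<rho> x - \<rho> (x + s *\<^sub>R v)) - (f (x + s *\<^sub>R v) - f x) * (s * (\<rho> x * (DU x \<bullet> v)))\<bar>)"
      by (intro integrable_abs Bochner_Integration.integrable_diff mb i1 i2 n1 n2)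
    show "integrable lborel (\<lambda>x. L * s * norm v * \<bar>\<rho> x - \<rho> (x + s *\<^sub>R v) - s * (\<rho> x * (DU x \<bullet> v))\<bar>)"
      using integrable_shift_error by (rule integrable_mult_right)
    fix x
    have "\<bar>(f (x + s *\<^sub>R v) - f x) * (\<rho> x - \<rho> (x + s *\<^sub>R v)) - (f (x + s *\<^sub>R v) - f x) * (s * (\<rho> x * (DU x \<bullet> v)))\<bar>
      = \<bar>f (x + s *\<^sub>R v) - f x\<bar> * \<bar>\<rho> x - \<rho> (x + s *\<^sub>R v) - s * (\<rho> x * (DU x \<bullet> v))\<bar>"
      by (simp only: right_diff_distrib[symmetric] abs_mult)
    also have "\<dots> \<le> (L * s * norm v) * \<bar>\<rho> x - \<rho> (x + s *\<^sub>R v) - s * (\<rho> x * (DU x \<bullet> v))\<bar>"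
      using C1_bdd_lipschitz[OF f, of "x + s *\<^sub>R v" x] s by (intro mult_right_mono) (auto simp: mult.assoc)
    finally show "\<bar>(f (x + s *\<^sub>R v) - f x) * (\<rho> x - \<rho> (x + s *\<^sub>R v)) - (f (x + s *\<^sub>R v) - f x) * (s * (\<rho> x * (DU x \<bullet> v)))\<bar>
      \<le> L * s * norm v * \<bar>\<rho> x - \<rho> (x + s *\<^sub>R v) - s * (\<rho> x * (DU x \<bullet> v))\<bar>" .
  qed
  also have "\<dots> = L * s * norm v * shift_error s v" unfolding shift_error_def by (rule integral_mult_right_zero)
  finally show ?thesis .
qed

lemma integrable_norm_DU_product: "integrable ((std_gauss :: 'a measure) \<Otimes>\<^sub>M \<mu>) (\<lambda>p. norm (fst p) * norm (DU (snd p)))"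
proof (rule gauss_\<mu>.Fubini_integrable)
  show "integrable (std_gauss :: 'a measure) (\<lambda>v. \<integral>x. norm (norm (fst (v, x)) * norm (DU (snd (v, x)))) \<partial>\<mu>)"
    using integrable_std_gauss_norm[where 'a = 'a] by (simp add: abs_mult)
  show "AE v in (std_gauss :: 'a measure). integrable \<mu> (\<lambda>x. norm (fst (v, x)) * norm (DU (snd (v, x))))"
    using integrable_\<mu>_DU by simp
qed simp

text \<open>By symmetry of the Gaussian, twice the increment is an average of second differences of
  \<open>f\<close>. Replacing the density difference by its linear part leaves
  \<open>f (x + s *\<^sub>R v) - f x\<close> paired with \<open>s * (DU x \<bullet> v)\<close>, and
  Gaussian integration by parts turns this into \<open>2 * h\<close> times
  \<open>heat h G x \<bullet> DU x\<close>.\<close>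

lemma heat_estimate:
  assumes h: "h > 0" and f: "C1_bdd B L f G"
  shows "\<bar>(\<integral>x. heat h f x - f x \<partial>\<mu>) - h * (\<integral>x. heat h G x \<bullet> DU x \<partial>\<mu>)\<bar> \<le> h * (L * heat_error h)"
proof -
  define s where "s = sqrt (2 * h)"
  have s: "s > 0" "s\<^sup>2 = 2 * h" "s * s = 2 * h" using h by (auto simp: s_def)
  let ?\<Gamma> = "std_gauss :: 'a measure"
  note [measurable] = C1_bddD(6,7)[OF f]
  have B: "0 \<le> B" and L: "0 \<le> L" using C1_bddD(3,4)[OF f, of 0] norm_ge_zero[of "G 0"] by linarith+
  have bd: "\<bar>f x - f y\<bar> \<le> 2 * B" for x y using C1_bddD(3)[OF f, of x] C1_bddD(3)[OF f, of y] by linarith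
  define A where "A v = (\<integral>x. f (x + s *\<^sub>R v) + f (x - s *\<^sub>R v) - 2 * f x \<partial>\<mu>)" for v
  define D where "D v = (\<integral>x. (f (x + s *\<^sub>R v) - f x) * (s * (DU x \<bullet> v)) \<partial>\<mu>)" for v
  have hf: "heat h f x = (\<integral>v. f (x + s *\<^sub>R v) \<partial>?\<Gamma>)" and hG: "heat h G x = (\<integral>v. G (x + s *\<^sub>R v) \<partial>?\<Gamma>)" for x
    unfolding heat_def[OF h] s_def by (rule refl)+
  have if': "integrable ?\<Gamma> (\<lambda>v. f (x + s *\<^sub>R v))" for x
    by (rule std_gauss.integrable_const_bound[where B = B]) (use C1_bddD(3)[OF f] in auto)
  have ifm: "integrable ?\<Gamma> (\<lambda>v. f (x - s *\<^sub>R v))" for x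
    by (rule std_gauss.integrable_const_bound[where B = B]) (use C1_bddD(3)[OF f] in auto)
  have two: "2 * (heat h f x - f x) = (\<integral>v. f (x + s *\<^sub>R v) + f (x - s *\<^sub>R v) - 2 * f x \<partial>?\<Gamma>)" for x
  proof -
    have "heat h f x = (\<integral>v. f (x - s *\<^sub>R v) \<partial>?\<Gamma>)"
      using integral_std_gauss_uminus[of "\<lambda>v. f (x + s *\<^sub>R v)"] by (simp add: hf)
    then show ?thesis using if' ifm by (simp add: hf std_gauss.prob_space[simplified])
  qed
  have i4: "integrable (?\<Gamma> \<Otimes>\<^sub>M \<mu>) (\<lambda>p. f (snd p + s *\<^sub>R fst p) + f (snd p - s *\<^sub>R fst p) - 2 * f (snd p))"
  proof (rule gauss_\<mu>.integrable_const_bound[where B = "4 * B"])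
    show "AE p in ?\<Gamma> \<Otimes>\<^sub>M \<mu>. norm (f (snd p + s *\<^sub>R fst p) + f (snd p - s *\<^sub>R fst p) - 2 * f (snd p)) \<le> 4 * B"
    proof (rule AE_I2)
      fix p
      show "norm (f (snd p + s *\<^sub>R fst p) + f (snd p - s *\<^sub>R fst p) - 2 * f (snd p)) \<le> 4 * B"
        using bd[of "snd p + s *\<^sub>R fst p" "snd p"] bd[of "snd p - s *\<^sub>R fst p" "snd p"] unfolding real_norm_def by linarith
    qed
  qed measurable
  have "2 * (\<integral>x. heat h f x - f x \<partial>\<mu>) = (\<integral>x. (\<integral>v. f (x + s *\<^sub>R v) + f (x - s *\<^sub>R v) - 2 * f x \<partial>?\<Gamma>) \<partial>\<mu>)"
    unfolding two[symmetric] integral_mult_right_zero ..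
  also have "\<dots> = (\<integral>v. A v \<partial>?\<Gamma>)"
    unfolding A_def using gauss_\<mu>.Fubini_integral[of "\<lambda>v x. f (x + s *\<^sub>R v) + f (x - s *\<^sub>R v) - 2 * f x"] i4 by (simp add: split_beta')
  finally have EA: "2 * (\<integral>x. heat h f x - f x \<partial>\<mu>) = (\<integral>v. A v \<partial>?\<Gamma>)" .
  have i5: "integrable (?\<Gamma> \<Otimes>\<^sub>M \<mu>) (\<lambda>p. (f (snd p + s *\<^sub>R fst p) - f (snd p)) * (s * (DU (snd p) \<bullet> fst p)))"
  proof (rule Bochner_Integration.integrable_bound)
    show "integrable (?\<Gamma> \<Otimes>\<^sub>M \<mu>) (\<lambda>p. 2 * B * s * (norm (fst p) * norm (DU (snd p))))"
      using integrable_norm_DU_product by simp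
    show "AE p in ?\<Gamma> \<Otimes>\<^sub>M \<mu>. norm ((f (snd p + s *\<^sub>R fst p) - f (snd p)) * (s * (DU (snd p) \<bullet> fst p))) \<le> norm (2 * B * s * (norm (fst p) * norm (DU (snd p))))"
    proof (rule AE_I2)
      fix p
      have "\<bar>f (snd p + s *\<^sub>R fst p) - f (snd p)\<bar> * (s * \<bar>DU (snd p) \<bullet> fst p\<bar>) \<le> (2 * B) * (s * (norm (DU (snd p)) * norm (fst p)))"
        using bd Cauchy_Schwarz_ineq2 B s(1) by (intro mult_mono) auto
      then show "norm ((f (snd p + s *\<^sub>R fst p) - f (snd p)) * (s * (DU (snd p) \<bullet> fst p))) \<le> norm (2 * B * s * (norm (fst p) * norm (DU (snd p))))"
        using B s(1) by (simp add: abs_mult mult_ac)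
    qed
  qed measurable
  \<comment> \<open>The term with \<open>f x\<close> drops out because the Gaussian is centred. One
    factor \<open>s\<close> is present, the integration by parts brings the other, and
    \<open>s * s = 2 * h\<close>.\<close>
  have inner: "(\<integral>v. (f (x + s *\<^sub>R v) - f x) * (s * (DU x \<bullet> v)) \<partial>?\<Gamma>) = 2 * h * (heat h G x \<bullet> DU x)" for x
  proof -
    have j1: "integrable ?\<Gamma> (\<lambda>v. f (x + s *\<^sub>R v) * (v \<bullet> DU x))"
    proof (rule Bochner_Integration.integrable_bound)
      show "integrable ?\<Gamma> (\<lambda>v. B * norm (DU x) * norm v)" by (intro integrable_mult_right integrable_std_gauss_norm)
      show "AE v in ?\<Gamma>. norm (f (x + s *\<^sub>R v) * (v \<bullet> DU x)) \<le> norm (B * norm (DU x) * norm v)"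
      proof (rule AE_I2)
        fix v
        have "\<bar>f (x + s *\<^sub>R v)\<bar> * \<bar>v \<bullet> DU x\<bar> \<le> B * (norm v * norm (DU x))"
          using C1_bddD(3)[OF f] Cauchy_Schwarz_ineq2 B by (intro mult_mono) auto
        then show "norm (f (x + s *\<^sub>R v) * (v \<bullet> DU x)) \<le> norm (B * norm (DU x) * norm v)"
          using B by (simp add: abs_mult mult_ac)
      qed
    qed simp
    have j2: "integrable ?\<Gamma> (\<lambda>v. v \<bullet> DU x)"
    proof (rule Bochner_Integration.integrable_bound)
      show "integrable ?\<Gamma> (\<lambda>v. norm (DU x) * norm v)" by (intro integrable_mult_right integrable_std_gauss_norm)
      show "AE v in ?\<Gamma>. norm (v \<bullet> DU x) \<le> norm (norm (DU x) * norm v)"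
        using Cauchy_Schwarz_ineq2 by (intro AE_I2) (simp add: mult.commute)
    qed simp
    have "(\<integral>v. (f (x + s *\<^sub>R v) - f x) * (s * (DU x \<bullet> v)) \<partial>?\<Gamma>) = (\<integral>v. s * (f (x + s *\<^sub>R v) * (v \<bullet> DU x)) - s * f x * (v \<bullet> DU x) \<partial>?\<Gamma>)"
      by (intro Bochner_Integration.integral_cong refl) (simp add: inner_commute algebra_simps)
    also have "\<dots> = s * (\<integral>v. f (x + s *\<^sub>R v) * (v \<bullet> DU x) \<partial>?\<Gamma>) - s * f x * (\<integral>v. v \<bullet> DU x \<partial>?\<Gamma>)"
      using j1 j2 by simp
    also have "\<dots> = (s * s) * (heat h G x \<bullet> DU x)"
      unfolding std_gauss_integration_by_parts[OF f] integral_std_gauss_inner hG by simp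
    finally show ?thesis unfolding s(3) .
  qed
  have "(\<integral>v. D v \<partial>?\<Gamma>) = (\<integral>x. (\<integral>v. (f (x + s *\<^sub>R v) - f x) * (s * (DU x \<bullet> v)) \<partial>?\<Gamma>) \<partial>\<mu>)"
    unfolding D_def using gauss_\<mu>.Fubini_integral[of "\<lambda>v x. (f (x + s *\<^sub>R v) - f x) * (s * (DU x \<bullet> v))"] i5 by (simp add: split_beta')
  also have "\<dots> = 2 * h * (\<integral>x. heat h G x \<bullet> DU x \<partial>\<mu>)" unfolding inner by simp
  finally have ED: "(\<integral>v. D v \<partial>?\<Gamma>) = 2 * h * (\<integral>x. heat h G x \<bullet> DU x \<partial>\<mu>)" .
  have iA: "integrable ?\<Gamma> A" and iD: "integrable ?\<Gamma> D"
    unfolding A_def[abs_def] D_def[abs_def]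
    using gauss_\<mu>.integrable_fst'[OF i4] gauss_\<mu>.integrable_fst'[OF i5] by simp_all
  have "\<bar>2 * (\<integral>x. heat h f x - f x \<partial>\<mu>) - 2 * h * (\<integral>x. heat h G x \<bullet> DU x \<partial>\<mu>)\<bar> = \<bar>\<integral>v. A v - D v \<partial>?\<Gamma>\<bar>"
    unfolding EA ED[symmetric] using iA iD by simp
  also have "\<dots> \<le> (\<integral>v. \<bar>A v - D v\<bar> \<partial>?\<Gamma>)" by (rule integral_abs_bound)
  also have "\<dots> \<le> (\<integral>v. L * (2 * h) * (norm v * (shift_error s v / s)) \<partial>?\<Gamma>)"
  proof (rule integral_mono)
    show "integrable ?\<Gamma> (\<lambda>v. \<bar>A v - D v\<bar>)" using iA iD by simp
    show "integrable ?\<Gamma> (\<lambda>v. L * (2 * h) * (norm v * (shift_error s v / s)))"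
      using integrable_heat_error[OF s(1)] by (rule integrable_mult_right)
    fix v
    have "\<bar>A v - D v\<bar> \<le> L * s * norm v * shift_error s v"
      unfolding A_def D_def using s(1) by (intro second_difference_estimate[OF f]) simp
    also have "\<dots> = L * (s * s) * (norm v * (shift_error s v / s))" using s(1) by (simp add: field_simps)
    finally show "\<bar>A v - D v\<bar> \<le> L * (2 * h) * (norm v * (shift_error s v / s))" unfolding s(3) .
  qed
  also have "\<dots> = 2 * (h * (L * heat_error h))" unfolding heat_error_def s_def[symmetric] by simp
  finally have le: "\<bar>2 * (\<integral>x. heat h f x - f x \<partial>\<mu>) - 2 * h * (\<integral>x. heat h G x \<bullet> DU x \<partial>\<mu>)\<bar> \<le> 2 * (h * (L * heat_error h))" .
  have "\<bar>2 * p - 2 * h * q\<bar> = 2 * \<bar>p - h * q\<bar>" for p q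
    using abs_mult[of 2 "p - h * q"] by (simp add: right_diff_distrib)
  with le show ?thesis by (simp only: mult_le_cancel_left_pos[OF zero_less_numeral])
qed

section \<open>Invariance error of the drift part\<close>

text \<open>The second bound tends to 0 with \<open>h\<close> but contains
  \<open>(norm (DU x))\<^sup>2\<close>; the minimum with the first bound, which is integrable, makes
  dominated convergence applicable.\<close>

definition drift_error_density :: "real \<Rightarrow> 'a \<Rightarrow> real" where
  "drift_error_density h x = min (2 * norm (DU x))
     (gauss_moment TYPE('a) / sqrt (2 * h) * h * (norm (DU x))\<^sup>2 + norm (DU x - DU (prox h x)))"

definition drift_error :: "real \<Rightarrow> real" where
  "drift_error h = (\<integral>x. drift_error_density h x \<partial>\<mu>)"

lemma measurable_prox [measurable]: "h > 0 \<Longrightarrow> prox h \<in> borel_measurable borel"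
  by (intro borel_measurable_continuous_onI continuous_prox)

lemma drift_error_density_bounds:
  assumes "h > 0" shows "0 \<le> drift_error_density h x" "drift_error_density h x \<le> 2 * norm (DU x)"
  unfolding drift_error_density_def using assms gauss_moment_nonneg[where 'a = 'a] by auto

lemma measurable_drift_error_density [measurable]:
  assumes [simp]: "h > 0" shows "drift_error_density h \<in> borel_measurable borel"
proof -
  have [measurable]: "prox h \<in> borel_measurable borel" by simp
  show ?thesis unfolding drift_error_density_def[abs_def] by measurable
qed

lemma drift_error_tendsto:
  assumes h: "h \<longlonglongrightarrow> 0" "\<And>n::nat. h n > 0"
  shows "(\<lambda>n. drift_error (h n)) \<longlonglongrightarrow> 0"
proof -
  have "(\<lambda>n. \<integral>x. drift_error_density (h n) x \<partial>\<mu>) \<longlonglongrightarrow> (\<integral>x. 0 \<partial>\<mu>)"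
  proof (rule integral_dominated_convergence[where w = "\<lambda>x. 2 * norm (DU x)"])
    show "integrable \<mu> (\<lambda>x. 2 * norm (DU x))" using integrable_\<mu>_DU by simp
    show "AE x in \<mu>. (\<lambda>n. drift_error_density (h n) x) \<longlonglongrightarrow> 0"
    proof (rule AE_I2)
      fix x
      have 1: "(\<lambda>n. prox (h n) x) \<longlonglongrightarrow> x"
      proof -
        have "(\<lambda>n. h n * norm (DU x)) \<longlonglongrightarrow> 0" using tendsto_mult[OF h(1) tendsto_const[of "norm (DU x)"]] by simp
        then have "(\<lambda>n. prox (h n) x - x) \<longlonglongrightarrow> 0"
          by (rule Lim_null_comparison[OF always_eventually, rotated]) (use prox_displacement[OF h(2)] in auto)
        then show ?thesis by (simp add: LIM_zero_iff)
      qed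
      have 2: "(\<lambda>n. norm (DU x - DU (prox (h n) x))) \<longlonglongrightarrow> norm (DU x - DU x)"
        by (intro tendsto_intros continuous_on_tendsto_compose[OF contDU[of UNIV] 1]) auto
      \<comment> \<open>The loss \<open>1 / sqrt (2 * h)\<close> from the smoothed gradient is
        beaten by the remaining factor \<open>h\<close>.\<close>
      have eq: "gauss_moment TYPE('a) / sqrt (2 * h n) * h n = gauss_moment TYPE('a) * (sqrt (2 * h n) / 2)" for n
      proof -
        have "h n = sqrt (2 * h n) * sqrt (2 * h n) / 2" using h(2)[of n] by simp
        then show ?thesis using h(2)[of n] by (simp add: field_simps)
      qed
      have lim: "(\<lambda>n. gauss_moment TYPE('a) * (sqrt (2 * h n) / 2) * (norm (DU x))\<^sup>2 + norm (DU x - DU (prox (h n) x)))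
        \<longlonglongrightarrow> gauss_moment TYPE('a) * (sqrt (2 * 0) / 2) * (norm (DU x))\<^sup>2 + norm (DU x - DU x)"
        by (intro tendsto_intros h(1) 2) auto
      have 3: "(\<lambda>n. gauss_moment TYPE('a) / sqrt (2 * h n) * h n * (norm (DU x))\<^sup>2 + norm (DU x - DU (prox (h n) x))) \<longlonglongrightarrow> 0"
        unfolding eq using lim by simp
      show "(\<lambda>n. drift_error_density (h n) x) \<longlonglongrightarrow> 0"
      proof (rule tendsto_sandwich[OF always_eventually always_eventually tendsto_const 3])
        show "\<forall>n. 0 \<le> drift_error_density (h n) x"
          using drift_error_density_bounds(1)[OF h(2)] by blast
        show "\<forall>n. drift_error_density (h n) x \<le> gauss_moment TYPE('a) / sqrt (2 * h n) * h n * (norm (DU x))\<^sup>2 + norm (DU x - DU (prox (h n) x))"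
          by (simp add: drift_error_density_def)
      qed
    qed
    show "AE x in \<mu>. norm (drift_error_density (h n) x) \<le> 2 * norm (DU x)" for n
      using drift_error_density_bounds[OF h(2)] by (intro AE_I2) simp
  qed (use h(2) in auto)
  then show ?thesis by (simp add: drift_error_def)
qed

text \<open>The same remainder is bounded twice: by the Lipschitz constant alone, and by Taylor's
  formula for the smoothed function together with \<open>prox_eq\<close>, where the gradient at the
  moved point is compared with \<open>DU x\<close>.\<close>

lemma drift_estimate:
  assumes h: "h > 0" and f: "C1_bdd B L f G"
  shows "\<bar>\<integral>x. heat h f (prox h x) - heat h f x + h * (heat h G x \<bullet> DU x) \<partial>\<mu>\<bar> \<le> h * (L * drift_error h)"
proof -
  define s where "s = sqrt (2 * h)"
  have s: "s > 0" using h by (simp add: s_def)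
  have L: "0 \<le> L" using C1_bddD(4)[OF f, of 0] norm_ge_zero[of "G 0"] by linarith
  note F = C1_bdd_heat[OF h f]
  note [measurable] = C1_bddD(6,7)[OF F]
  have [measurable]: "prox h \<in> borel_measurable borel" using h by simp
  let ?F = "heat h f" and ?H = "heat h G" and ?c = "gauss_moment TYPE('a)"
  have Hlip: "norm (?H x - ?H y) \<le> (L * ?c / s) * norm (x - y)" for x y
    unfolding heat_def[OF h] s_def[symmetric] by (rule smoothed_gradient_lipschitz[OF f s])
  have pt: "\<bar>?F (prox h x) - ?F x + h * (?H x \<bullet> DU x)\<bar> \<le> h * L * drift_error_density h x" for x
  proof -
    have disp: "norm (prox h x - x) \<le> h * norm (DU x)" by (rule prox_displacement[OF h])
    have HDU: "\<bar>?H x \<bullet> w\<bar> \<le> L * norm w" for w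
      using Cauchy_Schwarz_ineq2[of "?H x" w] mult_right_mono[OF C1_bddD(4)[OF F, of x] norm_ge_zero[of w]] by linarith
    have "\<bar>?F (prox h x) - ?F x\<bar> \<le> L * (h * norm (DU x))"
      using C1_bdd_lipschitz[OF F, of "prox h x" x] mult_left_mono[OF disp L] by linarith
    moreover have "\<bar>h * (?H x \<bullet> DU x)\<bar> \<le> h * (L * norm (DU x))"
      using HDU[of "DU x"] h by (simp add: abs_mult)
    ultimately have 1: "\<bar>?F (prox h x) - ?F x + h * (?H x \<bullet> DU x)\<bar> \<le> h * L * (2 * norm (DU x))"
      by (simp add: algebra_simps abs_le_iff)
    have "\<bar>?F (prox h x) - ?F x - ?H x \<bullet> (prox h x - x)\<bar> \<le> (L * ?c / s) * (norm (prox h x - x))\<^sup>2"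
      by (rule C1_bdd_taylor[OF F Hlip])
    also have "\<dots> \<le> (L * ?c / s) * (h * norm (DU x))\<^sup>2"
      using disp L s gauss_moment_nonneg[where 'a = 'a] by (intro mult_left_mono power_mono) auto
    also have "\<dots> = h * L * (?c / s * h * (norm (DU x))\<^sup>2)" by (simp add: power2_eq_square)
    finally have 2: "\<bar>?F (prox h x) - ?F x - ?H x \<bullet> (prox h x - x)\<bar> \<le> h * L * (?c / s * h * (norm (DU x))\<^sup>2)" .
    have eq: "prox h x - x = - (h *\<^sub>R DU (prox h x))" using prox_eq[OF h, of x] by (simp add: algebra_simps)
    have "?H x \<bullet> (prox h x - x) + h * (?H x \<bullet> DU x) = h * (?H x \<bullet> (DU x - DU (prox h x)))"
      unfolding eq by (simp add: inner_diff_right right_diff_distrib)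
    then have 3: "\<bar>?H x \<bullet> (prox h x - x) + h * (?H x \<bullet> DU x)\<bar> \<le> h * L * norm (DU x - DU (prox h x))"
      using HDU[of "DU x - DU (prox h x)"] h by (simp add: abs_mult mult.assoc)
    have "\<bar>?F (prox h x) - ?F x + h * (?H x \<bullet> DU x)\<bar> \<le> h * L * (?c / s * h * (norm (DU x))\<^sup>2 + norm (DU x - DU (prox h x)))"
      using 2 3 unfolding distrib_left by linarith
    with 1 show ?thesis unfolding drift_error_density_def s_def[symmetric] using h L
      by (auto simp: min_def)
  qed
  have id: "integrable \<mu> (drift_error_density h)"
  proof (rule Bochner_Integration.integrable_bound)
    show "integrable \<mu> (\<lambda>x. 2 * norm (DU x))" using integrable_\<mu>_DU by simp
    show "AE x in \<mu>. norm (drift_error_density h x) \<le> norm (2 * norm (DU x))"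
      using drift_error_density_bounds[OF h] by (intro AE_I2) simp
  qed (use h in simp)
  have "\<bar>\<integral>x. ?F (prox h x) - ?F x + h * (?H x \<bullet> DU x) \<partial>\<mu>\<bar> \<le> (\<integral>x. \<bar>?F (prox h x) - ?F x + h * (?H x \<bullet> DU x)\<bar> \<partial>\<mu>)"
    by (rule integral_abs_bound)
  also have "\<dots> \<le> (\<integral>x. h * L * drift_error_density h x \<partial>\<mu>)"
  proof (rule integral_mono')
    show "integrable \<mu> (\<lambda>x. h * L * drift_error_density h x)" using id by simp
  qed (use pt order_trans[OF abs_ge_zero pt] in auto)
  also have "\<dots> = h * (L * drift_error h)" by (simp add: drift_error_def)
  finally show ?thesis .
qed

definition step_error :: "real \<Rightarrow> real" where "step_error h = heat_error h + drift_error h"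

lemma step_error_tendsto:
  assumes "h \<longlonglongrightarrow> 0" "\<And>n::nat. h n > 0"
  shows "(\<lambda>n. step_error (h n)) \<longlonglongrightarrow> 0"
  unfolding step_error_def using tendsto_add[OF heat_error_tendsto[OF assms] drift_error_tendsto[OF assms]] by simp

lemma integrable_\<mu>_bounded:
  fixes f :: "'a \<Rightarrow> 'b::{banach, second_countable_topology}"
  assumes "f \<in> borel_measurable borel" "\<And>x. norm (f x) \<le> B" shows "integrable \<mu> f"
  by (rule \<mu>.integrable_const_bound[where B = B]) (use assms in auto)

text \<open>The first-order parts of drift and heat are \<open>- h\<close> and \<open>+ h\<close>
  times the integral of \<open>heat h G x \<bullet> DU x\<close>. They cancel, which is the
  invariance of \<open>\<mu>\<close> under the generator.\<close>

lemma step_estimate: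
  assumes h: "h > 0" and f: "C1_bdd B L f G"
  shows "\<bar>(\<integral>x. step h f x \<partial>\<mu>) - (\<integral>x. f x \<partial>\<mu>)\<bar> \<le> h * (L * step_error h)"
proof -
  note F = C1_bdd_heat[OF h f]
  note [measurable] = C1_bddD(6,7)[OF F] C1_bddD(6)[OF f]
  have [measurable]: "prox h \<in> borel_measurable borel" using h by simp
  have iF: "integrable \<mu> (heat h f)" and iFS: "integrable \<mu> (\<lambda>x. heat h f (prox h x))" and i: "integrable \<mu> f"
    using C1_bddD(3)[OF F] C1_bddD(3)[OF f] by (auto intro!: integrable_\<mu>_bounded[where B = B])
  have iH: "integrable \<mu> (\<lambda>x. heat h G x \<bullet> DU x)"
  proof (rule Bochner_Integration.integrable_bound)
    show "integrable \<mu> (\<lambda>x. L * norm (DU x))" using integrable_\<mu>_DU by simp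
    show "AE x in \<mu>. norm (heat h G x \<bullet> DU x) \<le> norm (L * norm (DU x))"
    proof (rule AE_I2)
      fix x
      have "\<bar>heat h G x \<bullet> DU x\<bar> \<le> L * norm (DU x)"
        using Cauchy_Schwarz_ineq2[of "heat h G x" "DU x"] mult_right_mono[OF C1_bddD(4)[OF F, of x] norm_ge_zero[of "DU x"]] by linarith
      then show "norm (heat h G x \<bullet> DU x) \<le> norm (L * norm (DU x))" by (simp add: order_trans[OF _ abs_ge_self])
    qed
  qed simp
  have "(\<integral>x. step h f x \<partial>\<mu>) - (\<integral>x. f x \<partial>\<mu>) = (\<integral>x. heat h f (prox h x) - heat h f x + h * (heat h G x \<bullet> DU x) \<partial>\<mu>)
    + ((\<integral>x. heat h f x - f x \<partial>\<mu>) - h * (\<integral>x. heat h G x \<bullet> DU x \<partial>\<mu>))"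
    unfolding step_def[OF h] using iF iFS i iH by simp
  then show ?thesis using drift_estimate[OF h f] heat_estimate[OF h f] unfolding step_error_def distrib_left by linarith
qed

lemma step_error_nonneg: "h > 0 \<Longrightarrow> step_error h \<ge> 0"
  unfolding step_error_def heat_error_def drift_error_def
  using shift_error_nonneg drift_error_density_bounds(1) by (intro add_nonneg_nonneg integral_nonneg_AE AE_I2) auto

text \<open>Telescoping: the step with index \<open>j\<close> acts on a function with Lipschitz
  constant \<open>L / (1 + h * R) ^ j\<close>, so the errors are bounded by a geometric series with
  sum \<open>(1 + h * R) / (h * R)\<close>. The factor \<open>h\<close> of each error cancels the
  \<open>h\<close> in the denominator, and the bound does not depend on \<open>k\<close>.\<close>

lemma step_funpow_estimate:
  assumes h: "h > 0" and f: "C1_bdd B L f G"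
  shows "\<bar>(\<integral>x. (step h ^^ k) f x \<partial>\<mu>) - (\<integral>x. f x \<partial>\<mu>)\<bar> \<le> L * step_error h * (1 + h * R) / R"
proof -
  let ?q = "1 / (1 + h * R)"
  have L: "0 \<le> L" using C1_bddD(4)[OF f, of 0] norm_ge_zero[of "G 0"] by linarith
  have q: "0 < ?q" "?q < 1" using h R by (auto simp: add_pos_pos)
  have each: "\<bar>(\<integral>x. (step h ^^ Suc j) f x \<partial>\<mu>) - (\<integral>x. (step h ^^ j) f x \<partial>\<mu>)\<bar> \<le> h * L * step_error h * ?q ^ j" for j
    using step_estimate[OF h C1_bdd_step_funpow[OF h f, of j]] by (simp add: power_one_over)
  have "\<bar>(\<integral>x. (step h ^^ k) f x \<partial>\<mu>) - (\<integral>x. f x \<partial>\<mu>)\<bar> \<le> (\<Sum>j<k. h * L * step_error h * ?q ^ j)"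
  proof (induction k)
    case (Suc k)
    then show ?case using each[of k] by (simp del: funpow.simps)
  qed simp
  also have "\<dots> = h * L * step_error h * (\<Sum>j<k. ?q ^ j)" by (simp add: sum_distrib_left)
  also have "\<dots> \<le> h * L * step_error h * (1 / (1 - ?q))"
  proof (rule mult_left_mono)
    have "(\<Sum>j<k. p ^ j) \<le> 1 / (1 - p)" if "0 < p" "p < 1" for p :: real
      using that by (simp add: sum_gp_strict divide_right_mono)
    then show "(\<Sum>j<k. ?q ^ j) \<le> 1 / (1 - ?q)" using q by blast
    show "0 \<le> h * L * step_error h" using h L step_error_nonneg[OF h] by simp
  qed
  also have "\<dots> = L * step_error h * (1 + h * R) / R"
  proof -
    have "1 - ?q = h * R / (1 + h * R)" using q by (simp add: field_simps)
    then have e: "1 / (1 - ?q) = (1 + h * R) / (h * R)" by simp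
    have "h * L * step_error h * (X / (h * R)) = L * step_error h * X / R" for X
      using h R by simp
    then show ?thesis unfolding e .
  qed
  finally show ?thesis .
qed

end

section \<open>Letting the step size tend to zero\<close>

locale bellman_log_concave = bellman a b N Nx Ny Nxx Nxy Nyx Nyy S + log_concave U DU HU R
  for a b N Nx Ny Nxx Nxy Nyx Nyy S and U :: "'a::euclidean_space \<Rightarrow> real" and DU HU R
begin

sublocale bellman_potential ..

lemma weight_tendsto: "h \<longlonglongrightarrow> 0 \<Longrightarrow> (\<lambda>n. weight (h n)) \<longlonglongrightarrow> 1 / R"
proof -
  assume h: "h \<longlonglongrightarrow> 0"
  have "(\<lambda>n. (1 + h n * R)\<^sup>2 / (R + h n * R\<^sup>2 / 2)) \<longlonglongrightarrow> (1 + 0 * R)\<^sup>2 / (R + 0 * R\<^sup>2 / 2)"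
    using R by (intro tendsto_intros h) auto
  then show ?thesis by (simp add: weight_def)
qed

lemma weight_le:
  assumes "0 < h" "h \<le> 1" shows "weight h \<le> (1 + R)\<^sup>2 / R"
  unfolding weight_def
proof (rule frac_le)
  have "h * R \<le> R" using assms R by simp
  then show "(1 + h * R)\<^sup>2 \<le> (1 + R)\<^sup>2" using assms R by (intro power_mono) auto
  show "R \<le> R + h * R\<^sup>2 / 2" using assms by simp
qed (use R in auto)

text \<open>The iterates flatten out as \<open>k\<close> grows, since their Lipschitz constants tend
  to 0. Compactness of \<open>{a..b}\<close> gives a subsequence along which their means, and hence
  the iterates at every point, converge to one number \<open>c\<close>; near-invariance keeps
  \<open>c\<close> close to the mean of \<open>f\<close>. The gradient term is discarded by
  monotonicity of \<open>N\<close>.\<close>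

lemma inequality_up_to_error:
  assumes h: "h > 0" and f: "C1_bdd B L f G" and fin: "\<And>x. f x \<in> {a..b}"
    and \<Phi>: "C1_bdd B' L' (\<lambda>x. N (f x, weight h * (norm (G x))\<^sup>2)) G'"
  obtains c where "c \<in> {a..b}" "\<bar>c - (\<integral>x. f x \<partial>\<mu>)\<bar> \<le> L * step_error h * (1 + h * R) / R"
    "(\<integral>x. N (f x, weight h * (norm (G x))\<^sup>2) \<partial>\<mu>) \<le> N (c, 0) + L' * step_error h * (1 + h * R) / R"
proof -
  let ?\<Phi> = "\<lambda>x. N (f x, weight h * (norm (G x))\<^sup>2)"
  define fk where "fk k = (step h ^^ k) f" for k
  define q where "q = 1 / (1 + h * R)"
  have q: "0 < q" "q < 1" using h R by (auto simp: q_def add_pos_pos)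
  note Ck = C1_bdd_step_funpow[OF h f, folded fk_def]
  have fkin: "fk k x \<in> {a..b}" for k x unfolding fk_def by (rule step_funpow_in_interval[OF h f fin])
  have fkm[measurable]: "fk k \<in> borel_measurable borel" for k by (rule C1_bddD(6)[OF Ck])
  define c where "c k = (\<integral>x. fk k x \<partial>\<mu>)" for k
  have cin: "c k \<in> {a..b}" for k unfolding c_def by (rule integral_in_interval[OF prob_space_\<mu>]) (use fkin in auto)
  have osc: "(\<lambda>k. fk k x - fk k 0) \<longlonglongrightarrow> 0" for x
  proof (rule Lim_null_comparison[OF always_eventually])
    show "\<forall>k. norm (fk k x - fk k 0) \<le> L * norm x * q ^ k"
      using C1_bdd_lipschitz[OF Ck, of _ x 0] by (auto simp: q_def power_one_over mult_ac)
    show "(\<lambda>k. L * norm x * q ^ k) \<longlonglongrightarrow> 0"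
      using tendsto_mult[OF tendsto_const[of "L * norm x"] LIMSEQ_realpow_zero[of q]] q by simp
  qed
  have ifk: "integrable \<mu> (fk k)" for k
    by (rule integrable_\<mu>_bounded[where B = B]) (use C1_bddD(3)[OF Ck] in auto)
  have "(\<lambda>k. \<integral>x. fk k x - fk k 0 \<partial>\<mu>) \<longlonglongrightarrow> (\<integral>x. 0 \<partial>\<mu>)"
  proof (rule integral_dominated_convergence[where w = "\<lambda>_. 2 * B"])
    show "AE x in \<mu>. norm (fk k x - fk k 0) \<le> 2 * B" for k
    proof (rule AE_I2)
      fix x show "norm (fk k x - fk k 0) \<le> 2 * B"
        using C1_bddD(3)[OF Ck, of k x] C1_bddD(3)[OF Ck, of k 0] unfolding real_norm_def by linarith
    qed
  qed (use osc in auto)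
  then have c0: "(\<lambda>k. c k - fk k 0) \<longlonglongrightarrow> 0" using ifk by (simp add: c_def \<mu>.prob_space[simplified])
  have close: "(\<lambda>k. fk k x - c k) \<longlonglongrightarrow> 0" for x
    using tendsto_diff[OF osc[of x] c0] by simp
  obtain l r where l: "l \<in> {a..b}" "strict_mono (r :: nat \<Rightarrow> nat)" "(c \<circ> r) \<longlonglongrightarrow> l"
    using compact_Icc[of a b, unfolded compact_def, rule_format, of c] cin by auto
  have flim: "(\<lambda>k. fk (r k) x) \<longlonglongrightarrow> l" for x
    using tendsto_add[OF LIMSEQ_subseq_LIMSEQ[OF close[of x] l(2)] l(3)] by (simp add: o_def)
  obtain BN where BN: "\<And>p. p \<in> {a..b} \<times> {0..0} \<Longrightarrow> \<bar>N p\<bar> \<le> BN" using N_bounded by blast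
  have cN0: "continuous_on UNIV (\<lambda>x. N (fk k x, 0))" for k
    by (intro continuous_on_N_compose C1_bddD(5)[OF Ck] continuous_on_const fkin) auto
  have Nm[measurable]: "(\<lambda>x. N (fk k x, 0)) \<in> borel_measurable borel" for k
    using cN0 by (rule borel_measurable_continuous_onI)
  have Nlim: "(\<lambda>k. \<integral>x. N (fk (r k) x, 0) \<partial>\<mu>) \<longlonglongrightarrow> (\<integral>x. N (l, 0) \<partial>\<mu>)"
  proof (rule integral_dominated_convergence[where w = "\<lambda>_. BN"])
    show "AE x in \<mu>. (\<lambda>k. N (fk (r k) x, 0)) \<longlonglongrightarrow> N (l, 0)"
      by (intro AE_I2 continuous_on_tendsto_compose[OF cont_N] tendsto_intros flim) (use l fkin in \<open>auto simp: S_def\<close>)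
    show "AE x in \<mu>. norm (N (fk (r k) x, 0)) \<le> BN" for k
      using BN fkin by (intro AE_I2) simp
  qed auto
  have le: "(\<integral>x. ?\<Phi> x \<partial>\<mu>) \<le> (\<integral>x. N (fk k x, 0) \<partial>\<mu>) + L' * step_error h * (1 + h * R) / R" for k
  proof -
    note C\<Phi> = C1_bdd_step_funpow[OF h \<Phi>, of k]
    have "(\<integral>x. (step h ^^ k) ?\<Phi> x \<partial>\<mu>) \<le> (\<integral>x. N (fk k x, 0) \<partial>\<mu>)"
    proof (rule integral_mono)
      show "integrable \<mu> ((step h ^^ k) ?\<Phi>)"
        by (rule integrable_\<mu>_bounded[where B = B']) (use C1_bddD(3,6)[OF C\<Phi>] in auto)
      show "integrable \<mu> (\<lambda>x. N (fk k x, 0))"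
        by (rule integrable_\<mu>_bounded[where B = BN]) (use BN fkin in auto)
      fix x
      have "(step h ^^ k) ?\<Phi> x \<le> N (fk k x, weight h * (norm ((step_grad h ^^ k) G x))\<^sup>2)"
        unfolding fk_def by (rule step_funpow_inequality[OF h f fin \<Phi>])
      also have "\<dots> \<le> N (fk k x, 0)" by (rule N_antimono[OF fkin]) (use weight_eq(2)[OF h] in auto)
      finally show "(step h ^^ k) ?\<Phi> x \<le> N (fk k x, 0)" .
    qed
    then show ?thesis using step_funpow_estimate[OF h \<Phi>, of k] by linarith
  qed
  show ?thesis
  proof (rule that[OF l(1)])
    have "(\<lambda>k. \<bar>c (r k) - (\<integral>x. f x \<partial>\<mu>)\<bar>) \<longlonglongrightarrow> \<bar>l - (\<integral>x. f x \<partial>\<mu>)\<bar>"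
      using l(3) by (intro tendsto_intros) (simp add: o_def)
    then show "\<bar>l - (\<integral>x. f x \<partial>\<mu>)\<bar> \<le> L * step_error h * (1 + h * R) / R"
      by (rule tendsto_upperbound) (auto simp: c_def fk_def intro!: always_eventually step_funpow_estimate[OF h f])
    have "(\<lambda>k. (\<integral>x. N (fk (r k) x, 0) \<partial>\<mu>) + L' * step_error h * (1 + h * R) / R) \<longlonglongrightarrow> N (l, 0) + L' * step_error h * (1 + h * R) / R"
      using Nlim by (intro tendsto_add tendsto_const) (simp add: \<mu>.prob_space[simplified])
    then show "(\<integral>x. ?\<Phi> x \<partial>\<mu>) \<le> N (l, 0) + L' * step_error h * (1 + h * R) / R"
      by (rule tendsto_lowerbound) (auto intro!: always_eventually le)
  qed
qed

text \<open>The limit \<open>h \<rightarrow> 0\<close>. The Lipschitz constant \<open>L'\<close>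
  must not depend on \<open>h\<close>, hence the assumption on an interval of weights that contains
  every \<open>weight h\<close> with \<open>h \<le> 1\<close>.\<close>

lemma inequality_uniformly_C1:
  assumes f: "C1_bdd B L f G" and fin: "\<And>x. f x \<in> {a..b}"
    and \<Phi>: "\<And>s. 0 \<le> s \<Longrightarrow> s \<le> (1 + R)\<^sup>2 / R \<Longrightarrow> \<exists>G'. C1_bdd B' L' (\<lambda>x. N (f x, s * (norm (G x))\<^sup>2)) G'"
  shows "(\<integral>x. N (f x, (norm (G x))\<^sup>2 / R) \<partial>\<mu>) \<le> N (\<integral>x. f x \<partial>\<mu>, 0)"
proof -
  define h where "h n = inverse (real (Suc n))" for n
  have h: "h \<longlonglongrightarrow> 0" "\<And>n. h n > 0" "\<And>n. h n \<le> 1"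
    unfolding h_def by (rule LIMSEQ_inverse_real_of_nat) (auto simp: field_simps)
  define e where "e n = step_error (h n) * (1 + h n * R) / R" for n
  have e: "e \<longlonglongrightarrow> 0"
  proof -
    have "(\<lambda>n. step_error (h n) * (1 + h n * R) / R) \<longlonglongrightarrow> 0 * (1 + 0 * R) / R"
      using R by (intro tendsto_intros step_error_tendsto h) auto
    then show ?thesis by (simp add: e_def[abs_def])
  qed
  have wr: "0 \<le> weight (h n)" "weight (h n) \<le> (1 + R)\<^sup>2 / R" for n
    using weight_eq(2)[OF h(2)] weight_le[OF h(2,3)] by auto
  have "\<exists>c. c \<in> {a..b} \<and> \<bar>c - (\<integral>x. f x \<partial>\<mu>)\<bar> \<le> L * e n \<and>
    (\<integral>x. N (f x, weight (h n) * (norm (G x))\<^sup>2) \<partial>\<mu>) \<le> N (c, 0) + L' * e n" for n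
  proof -
    obtain G' where "C1_bdd B' L' (\<lambda>x. N (f x, weight (h n) * (norm (G x))\<^sup>2)) G'" using \<Phi> wr by blast
    from inequality_up_to_error[OF h(2) f fin this] show ?thesis
      by (auto simp: e_def mult.assoc)
  qed
  then have "\<exists>c. \<forall>n. c n \<in> {a..b} \<and> \<bar>c n - (\<integral>x. f x \<partial>\<mu>)\<bar> \<le> L * e n \<and>
    (\<integral>x. N (f x, weight (h n) * (norm (G x))\<^sup>2) \<partial>\<mu>) \<le> N (c n, 0) + L' * e n"
    by (intro choice allI)
  then obtain c where c: "\<And>n. c n \<in> {a..b}" "\<And>n. \<bar>c n - (\<integral>x. f x \<partial>\<mu>)\<bar> \<le> L * e n"
    "\<And>n. (\<integral>x. N (f x, weight (h n) * (norm (G x))\<^sup>2) \<partial>\<mu>) \<le> N (c n, 0) + L' * e n" by blast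
  have [measurable]: "f \<in> borel_measurable borel" by (rule C1_bddD(6)[OF f])
  have fin': "(\<integral>x. f x \<partial>\<mu>) \<in> {a..b}" by (rule integral_in_interval[OF prob_space_\<mu>]) (use fin in auto)
  have "(\<lambda>n. c n - (\<integral>x. f x \<partial>\<mu>)) \<longlonglongrightarrow> 0"
  proof (rule Lim_null_comparison[OF always_eventually])
    show "\<forall>n. norm (c n - (\<integral>x. f x \<partial>\<mu>)) \<le> L * e n" using c(2) by simp
    show "(\<lambda>n. L * e n) \<longlonglongrightarrow> 0" using tendsto_mult[OF tendsto_const[of L] e] by simp
  qed
  then have clim: "c \<longlonglongrightarrow> (\<integral>x. f x \<partial>\<mu>)" by (simp add: LIM_zero_iff)
  have Nc: "(\<lambda>n. N (c n, 0)) \<longlonglongrightarrow> N (\<integral>x. f x \<partial>\<mu>, 0)"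
    by (intro continuous_on_tendsto_compose[OF cont_N] tendsto_intros clim) (use c(1) fin' in \<open>auto simp: S_def\<close>)
  have rhs: "(\<lambda>n. N (c n, 0) + L' * e n) \<longlonglongrightarrow> N (\<integral>x. f x \<partial>\<mu>, 0)"
    using tendsto_add[OF Nc tendsto_mult[OF tendsto_const[of L'] e]] by simp
  have lhs: "(\<lambda>n. \<integral>x. N (f x, weight (h n) * (norm (G x))\<^sup>2) \<partial>\<mu>) \<longlonglongrightarrow> (\<integral>x. N (f x, (norm (G x))\<^sup>2 / R) \<partial>\<mu>)"
  proof (rule integral_dominated_convergence[where w = "\<lambda>_. B'"])
    have cont: "continuous_on UNIV (\<lambda>x. N (f x, s * (norm (G x))\<^sup>2))" if "s \<ge> 0" for s
      by (intro continuous_on_N_compose continuous_intros C1_bddD(2,5)[OF f] fin) (use that in auto)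
    show "(\<lambda>x. N (f x, (norm (G x))\<^sup>2 / R)) \<in> borel_measurable \<mu>"
      using borel_measurable_continuous_onI[OF cont[of "1 / R"]] R by simp
    show "(\<lambda>x. N (f x, weight (h n) * (norm (G x))\<^sup>2)) \<in> borel_measurable \<mu>" for n
      using borel_measurable_continuous_onI[OF cont[OF wr(1)]] by simp
    show "AE x in \<mu>. norm (N (f x, weight (h n) * (norm (G x))\<^sup>2)) \<le> B'" for n
    proof -
      obtain G' where "C1_bdd B' L' (\<lambda>x. N (f x, weight (h n) * (norm (G x))\<^sup>2)) G'" using \<Phi> wr by blast
      then show ?thesis using C1_bddD(3) by (intro AE_I2) force
    qed
    show "AE x in \<mu>. (\<lambda>n. N (f x, weight (h n) * (norm (G x))\<^sup>2)) \<longlonglongrightarrow> N (f x, (norm (G x))\<^sup>2 / R)"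
    proof (rule AE_I2)
      fix x
      have "(\<lambda>n. weight (h n) * (norm (G x))\<^sup>2) \<longlonglongrightarrow> 1 / R * (norm (G x))\<^sup>2"
        by (intro tendsto_intros weight_tendsto h(1))
      then have "(\<lambda>n. (f x, weight (h n) * (norm (G x))\<^sup>2)) \<longlonglongrightarrow> (f x, (norm (G x))\<^sup>2 / R)"
        by (intro tendsto_intros) simp
      then show "(\<lambda>n. N (f x, weight (h n) * (norm (G x))\<^sup>2)) \<longlonglongrightarrow> N (f x, (norm (G x))\<^sup>2 / R)"
        by (rule continuous_on_tendsto_compose[OF cont_N]) (use fin wr R in \<open>auto simp: S_def\<close>)
    qed
  qed simp
  show ?thesis by (rule LIMSEQ_le[OF lhs rhs]) (use c(3) in auto)
qed

text \<open>When \<open>G\<close> vanishes outside a ball, compactness bounds the gradient of the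
  left-hand function, uniformly for weights in a compact interval.\<close>

lemma inequality_constant_at_infinity:
  fixes g :: "'a \<Rightarrow> real" and G :: "'a \<Rightarrow> 'a" and HG :: "'a \<Rightarrow> 'a \<Rightarrow> 'a"
  assumes g: "\<And>x. (g has_derivative (\<lambda>h. G x \<bullet> h)) (at x)"
    and G: "\<And>x. (G has_derivative HG x) (at x)" and HG: "\<And>v. continuous_on UNIV (\<lambda>x. HG x v)"
    and outside: "\<And>x. norm x > r \<Longrightarrow> G x = 0" and gin: "\<And>x. g x \<in> {a..b}"
  shows "(\<integral>x. N (g x, (norm (G x))\<^sup>2 / R) \<partial>\<mu>) \<le> N (\<integral>x. g x \<partial>\<mu>, 0)"
proof -
  define s0 where "s0 = (1 + R)\<^sup>2 / R"
  have cG: "continuous_on A G" and cg: "continuous_on A g" for A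
    using g G by (meson continuous_at_imp_continuous_on has_derivative_continuous)+
  have cHG: "continuous_on A (\<lambda>x. HG x v)" for A v using HG by (rule continuous_on_subset) simp
  have bnd: "\<exists>L. \<forall>p\<in>C. norm (\<phi> p) \<le> L" if "continuous_on C \<phi>" "compact C" for \<phi> :: "'x::euclidean_space \<Rightarrow> 'a" and C
    using compact_imp_bounded[OF compact_continuous_image[OF that]] unfolding bounded_iff by blast
  obtain L0 where L0: "\<And>x. x \<in> cball 0 r \<Longrightarrow> norm (G x) \<le> L0" using bnd[OF cG compact_cball] by blast
  define L where "L = max L0 0"
  have L: "norm (G x) \<le> L" for x
    using L0[of x] outside[of x] by (cases "norm x > r") (auto simp: L_def dist_norm)
  have f: "C1_bdd (\<bar>a\<bar> + \<bar>b\<bar>) L g G"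
    unfolding C1_bdd_def using g cG L abs_le_interval[OF gin] by blast
  define P where "P s x = (g x, s * (norm (G x))\<^sup>2)" for s x
  \<comment> \<open>The chain rule. The sum over \<open>Basis\<close> is the transpose of
    \<open>HG x\<close> applied to \<open>G x\<close>, half the gradient of the squared norm of
    \<open>G\<close>.\<close>
  define grad\<Phi> where "grad\<Phi> s x = Nx (P s x) *\<^sub>R G x + (2 * s * Ny (P s x)) *\<^sub>R (\<Sum>v\<in>Basis. (G x \<bullet> HG x v) *\<^sub>R v)" for s x
  have Pin: "P s x \<in> S" if "s \<ge> 0" for s x using gin that by (auto simp: P_def S_def)
  have cgrad: "continuous_on ({0..s0} \<times> UNIV) (\<lambda>p. grad\<Phi> (fst p) (snd p))"
  proof -
    have cP: "continuous_on ({0..s0} \<times> UNIV) (\<lambda>p. P (fst p) (snd p))" unfolding P_def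
      by (intro continuous_intros continuous_on_compose2[OF cg[of UNIV]] continuous_on_compose2[OF cG[of UNIV]]) auto
    show ?thesis unfolding grad\<Phi>_def
      by (intro continuous_intros continuous_on_compose2[OF cont_Nx cP] continuous_on_compose2[OF cont_Ny cP]
          continuous_on_compose2[OF cG[of UNIV]] continuous_on_compose2[OF cHG[of UNIV]]) (auto intro: Pin)
  qed
  have "continuous_on ({0..s0} \<times> cball 0 r) (\<lambda>p. grad\<Phi> (fst p) (snd p))"
    using cgrad by (rule continuous_on_subset) auto
  from bnd[OF this compact_Times[OF compact_Icc compact_cball]]
  obtain L1 where L1: "\<And>s x. s \<in> {0..s0} \<Longrightarrow> x \<in> cball 0 r \<Longrightarrow> norm (grad\<Phi> s x) \<le> L1" by force
  define L' where "L' = max L1 0"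
  have L': "norm (grad\<Phi> s x) \<le> L'" if "s \<in> {0..s0}" for s x
  proof (cases "norm x > r")
    case True
    then show ?thesis using outside by (simp add: grad\<Phi>_def L'_def)
  qed (use L1[OF that, of x] in \<open>auto simp: L'_def\<close>)
  obtain B' where B': "\<And>p. p \<in> {a..b} \<times> {0..s0 * L\<^sup>2} \<Longrightarrow> \<bar>N p\<bar> \<le> B'" using N_bounded by blast
  have \<Phi>: "C1_bdd B' L' (\<lambda>x. N (g x, s * (norm (G x))\<^sup>2)) (grad\<Phi> s)" if s: "0 \<le> s" "s \<le> s0" for s
    unfolding C1_bdd_def
  proof (intro conjI allI)
    fix x
    interpret H: bounded_linear "HG x" by (rule has_derivative_bounded_linear[OF G])
    have dP: "(P s has_derivative (\<lambda>h. (G x \<bullet> h, s * (2 * (G x \<bullet> HG x h))))) (at x)"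
      unfolding P_def power2_norm_eq_inner
      by (auto intro!: derivative_eq_intros g G simp: inner_commute)
    have "(N has_derivative (\<lambda>v. fst v * Nx (P s x) + snd v * Ny (P s x))) (at (P s x) within range (P s))"
      by (rule has_derivative_subset[OF dN]) (use Pin[OF s(1)] in auto)
    from has_derivative_in_compose[OF dP this]
    have "((\<lambda>x. N (P s x)) has_derivative (\<lambda>h. (G x \<bullet> h) * Nx (P s x) + s * (2 * (G x \<bullet> HG x h)) * Ny (P s x))) (at x)"
      by simp
    moreover have "(G x \<bullet> h) * Nx (P s x) + s * (2 * (G x \<bullet> HG x h)) * Ny (P s x) = grad\<Phi> s x \<bullet> h" for h
    proof -
      have "G x \<bullet> HG x h = G x \<bullet> HG x (\<Sum>v\<in>Basis. (h \<bullet> v) *\<^sub>R v)" by (simp add: euclidean_representation)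
      also have "\<dots> = (\<Sum>v\<in>Basis. (G x \<bullet> HG x v) *\<^sub>R v) \<bullet> h"
        by (simp add: H.sum H.scaleR inner_sum_left inner_sum_right inner_commute mult.commute)
      finally show ?thesis by (simp add: grad\<Phi>_def inner_add_left mult_ac)
    qed
    ultimately show "((\<lambda>x. N (g x, s * (norm (G x))\<^sup>2)) has_derivative (\<lambda>h. grad\<Phi> s x \<bullet> h)) (at x)"
      by (simp add: P_def)
    have "s * (norm (G x))\<^sup>2 \<le> s0 * L\<^sup>2" using s L by (intro mult_mono power_mono) auto
    then show "\<bar>N (g x, s * (norm (G x))\<^sup>2)\<bar> \<le> B'" using gin s by (intro B') auto
    show "norm (grad\<Phi> s x) \<le> L'" using L' s by simp
  next
    have "continuous_on UNIV (\<lambda>x. grad\<Phi> (fst (s, x)) (snd (s, x)))"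
      by (rule continuous_on_compose2[OF cgrad]) (use s in \<open>auto intro!: continuous_intros\<close>)
    then show "continuous_on UNIV (grad\<Phi> s)" by simp
  qed
  show ?thesis by (rule inequality_uniformly_C1[OF f gin]) (use \<Phi> in \<open>auto simp: s0_def\<close>)
qed

end

section \<open>Truncation of the measure\<close>

lemma has_real_derivative_max0_power:
  assumes "n \<ge> 2"
  shows "((\<lambda>t::real. max 0 t ^ n) has_real_derivative real n * max 0 t ^ (n - 1)) (at t)"
proof (cases t "0::real" rule: linorder_cases)
  case less
  have "((\<lambda>t::real. 0) has_real_derivative 0) (at t)" by simp
  then have "((\<lambda>t::real. max 0 t ^ n) has_real_derivative 0) (at t)"
    by (rule has_field_derivative_transform_within_open[where S = "{..<0}"]) (use less assms in auto)
  then show ?thesis using less assms by (simp add: max.absorb1 zero_power)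
next
  case greater
  have "((\<lambda>t::real. t ^ n) has_real_derivative real n * t ^ (n - 1)) (at t)"
    using DERIV_pow[of n t] by simp
  then have "((\<lambda>t::real. max 0 t ^ n) has_real_derivative real n * t ^ (n - 1)) (at t)"
    by (rule has_field_derivative_transform_within_open[where S = "{0<..}"]) (use greater in auto)
  then show ?thesis using greater by (simp add: max_def)
next
  case equal
  obtain m where n: "n = Suc (Suc m)" using assms by (metis Suc_le_D numeral_2_eq_2 Suc_le_mono)
  have "(\<lambda>h::real. max 0 h ^ n / h) \<midarrow>0\<rightarrow> 0"
  proof (rule Lim_null_comparison)
    have "norm (max 0 h ^ n / h) \<le> \<bar>h\<bar> ^ Suc m" for h :: real
    proof (cases "h \<le> 0")
      case True
      then have "norm (max 0 h ^ n / h) = 0" by (simp add: n max.absorb1)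
      also have "0 \<le> \<bar>h\<bar> ^ Suc m" by (rule zero_le_power) simp
      finally show ?thesis .
    qed (simp add: n max.absorb2)
    then show "\<forall>\<^sub>F h::real in at 0. norm (max 0 h ^ n / h) \<le> \<bar>h\<bar> ^ Suc m"
      by (intro always_eventually allI)
    have "((\<lambda>h::real. \<bar>h\<bar> ^ Suc m) \<longlongrightarrow> \<bar>0\<bar> ^ Suc m) (at 0)" by (intro tendsto_intros)
    then show "((\<lambda>h::real. \<bar>h\<bar> ^ Suc m) \<longlongrightarrow> 0) (at 0)" by simp
  qed
  then show ?thesis using equal by (simp add: DERIV_def n)
qed

section \<open>Penalties and cutoffs of class C^2\<close>

definition C2_fun :: "('a::euclidean_space \<Rightarrow> real) \<Rightarrow> ('a \<Rightarrow> 'a) \<Rightarrow> ('a \<Rightarrow> 'a \<Rightarrow> 'a) \<Rightarrow> bool" where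
  "C2_fun f G H \<longleftrightarrow> (\<forall>x. (f has_derivative (\<lambda>h. G x \<bullet> h)) (at x)) \<and> (\<forall>x. (G has_derivative H x) (at x)) \<and>
     (\<forall>v. continuous_on UNIV (\<lambda>x. H x v))"

lemma C2_funD:
  assumes "C2_fun f G H"
  shows "(f has_derivative (\<lambda>h. G x \<bullet> h)) (at x)" "(G has_derivative H x) (at x)" "continuous_on A (\<lambda>x. H x v)"
    "continuous_on A f" "continuous_on A G"
proof -
  show 1: "(f has_derivative (\<lambda>h. G x \<bullet> h)) (at x)" and 2: "(G has_derivative H x) (at x)" for x
    using assms by (auto simp: C2_fun_def)
  have "continuous_on UNIV (\<lambda>x. H x v)" using assms by (auto simp: C2_fun_def)
  then show "continuous_on A (\<lambda>x. H x v)" by (rule continuous_on_subset) simp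
  show "continuous_on A f" "continuous_on A G"
    using 1 2 by (meson continuous_at_imp_continuous_on has_derivative_continuous)+
qed

lemma C2_fun_affine:
  assumes "C2_fun f G H"
  shows "C2_fun (\<lambda>x. c + d * f x) (\<lambda>x. d *\<^sub>R G x) (\<lambda>x v. d *\<^sub>R H x v)"
  unfolding C2_fun_def using C2_funD[OF assms]
  by (auto intro!: derivative_eq_intros continuous_intros)

lemma C2_fun_add:
  assumes "C2_fun f G H" "C2_fun f' G' H'"
  shows "C2_fun (\<lambda>x. f x + f' x) (\<lambda>x. G x + G' x) (\<lambda>x v. H x v + H' x v)"
  unfolding C2_fun_def using C2_funD[OF assms(1)] C2_funD[OF assms(2)]
  by (auto intro!: derivative_eq_intros continuous_intros simp: inner_add_left)

lemma C2_fun_mult: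
  assumes "C2_fun f G H" "C2_fun f' G' H'"
  shows "C2_fun (\<lambda>x. f x * f' x) (\<lambda>x. f x *\<^sub>R G' x + f' x *\<^sub>R G x)
    (\<lambda>x v. (f x *\<^sub>R H' x v + (G x \<bullet> v) *\<^sub>R G' x) + (f' x *\<^sub>R H x v + (G' x \<bullet> v) *\<^sub>R G x))"
  unfolding C2_fun_def
proof (intro conjI allI)
  fix x v
  show "((\<lambda>x. f x * f' x) has_derivative (\<lambda>h. (f x *\<^sub>R G' x + f' x *\<^sub>R G x) \<bullet> h)) (at x)"
    using has_derivative_mult[OF C2_funD(1)[OF assms(1)] C2_funD(1)[OF assms(2)]]
    by (simp add: inner_add_left mult.commute)
  show "((\<lambda>x. f x *\<^sub>R G' x + f' x *\<^sub>R G x) has_derivative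
      (\<lambda>v. (f x *\<^sub>R H' x v + (G x \<bullet> v) *\<^sub>R G' x) + (f' x *\<^sub>R H x v + (G' x \<bullet> v) *\<^sub>R G x))) (at x)"
    by (intro has_derivative_add has_derivative_scaleR C2_funD[OF assms(1)] C2_funD[OF assms(2)])
  show "continuous_on UNIV (\<lambda>x. (f x *\<^sub>R H' x v + (G x \<bullet> v) *\<^sub>R G' x) + (f' x *\<^sub>R H x v + (G' x \<bullet> v) *\<^sub>R G x))"
    by (intro continuous_intros C2_funD[OF assms(1)] C2_funD[OF assms(2)])
qed

text \<open>The cube is the lowest integer power of the positive part with a continuous second
  derivative. Both the penalty and the cutoff are built from it.\<close>

lemma C2_fun_cube_pos:
  assumes "C2_fun f G H"
  shows "C2_fun (\<lambda>x. max 0 (f x) ^ 3) (\<lambda>x. (3 * max 0 (f x) ^ 2) *\<^sub>R G x)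
    (\<lambda>x v. (3 * max 0 (f x) ^ 2) *\<^sub>R H x v + (6 * max 0 (f x) * (G x \<bullet> v)) *\<^sub>R G x)"
  unfolding C2_fun_def
proof (intro conjI allI)
  fix x v
  have d3: "((\<lambda>t::real. max 0 t ^ 3) has_derivative (\<lambda>h. h * (3 * max 0 (f x) ^ 2))) (at (f x))"
    using has_real_derivative_max0_power[of 3 "f x"] by (simp add: has_field_derivative_def mult_commute_abs)
  have d2: "((\<lambda>t::real. max 0 t ^ 2) has_derivative (\<lambda>h. h * (2 * max 0 (f x)))) (at (f x))"
    using has_real_derivative_max0_power[of 2 "f x"] by (simp add: has_field_derivative_def mult_commute_abs)
  show "((\<lambda>x. max 0 (f x) ^ 3) has_derivative (\<lambda>h. ((3 * max 0 (f x) ^ 2) *\<^sub>R G x) \<bullet> h)) (at x)"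
    using has_derivative_compose[OF C2_funD(1)[OF assms] d3] by (simp add: mult_ac)
  have "((\<lambda>x. 3 * max 0 (f x) ^ 2) has_derivative (\<lambda>v. 3 * ((G x \<bullet> v) * (2 * max 0 (f x))))) (at x)"
    by (intro has_derivative_mult_right has_derivative_compose[OF C2_funD(1)[OF assms] d2])
  from has_derivative_scaleR[OF this C2_funD(2)[OF assms]]
  show "((\<lambda>x. (3 * max 0 (f x) ^ 2) *\<^sub>R G x) has_derivative
     (\<lambda>v. (3 * max 0 (f x) ^ 2) *\<^sub>R H x v + (6 * max 0 (f x) * (G x \<bullet> v)) *\<^sub>R G x)) (at x)"
    by (simp add: mult_ac)
  show "continuous_on UNIV (\<lambda>x. (3 * max 0 (f x) ^ 2) *\<^sub>R H x v + (6 * max 0 (f x) * (G x \<bullet> v)) *\<^sub>R G x)"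
    by (intro continuous_intros C2_funD[OF assms])
qed

lemma C2_fun_norm_square: "C2_fun (\<lambda>x. x \<bullet> x) (\<lambda>x. 2 *\<^sub>R x) (\<lambda>x v. 2 *\<^sub>R v)"
  unfolding C2_fun_def by (auto intro!: derivative_eq_intros simp: inner_commute)

text \<open>The factor \<open>1 *\<close> and the order of the summands reproduce an instance of
  \<open>C2_fun_affine\<close>, so that the definition can be folded there.\<close>

definition penalty :: "real \<Rightarrow> 'a::euclidean_space \<Rightarrow> real" where
  "penalty r x = max 0 (- r\<^sup>2 + 1 * (x \<bullet> x)) ^ 3"

lemma penalty_nonneg [simp]: "penalty r x \<ge> 0"
  by (simp add: penalty_def)

lemma penalty_eq_0_iff:
  assumes "r \<ge> 0" shows "penalty r x = 0 \<longleftrightarrow> norm x \<le> r"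
proof -
  have "penalty r x = 0 \<longleftrightarrow> (norm x)\<^sup>2 \<le> r\<^sup>2"
    by (auto simp: penalty_def max_def power2_norm_eq_inner)
  also have "\<dots> \<longleftrightarrow> norm x \<le> r" using assms by (simp add: power_mono_iff)
  finally show ?thesis .
qed

text \<open>The form of the Hessian is a nonnegative multiple of the squared norm of
  \<open>v\<close> plus a nonnegative multiple of \<open>(x \<bullet> v)\<^sup>2\<close>. Adding the
  penalty to \<open>U\<close> therefore preserves the lower bound \<open>R\<close>.\<close>

lemma C2_fun_penalty:
  obtains G H where "C2_fun (penalty r :: 'a::euclidean_space \<Rightarrow> real) G H" "\<And>x v. H x v \<bullet> v \<ge> 0"
    "\<And>x. r \<ge> 0 \<Longrightarrow> norm x \<le> r \<Longrightarrow> G x = 0"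
proof -
  note C = C2_fun_cube_pos[OF C2_fun_affine[OF C2_fun_norm_square, where c = "- r\<^sup>2" and d = 1], folded penalty_def, unfolded scaleR_one]
  show ?thesis
  proof (rule that[OF C])
    fix x v :: 'a
    show "0 \<le> ((3 * (max 0 (- r\<^sup>2 + 1 * (x \<bullet> x)))\<^sup>2) *\<^sub>R 2 *\<^sub>R v + (6 * max 0 (- r\<^sup>2 + 1 * (x \<bullet> x)) * ((2 *\<^sub>R x) \<bullet> v)) *\<^sub>R 2 *\<^sub>R x) \<bullet> v"
      by (simp add: inner_add_left mult.assoc)
  next
    fix x :: 'a assume "r \<ge> 0" "norm x \<le> r"
    then have "x \<bullet> x \<le> r\<^sup>2" unfolding power2_norm_eq_inner[symmetric] by (simp add: power_mono)
    then show "(3 * (max 0 (- r\<^sup>2 + 1 * (x \<bullet> x)))\<^sup>2) *\<^sub>R 2 *\<^sub>R x = 0" by (simp add: max_def)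
  qed
qed

text \<open>The witness is \<open>a + cut * (g - a)\<close>, which lies between \<open>a\<close> and
  \<open>g\<close> and so keeps its values in the interval. \<open>cut\<close> is 1 where the
  penalty vanishes and 0 where it is at least 1; beyond radius \<open>r + 1\<close> the penalty is
  at least 1 because \<open>(r + 1)\<^sup>2 - r\<^sup>2 \<ge> 1\<close>.\<close>

lemma C2_fun_cutoff:
  fixes g :: "'a::euclidean_space \<Rightarrow> real"
  assumes g: "C2_fun g G H" and gin: "\<And>x. g x \<in> {a..b}" and r: "r \<ge> 0"
  obtains g' G' H' where "C2_fun g' G' H'" "\<And>x. g' x \<in> {a..b}" "\<And>x. norm x \<le> r \<Longrightarrow> g' x = g x \<and> G' x = G x"
    "\<And>x. norm x > r + 1 \<Longrightarrow> G' x = 0"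
proof -
  obtain P HP where P: "C2_fun (penalty r :: 'a \<Rightarrow> real) P HP" "\<And>x. norm x \<le> r \<Longrightarrow> P x = 0"
    using C2_fun_penalty[of r] r by metis
  define cut :: "'a \<Rightarrow> real" where "cut x = max 0 (1 + - 1 * penalty r x) ^ 3" for x
  note Ccut = C2_fun_cube_pos[OF C2_fun_affine[OF P(1), of 1 "- 1"], folded cut_def]
  note Cg = C2_fun_affine[OF g, of "- a" 1]
  note C = C2_fun_affine[OF C2_fun_mult[OF Ccut Cg], of a 1]
  have cut01: "0 \<le> cut x" "cut x \<le> 1" for x
    unfolding cut_def using penalty_nonneg[of r x] by (auto intro!: power_le_one)
  show ?thesis
  proof (rule that[OF C])
    fix x :: 'a
    have "0 \<le> cut x * (g x - a)" using cut01 gin[of x] by (intro mult_nonneg_nonneg) auto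
    moreover have "cut x * (g x - a) \<le> 1 * (g x - a)" using cut01 gin[of x] by (intro mult_right_mono) auto
    ultimately show "a + 1 * (cut x * (- a + 1 * g x)) \<in> {a..b}" using gin[of x] by auto
  next
    fix x :: 'a assume x: "norm x \<le> r"
    then have "penalty r x = 0" using penalty_eq_0_iff[OF r, of x] by simp
    then have "cut x = 1" by (simp add: cut_def)
    then show "a + 1 * (cut x * (- a + 1 * g x)) = g x \<and>
      1 *\<^sub>R (cut x *\<^sub>R 1 *\<^sub>R G x + (- a + 1 * g x) *\<^sub>R (3 * (max 0 (1 + - 1 * penalty r x))\<^sup>2) *\<^sub>R (- 1) *\<^sub>R P x) = G x"
      using P(2)[OF x] by simp
  next
    fix x :: 'a assume x: "norm x > r + 1"
    have "(r + 1)\<^sup>2 < (norm x)\<^sup>2" using x r by (intro power_strict_mono) auto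
    then have "1 \<le> - r\<^sup>2 + 1 * (x \<bullet> x)" using r by (simp add: power2_norm_eq_inner power2_sum)
    then have "1 \<le> penalty r x" unfolding penalty_def by (simp add: max_def one_le_power)
    then have "cut x = 0" "max 0 (1 + - 1 * penalty r x) = 0" by (auto simp: cut_def max_def)
    then show "1 *\<^sub>R (cut x *\<^sub>R 1 *\<^sub>R G x + (- a + 1 * g x) *\<^sub>R (3 * (max 0 (1 + - 1 * penalty r x))\<^sup>2) *\<^sub>R (- 1) *\<^sub>R P x) = 0"
      by simp
  qed
qed

section \<open>Conditioning on balls and exhausting the space\<close>

context bellman_log_concave begin

lemma C2_U: "C2_fun U DU HU"
  unfolding C2_fun_def using dU dDU contHU by blast

text \<open>Normalising \<open>exp (- k * penalty r x)\<close> relative to \<open>\<mu>\<close>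
  gives a measure with potential \<open>U + k * penalty r + ln Z\<close>, which satisfies the same
  hypotheses with the same \<open>R\<close>; the whole locale is instantiated for it.\<close>

lemma penalized_inequality:
  fixes k r :: real
  assumes r: "r \<ge> 0" and k: "k \<ge> 0"
    and g: "C2_fun g G H" and gin: "\<And>x. g x \<in> {a..b}" and out: "\<And>x. norm x > r' \<Longrightarrow> G x = 0"
  defines "Z \<equiv> \<integral>x. exp (- k * penalty r x) \<partial>\<mu>"
  shows "Z > 0" "(\<integral>x. exp (- k * penalty r x) * N (g x, (norm (G x))\<^sup>2 / R) \<partial>\<mu>) / Z
    \<le> N ((\<integral>x. exp (- k * penalty r x) * g x \<partial>\<mu>) / Z, 0)"
proof -
  obtain P HP where P: "C2_fun (penalty r :: 'a \<Rightarrow> real) P HP" "\<And>x v. HP x v \<bullet> v \<ge> 0"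
    using C2_fun_penalty[of r] by metis
  have [measurable]: "(penalty r :: 'a \<Rightarrow> real) \<in> borel_measurable borel"
    by (rule borel_measurable_continuous_onI[OF C2_funD(4)[OF P(1)]])
  have iZ: "integrable \<mu> (\<lambda>x. exp (- k * penalty r x))"
    by (rule integrable_\<mu>_bounded[where B = 1]) (use k penalty_nonneg[of r] in \<open>auto intro: mult_nonneg_nonneg\<close>)
  show Z: "Z > 0"
  proof -
    have "Z \<noteq> 0"
    proof
      assume "Z = 0"
      then have "AE x in \<mu>. exp (- k * penalty r x) = 0"
        unfolding Z_def using iZ by (subst (asm) integral_nonneg_eq_0_iff_AE) auto
      then show False by simp
    qed
    moreover have "Z \<ge> 0" unfolding Z_def by simp
    ultimately show ?thesis by simp
  qed
  define Uk where "Uk x = ln Z + 1 * (U x + (0 + k * penalty r x))" for x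
  note CU = C2_fun_affine[OF C2_fun_add[OF C2_U C2_fun_affine[OF P(1), of 0 k]], of "ln Z" 1, folded Uk_def]
  have eUk: "exp (- Uk x) = \<rho> x * exp (- k * penalty r x) / Z" for x
  proof -
    have "- Uk x = - U x + (- k * penalty r x) - ln Z" by (simp add: Uk_def)
    then show ?thesis using Z by (simp only: exp_diff exp_add exp_ln \<rho>_def)
  qed
  interpret K: bellman_log_concave a b N Nx Ny Nxx Nxy Nyx Nyy S Uk "\<lambda>x. 1 *\<^sub>R (DU x + k *\<^sub>R P x)" "\<lambda>x v. 1 *\<^sub>R (HU x v + k *\<^sub>R HP x v)" R
  proof (intro bellman_log_concave.intro bellman_axioms log_concave.intro convex_potential.intro log_concave_axioms.intro)
    show "(\<integral>x. exp (- Uk x) \<partial>lborel) = 1"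
    proof -
      have "(\<integral>x. exp (- Uk x) \<partial>lborel) = (\<integral>x. \<rho> x *\<^sub>R exp (- k * penalty r x) \<partial>lborel) / Z" unfolding eUk by simp
      also have "(\<integral>x. \<rho> x *\<^sub>R exp (- k * penalty r x) \<partial>lborel) = Z" unfolding Z_def by (rule integral_\<mu>[symmetric]) simp
      finally show ?thesis using Z by simp
    qed
    show "R * (v \<bullet> v) \<le> (1 *\<^sub>R (HU x v + k *\<^sub>R HP x v)) \<bullet> v" for x v
      using HU_ge[of v x] mult_nonneg_nonneg[OF k P(2)[of x v]] by (simp add: inner_add_left)
  qed ((rule S_def) | (use R C2_funD[OF CU] in auto))+
  have intK: "(\<integral>x. \<phi> x \<partial>K.\<mu>) = (\<integral>x. exp (- k * penalty r x) * \<phi> x \<partial>\<mu>) / Z" if [measurable]: "\<phi> \<in> borel_measurable borel" for \<phi> :: "'a \<Rightarrow> real"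
  proof -
    have "(\<integral>x. \<phi> x \<partial>K.\<mu>) = (\<integral>x. exp (- Uk x) * \<phi> x \<partial>lborel)"
      using K.integral_\<mu>[OF that] by (simp add: K.\<rho>_def)
    also have "\<dots> = (\<integral>x. \<rho> x *\<^sub>R (exp (- k * penalty r x) * \<phi> x) \<partial>lborel) / Z" unfolding eUk by (simp add: mult.assoc)
    also have "(\<integral>x. \<rho> x *\<^sub>R (exp (- k * penalty r x) * \<phi> x) \<partial>lborel) = (\<integral>x. exp (- k * penalty r x) * \<phi> x \<partial>\<mu>)"
      by (rule integral_\<mu>[symmetric]) simp
    finally show ?thesis .
  qed
  have gm: "g \<in> borel_measurable borel" by (rule borel_measurable_continuous_onI[OF C2_funD(4)[OF g]])
  have Nm: "(\<lambda>x. N (g x, (norm (G x))\<^sup>2 / R)) \<in> borel_measurable borel"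
    by (intro borel_measurable_continuous_onI continuous_on_N_compose continuous_intros C2_funD(4,5)[OF g] gin) (use R in auto)
  show "(\<integral>x. exp (- k * penalty r x) * N (g x, (norm (G x))\<^sup>2 / R) \<partial>\<mu>) / Z
    \<le> N ((\<integral>x. exp (- k * penalty r x) * g x \<partial>\<mu>) / Z, 0)"
    using K.inequality_constant_at_infinity[OF C2_funD(1,2,3)[OF g] out gin] unfolding intK[OF gm] intK[OF Nm] .
qed

text \<open>As \<open>k\<close> tends to infinity the weights converge to the indicator of the ball.
  The cutoff agrees with \<open>g\<close> and its gradient there, so the limit contains no trace of
  the region where \<open>g\<close> was changed.\<close>

lemma ball_inequality:
  assumes r: "r \<ge> 0" and z: "measure \<mu> (cball 0 r) > 0" and g: "C2_fun g G H" and gin: "\<And>x. g x \<in> {a..b}"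
  shows "(\<integral>x. indicator (cball 0 r) x * N (g x, (norm (G x))\<^sup>2 / R) \<partial>\<mu>) / measure \<mu> (cball 0 r)
    \<le> N ((\<integral>x. indicator (cball 0 r) x * g x \<partial>\<mu>) / measure \<mu> (cball 0 r), 0)"
proof (rule C2_fun_cutoff[OF g gin r])
  fix g' G' H' assume g': "C2_fun g' G' H'" "\<And>x. g' x \<in> {a..b}" "\<And>x. norm x \<le> r \<Longrightarrow> g' x = g x \<and> G' x = G x"
    "\<And>x. norm x > r + 1 \<Longrightarrow> G' x = 0"
  obtain P HP where P: "C2_fun (penalty r :: 'a \<Rightarrow> real) P HP"
    using C2_fun_penalty[of r] by metis
  have [measurable]: "(penalty r :: 'a \<Rightarrow> real) \<in> borel_measurable borel"
    by (rule borel_measurable_continuous_onI[OF C2_funD(4)[OF P]])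
  have [measurable]: "cball (0 :: 'a) r \<in> sets borel" by (rule borel_closed[OF closed_cball])
  let ?e = "\<lambda>k x. exp (- real k * penalty r x)" and ?I = "indicator (cball 0 r) :: 'a \<Rightarrow> real"
  have lim: "(\<lambda>k. \<integral>x. ?e k x * \<phi> x \<partial>\<mu>) \<longlonglongrightarrow> (\<integral>x. ?I x * \<phi> x \<partial>\<mu>)"
    if [measurable]: "\<phi> \<in> borel_measurable borel" and B: "\<And>x. \<bar>\<phi> x\<bar> \<le> B" for \<phi> :: "'a \<Rightarrow> real" and B
  proof (rule integral_dominated_convergence[where w = "\<lambda>_. B"])
    show "AE x in \<mu>. (\<lambda>k. ?e k x * \<phi> x) \<longlonglongrightarrow> ?I x * \<phi> x"
    proof (rule AE_I2)
      fix x
      have "(\<lambda>k. ?e k x) \<longlonglongrightarrow> ?I x"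
      proof (cases "norm x \<le> r")
        case True
        then show ?thesis using penalty_eq_0_iff[OF r, of x] by simp
      next
        case False
        then have p: "penalty r x > 0" using penalty_eq_0_iff[OF r, of x] penalty_nonneg[of r x] by linarith
        have "?e k x = exp (- penalty r x) ^ k" for k by (simp add: exp_of_nat_mult[symmetric])
        then show ?thesis using False p LIMSEQ_realpow_zero[of "exp (- penalty r x)"] by simp
      qed
      then show "(\<lambda>k. ?e k x * \<phi> x) \<longlonglongrightarrow> ?I x * \<phi> x" by (intro tendsto_intros)
    qed
    show "AE x in \<mu>. norm (?e k x * \<phi> x) \<le> B" for k
    proof (rule AE_I2)
      fix x
      have "?e k x * \<bar>\<phi> x\<bar> \<le> 1 * B" using B[of x] penalty_nonneg[of r x] by (intro mult_mono) auto
      then show "norm (?e k x * \<phi> x) \<le> B" by (simp add: abs_mult)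
    qed
  qed auto
  have ind: "(\<integral>x. ?I x * 1 \<partial>\<mu>) = measure \<mu> (cball 0 r)" by simp
  define Z where "Z k = (\<integral>x. ?e k x \<partial>\<mu>)" for k
  have Zlim: "Z \<longlonglongrightarrow> measure \<mu> (cball 0 r)"
    using lim[of "\<lambda>_. 1" 1] unfolding ind Z_def[abs_def] by simp
  have gm: "g' \<in> borel_measurable borel" by (rule borel_measurable_continuous_onI[OF C2_funD(4)[OF g'(1)]])
  have Nm: "(\<lambda>x. N (g' x, (norm (G' x))\<^sup>2 / R)) \<in> borel_measurable borel"
    by (intro borel_measurable_continuous_onI continuous_on_N_compose continuous_intros C2_funD(4,5)[OF g'(1)] g'(2)) (use R in auto)
  have "compact (G' ` cball 0 (r + 1))" by (intro compact_continuous_image C2_funD(5)[OF g'(1)] compact_cball)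
  from compact_imp_bounded[OF this]
  obtain L where L: "\<And>x. x \<in> cball 0 (r + 1) \<Longrightarrow> norm (G' x) \<le> L"
    unfolding bounded_iff by blast
  have L': "norm (G' x) \<le> max L 0" for x
    using L[of x] g'(4)[of x] by (cases "norm x > r + 1") (auto simp: dist_norm)
  obtain BN where BN: "\<And>p. p \<in> {a..b} \<times> {0..(max L 0)\<^sup>2 / R} \<Longrightarrow> \<bar>N p\<bar> \<le> BN" using N_bounded by blast
  have NB: "\<bar>N (g' x, (norm (G' x))\<^sup>2 / R)\<bar> \<le> BN" for x
    using g'(2)[of x] R power_mono[OF L'[of x] norm_ge_zero, of 2] by (intro BN) (auto simp: divide_right_mono)
  have gB: "\<bar>g' x\<bar> \<le> \<bar>a\<bar> + \<bar>b\<bar>" for x by (rule abs_le_interval[OF g'(2)])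
  have pen: "0 < Z k" "(\<integral>x. ?e k x * N (g' x, (norm (G' x))\<^sup>2 / R) \<partial>\<mu>) / Z k \<le> N ((\<integral>x. ?e k x * g' x \<partial>\<mu>) / Z k, 0)" for k
    unfolding Z_def by (rule penalized_inequality[OF r of_nat_0_le_iff g'(1,2), where r' = "r + 1"], rule g'(4), assumption)+
  have in_ab: "(\<integral>x. ?e k x * g' x \<partial>\<mu>) / Z k \<in> {a..b}" for k
  proof -
    have ie: "integrable \<mu> (?e k)"
      by (rule integrable_\<mu>_bounded[where B = 1]) (use penalty_nonneg[of r] in auto)
    have ig: "integrable \<mu> (\<lambda>x. ?e k x * g' x)"
    proof (rule integrable_\<mu>_bounded[where B = "\<bar>a\<bar> + \<bar>b\<bar>"])
      fix x
      have "?e k x * \<bar>g' x\<bar> \<le> 1 * (\<bar>a\<bar> + \<bar>b\<bar>)" using gB[of x] penalty_nonneg[of r x] by (intro mult_mono) auto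
      then show "norm (?e k x * g' x) \<le> \<bar>a\<bar> + \<bar>b\<bar>" by (simp add: abs_mult)
    qed (use gm in measurable)
    have "(\<integral>x. ?e k x * a \<partial>\<mu>) \<le> (\<integral>x. ?e k x * g' x \<partial>\<mu>)"
      by (rule integral_mono) (use ie ig g'(2) in auto)
    moreover have "(\<integral>x. ?e k x * g' x \<partial>\<mu>) \<le> (\<integral>x. ?e k x * b \<partial>\<mu>)"
      by (rule integral_mono) (use ie ig g'(2) in auto)
    moreover have "(\<integral>x. ?e k x * c \<partial>\<mu>) = c * Z k" for c by (simp add: Z_def)
    ultimately show ?thesis using pen(1)[of k] by (simp only: atLeastAtMost_iff pos_le_divide_eq pos_divide_le_eq)
  qed
  have lim1: "(\<lambda>k. (\<integral>x. ?e k x * N (g' x, (norm (G' x))\<^sup>2 / R) \<partial>\<mu>) / Z k) \<longlonglongrightarrow>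
      (\<integral>x. ?I x * N (g' x, (norm (G' x))\<^sup>2 / R) \<partial>\<mu>) / measure \<mu> (cball 0 r)"
    using z by (intro tendsto_divide lim[OF Nm NB] Zlim) auto
  have lim2: "(\<lambda>k. (\<integral>x. ?e k x * g' x \<partial>\<mu>) / Z k) \<longlonglongrightarrow> (\<integral>x. ?I x * g' x \<partial>\<mu>) / measure \<mu> (cball 0 r)"
    using z by (intro tendsto_divide lim[OF gm gB] Zlim) auto
  have in_lim: "(\<integral>x. ?I x * g' x \<partial>\<mu>) / measure \<mu> (cball 0 r) \<in> {a..b}"
    by (rule Lim_in_closed_set[OF closed_atLeastAtMost _ _ lim2]) (use in_ab in auto)
  have lim3: "(\<lambda>k. N ((\<integral>x. ?e k x * g' x \<partial>\<mu>) / Z k, 0)) \<longlonglongrightarrow> N ((\<integral>x. ?I x * g' x \<partial>\<mu>) / measure \<mu> (cball 0 r), 0)"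
    by (intro continuous_on_tendsto_compose[OF cont_N] tendsto_Pair lim2 tendsto_const)
      (use in_ab in_lim in \<open>auto simp: S_def\<close>)
  have "(\<integral>x. ?I x * N (g' x, (norm (G' x))\<^sup>2 / R) \<partial>\<mu>) / measure \<mu> (cball 0 r)
    \<le> N ((\<integral>x. ?I x * g' x \<partial>\<mu>) / measure \<mu> (cball 0 r), 0)"
    by (rule LIMSEQ_le[OF lim1 lim3]) (use pen(2) in auto)
  moreover have "(\<lambda>x. ?I x * g' x) = (\<lambda>x. ?I x * g x)"
    using g'(3) by (auto simp: indicator_def)
  moreover have "(\<lambda>x. ?I x * N (g' x, (norm (G' x))\<^sup>2 / R)) = (\<lambda>x. ?I x * N (g x, (norm (G x))\<^sup>2 / R))"
    using g'(3) by (auto simp: indicator_def)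
  ultimately show ?thesis by simp
qed

text \<open>Balls of integer radius exhaust the space. The function inside stays the same while the
  ball grows, so its integrability alone gives the dominating function.\<close>

theorem integral_inequality:
  assumes g: "C2_fun g G H" and gin: "\<And>x. g x \<in> {a..b}"
    and int: "integrable \<mu> (\<lambda>x. N (g x, (norm (G x))\<^sup>2 / R))"
  shows "(\<integral>x. N (g x, (norm (G x))\<^sup>2 / R) \<partial>\<mu>) \<le> N (\<integral>x. g x \<partial>\<mu>, 0)"
proof -
  let ?D = "\<lambda>n::nat. cball (0::'a) (real n)"
  let ?I = "\<lambda>n. indicator (?D n) :: 'a \<Rightarrow> real"
  have [measurable]: "?D n \<in> sets borel" for n by (rule borel_closed[OF closed_cball])
  have Ilim: "(\<lambda>n. ?I n x) \<longlonglongrightarrow> 1" for x :: 'a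
  proof (rule tendsto_eventually)
    obtain m where "norm x \<le> real m" using real_arch_simple by blast
    then have "\<forall>n\<ge>m. ?I n x = 1" by (auto simp: indicator_def)
    then show "\<forall>\<^sub>F n in sequentially. ?I n x = 1" unfolding eventually_sequentially by blast
  qed
  have lim: "(\<lambda>n. \<integral>x. ?I n x * \<phi> x \<partial>\<mu>) \<longlonglongrightarrow> (\<integral>x. \<phi> x \<partial>\<mu>)" if i: "integrable \<mu> \<phi>" for \<phi> :: "'a \<Rightarrow> real"
  proof (rule integral_dominated_convergence[where w = "\<lambda>x. norm (\<phi> x)"])
    show "AE x in \<mu>. (\<lambda>n. ?I n x * \<phi> x) \<longlonglongrightarrow> \<phi> x"
    proof (rule AE_I2)
      fix x show "(\<lambda>n. ?I n x * \<phi> x) \<longlonglongrightarrow> \<phi> x"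
        using tendsto_mult[OF Ilim[of x] tendsto_const[of "\<phi> x"]] by simp
    qed
  qed (use i in \<open>auto simp: indicator_def\<close>)
  have gm[measurable]: "g \<in> borel_measurable borel" by (rule borel_measurable_continuous_onI[OF C2_funD(4)[OF g]])
  have ig: "integrable \<mu> g"
    by (rule integrable_\<mu>_bounded[where B = "\<bar>a\<bar> + \<bar>b\<bar>"]) (use abs_le_interval[OF gin] in auto)
  have zlim: "(\<lambda>n. measure \<mu> (?D n)) \<longlonglongrightarrow> 1"
  proof -
    have "(\<lambda>n. \<integral>x. ?I n x * 1 \<partial>\<mu>) \<longlonglongrightarrow> (\<integral>x. 1 \<partial>\<mu>)" by (rule lim) simp
    then show ?thesis by (simp add: \<mu>.prob_space[simplified])
  qed
  \<comment> \<open>The ball of radius 0 is a null set, so positivity is claimed eventually and not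
    for all \<open>n\<close>.\<close>
  have zpos: "\<forall>\<^sub>F n in sequentially. measure \<mu> (?D n) > 0"
    by (rule order_tendstoD(1)[OF zlim]) simp
  have l1: "(\<lambda>n. (\<integral>x. ?I n x * N (g x, (norm (G x))\<^sup>2 / R) \<partial>\<mu>) / measure \<mu> (?D n)) \<longlonglongrightarrow> (\<integral>x. N (g x, (norm (G x))\<^sup>2 / R) \<partial>\<mu>) / 1"
    by (intro tendsto_divide lim int zlim) simp
  have l2: "(\<lambda>n. (\<integral>x. ?I n x * g x \<partial>\<mu>) / measure \<mu> (?D n)) \<longlonglongrightarrow> (\<integral>x. g x \<partial>\<mu>) / 1"
    by (intro tendsto_divide lim ig zlim) simp
  have in_ab: "(\<integral>x. ?I n x * g x \<partial>\<mu>) / measure \<mu> (?D n) \<in> {a..b}" if "measure \<mu> (?D n) > 0" for n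
  proof -
    have iI: "integrable \<mu> (?I n)" by (rule integrable_\<mu>_bounded[where B = 1]) (auto simp: indicator_def)
    have iIg: "integrable \<mu> (\<lambda>x. ?I n x * g x)"
      by (rule integrable_\<mu>_bounded[where B = "\<bar>a\<bar> + \<bar>b\<bar>"]) (use abs_le_interval[OF gin] in \<open>auto simp: indicator_def\<close>)
    have "(\<integral>x. ?I n x * a \<partial>\<mu>) \<le> (\<integral>x. ?I n x * g x \<partial>\<mu>)"
      by (intro integral_mono integrable_mult_left iI iIg mult_left_mono) (use gin in auto)
    moreover have "(\<integral>x. ?I n x * g x \<partial>\<mu>) \<le> (\<integral>x. ?I n x * b \<partial>\<mu>)"
      by (intro integral_mono integrable_mult_left iI iIg mult_left_mono) (use gin in auto)
    ultimately show ?thesis using that by (simp add: field_simps)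
  qed
  have gI: "(\<integral>x. g x \<partial>\<mu>) \<in> {a..b}" by (rule integral_in_interval[OF prob_space_\<mu>]) (use gin in auto)
  have l3: "(\<lambda>n. N ((\<integral>x. ?I n x * g x \<partial>\<mu>) / measure \<mu> (?D n), 0)) \<longlonglongrightarrow> N ((\<integral>x. g x \<partial>\<mu>) / 1, 0)"
    by (rule continuous_on_tendsto_compose[OF cont_N tendsto_Pair[OF l2 tendsto_const]])
      (use gI in_ab zpos in \<open>auto simp: S_def elim!: eventually_mono\<close>)
  have "(\<integral>x. N (g x, (norm (G x))\<^sup>2 / R) \<partial>\<mu>) / 1 \<le> N ((\<integral>x. g x \<partial>\<mu>) / 1, 0)"
  proof (rule tendsto_le[OF _ l3 l1])
    show "\<forall>\<^sub>F n in sequentially. (\<integral>x. ?I n x * N (g x, (norm (G x))\<^sup>2 / R) \<partial>\<mu>) / measure \<mu> (?D n)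
      \<le> N ((\<integral>x. ?I n x * g x \<partial>\<mu>) / measure \<mu> (?D n), 0)"
      using zpos by eventually_elim (rule ball_inequality[OF _ _ g gin], auto)
  qed simp
  then show ?thesis by simp
qed

end

section \<open>Derivation of the theorem\<close>

lemma has_derivative_grad:
  fixes f :: "real^'n \<Rightarrow> real"
  assumes "f differentiable (at x)"
  shows "(f has_derivative (\<lambda>h. grad f x \<bullet> h)) (at x)"
proof -
  have d: "(f has_derivative frechet_derivative f (at x)) (at x)"
    using assms by (simp add: frechet_derivative_works)
  interpret bounded_linear "frechet_derivative f (at x)" using d by (rule has_derivative_bounded_linear)
  have "frechet_derivative f (at x) h = grad f x \<bullet> h" for h
  proof -
    have "frechet_derivative f (at x) h = frechet_derivative f (at x) (\<Sum>i\<in>UNIV. (h $ i) *\<^sub>R axis i 1)"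
      using basis_expansion[of h] by (simp add: scalar_mult_eq_scaleR)
    also have "\<dots> = grad f x \<bullet> h"
      by (simp add: sum scaleR grad_def partial_def inner_vec_def mult.commute)
    finally show ?thesis .
  qed
  then have "frechet_derivative f (at x) = (\<lambda>h. grad f x \<bullet> h)" by auto
  then show ?thesis using d by simp
qed

definition grad_deriv :: "(real^'n \<Rightarrow> real) \<Rightarrow> real^'n \<Rightarrow> real^'n \<Rightarrow> real^'n" where
  "grad_deriv f x v = (\<chi> j. frechet_derivative (partial j f) (at x) v)"

lemma smooth_imp_C2:
  fixes f :: "real^'n \<Rightarrow> real"
  assumes "smooth f"
  shows "C2_fun f (grad f) (grad_deriv f)" "\<And>j. partial j f differentiable (at x)"
proof -
  have "C_k_on (Suc (Suc 0)) UNIV f" using assms unfolding smooth_def by blast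
  then have 1: "\<And>x. f differentiable (at x)"
    and 2: "\<And>v x. (\<lambda>x. frechet_derivative f (at x) v) differentiable (at x)"
    and 3: "\<And>v w. continuous_on UNIV (\<lambda>x. frechet_derivative (\<lambda>x. frechet_derivative f (at x) v) (at x) w)"
    by (auto simp: differentiable_on_def)
  have p: "partial j f = (\<lambda>x. frechet_derivative f (at x) (axis j 1))" for j by (auto simp: partial_def)
  show pd: "partial j f differentiable (at x)" for j x unfolding p by (rule 2)
  show "C2_fun f (grad f) (grad_deriv f)"
    unfolding C2_fun_def
  proof (intro conjI allI)
    fix x
    show "(f has_derivative (\<lambda>h. grad f x \<bullet> h)) (at x)" by (rule has_derivative_grad[OF 1])
    show "(grad f has_derivative grad_deriv f x) (at x)"
    proof (subst has_derivative_componentwise_within, intro ballI)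
      fix b :: "real^'n" assume "b \<in> Basis"
      then obtain j where b: "b = axis j 1" by (auto simp: Basis_vec_def)
      have "((\<lambda>x. partial j f x) has_derivative frechet_derivative (partial j f) (at x)) (at x)"
        using pd by (simp add: frechet_derivative_works)
      then show "((\<lambda>x. grad f x \<bullet> b) has_derivative (\<lambda>v. grad_deriv f x v \<bullet> b)) (at x)"
        by (simp add: b inner_axis grad_def grad_deriv_def)
    qed
    show "continuous_on UNIV (\<lambda>x. grad_deriv f x v)" for v
      unfolding grad_deriv_def p by (intro continuous_on_vec_lambda 3)
  qed
qed

text \<open>By the index order in \<open>Hess\<close>, \<open>grad_deriv f x v\<close> is the
  transposed matrix applied to \<open>v\<close>; exchanging the two sums shows that the quadratic
  form is the same.\<close>

lemma grad_deriv_eq_Hess: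
  fixes f :: "real^'n \<Rightarrow> real"
  assumes "smooth f"
  shows "grad_deriv f x v \<bullet> v = v \<bullet> (Hess f x *v v)"
proof -
  have "frechet_derivative (partial j f) (at x) v = (\<Sum>i\<in>UNIV. v $ i * Hess f x $ i $ j)" for j
  proof -
    have "(partial j f has_derivative (\<lambda>h. grad (partial j f) x \<bullet> h)) (at x)"
      by (rule has_derivative_grad[OF smooth_imp_C2(2)[OF assms]])
    from frechet_derivative_at[OF this, symmetric]
    have "frechet_derivative (partial j f) (at x) v = grad (partial j f) x \<bullet> v" by simp
    then show ?thesis by (simp add: inner_vec_def grad_def Hess_def mult.commute)
  qed
  then have "grad_deriv f x v \<bullet> v = (\<Sum>j\<in>UNIV. \<Sum>i\<in>UNIV. v $ i * Hess f x $ i $ j * v $ j)"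
    by (simp add: grad_deriv_def inner_vec_def sum_distrib_right)
  also have "\<dots> = (\<Sum>i\<in>UNIV. \<Sum>j\<in>UNIV. v $ i * Hess f x $ i $ j * v $ j)" by (rule sum.swap)
  also have "\<dots> = v \<bullet> (Hess f x *v v)"
    by (simp add: inner_vec_def matrix_vector_mult_def sum_distrib_left mult.assoc)
  finally show ?thesis .
qed

lemma neg_semidef_2:
  fixes A :: "real^2^2"
  assumes "neg_semidef A"
  shows "A $ 1 $ 1 * p\<^sup>2 + (A $ 1 $ 2 + A $ 2 $ 1) * p * q + A $ 2 $ 2 * q\<^sup>2 \<le> 0"
proof -
  have "vector [p, q] \<bullet> (A *v vector [p, q]) \<le> 0" using assms unfolding neg_semidef_def by blast
  then show ?thesis
    by (simp add: inner_vec_def matrix_vector_mult_def sum_2 vector_2 algebra_simps power2_eq_square)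
qed

lemma frechet_derivative_pair:
  fixes f :: "real \<times> real \<Rightarrow> real"
  assumes "f differentiable (at p within A)"
  shows "(f has_derivative (\<lambda>v. fst v * frechet_derivative f (at p within A) (1, 0) + snd v * frechet_derivative f (at p within A) (0, 1))) (at p within A)"
proof -
  have d: "(f has_derivative frechet_derivative f (at p within A)) (at p within A)"
    using assms by (simp add: frechet_derivative_works)
  interpret bounded_linear "frechet_derivative f (at p within A)" using d by (rule has_derivative_bounded_linear)
  have "frechet_derivative f (at p within A) v = fst v * frechet_derivative f (at p within A) (1, 0) + snd v * frechet_derivative f (at p within A) (0, 1)" for v
  proof -
    have "v = fst v *\<^sub>R (1, 0) + snd v *\<^sub>R (0, 1)" by (cases v) simp
    then have "frechet_derivative f (at p within A) v = frechet_derivative f (at p within A) (fst v *\<^sub>R (1, 0) + snd v *\<^sub>R (0, 1))" by simp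
    then show ?thesis by (simp only: add scaleR) simp
  qed
  then show ?thesis by (intro has_derivative_eq_rhs[OF d] ext)
qed

text \<open>For \<open>y \<ge> 0\<close> one has \<open>M x y = N (x, y\<^sup>2)\<close>, and the
  chain rule expresses the entries of the matrix by the derivatives of \<open>N\<close>. The latter
  are the Frechet derivatives relative to the strip, applied to the unit vectors.\<close>

lemma C2_imp_bellman:
  fixes M :: "real \<Rightarrow> real \<Rightarrow> real"
  assumes ab: "a < b"
    and C2: "C_k_on 2 ({a..b} \<times> {0..}) (\<lambda>(x, y). M x (sqrt y))"
    and neg: "\<And>x y. x \<in> {a..b} \<Longrightarrow> y > 0 \<Longrightarrow> neg_semidef (M_matrix {a..b} M x y)"
  obtains Nx Ny Nxx Nxy Nyx Nyy where "bellman a b (\<lambda>(x, y). M x (sqrt y)) Nx Ny Nxx Nxy Nyx Nyy"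
proof -
  define S where "S = {a..b} \<times> {0::real..}"
  define N where "N = (\<lambda>(x, y). M x (sqrt y))"
  define D where "D f v = (\<lambda>p. frechet_derivative f (at p within S) v)" for f :: "real \<times> real \<Rightarrow> real" and v
  define Nx Ny where "Nx = D N (1, 0)" and "Ny = D N (0, 1)"
  define Nxx Nxy where "Nxx = D Nx (1, 0)" and "Nxy = D Nx (0, 1)"
  define Nyx Nyy where "Nyx = D Ny (1, 0)" and "Nyy = D Ny (0, 1)"
  have "C_k_on (Suc (Suc 0)) S N" using C2 by (simp only: numeral_2_eq_2 S_def N_def)
  then have d1: "N differentiable_on S" and d2: "\<And>v. D N v differentiable_on S" and d3: "\<And>v w. continuous_on S (D (D N v) w)"
    by (auto simp: D_def)
  have dN: "(N has_derivative (\<lambda>v. fst v * Nx p + snd v * Ny p)) (at p within S)" if "p \<in> S" for p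
    using frechet_derivative_pair[of N p S] d1 that by (simp add: differentiable_on_def Nx_def Ny_def D_def)
  have dNx: "(Nx has_derivative (\<lambda>v. fst v * Nxx p + snd v * Nxy p)) (at p within S)" if "p \<in> S" for p
    using frechet_derivative_pair[of Nx p S] d2[of "(1, 0)"] that by (simp add: differentiable_on_def Nxx_def Nxy_def Nx_def D_def)
  have dNy: "(Ny has_derivative (\<lambda>v. fst v * Nyx p + snd v * Nyy p)) (at p within S)" if "p \<in> S" for p
    using frechet_derivative_pair[of Ny p S] d2[of "(0, 1)"] that by (simp add: differentiable_on_def Nyx_def Nyy_def Ny_def D_def)
  have MN: "M x y = N (x, y\<^sup>2)" if "y \<ge> 0" for x y using that by (simp add: N_def)
  have along_x: "vector_derivative (\<lambda>t. h t) (at x within {a..b}) = A (x, y\<^sup>2)"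
    if h: "\<And>t. t \<in> {a..b} \<Longrightarrow> h t = f (t, y\<^sup>2)" and x: "x \<in> {a..b}"
      and f: "\<And>p. p \<in> S \<Longrightarrow> (f has_derivative (\<lambda>v. fst v * A p + snd v * B p)) (at p within S)" for f A B :: "real \<times> real \<Rightarrow> real" and h x y
  proof (rule vector_derivative_within_closed_interval[OF ab x], rule has_vector_derivative_transform[OF x h])
    have "((\<lambda>t. f (t, y\<^sup>2)) has_derivative (\<lambda>k. k * A (x, y\<^sup>2) + 0 * B (x, y\<^sup>2))) (at x within {a..b})"
      by (rule has_derivative_along_curve[where X = "\<lambda>t. (t, y\<^sup>2)", OF f])
        (use x in \<open>auto intro!: derivative_eq_intros simp: S_def\<close>)
    then show "((\<lambda>t. f (t, y\<^sup>2)) has_vector_derivative A (x, y\<^sup>2)) (at x within {a..b})"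
      by (simp add: has_vector_derivative_def)
  qed
  have along_y: "((\<lambda>t. f (x, t\<^sup>2)) has_real_derivative 2 * y * B (x, y\<^sup>2)) (at y)"
    if x: "x \<in> {a..b}" and y: "y > 0"
      and f: "\<And>p. p \<in> S \<Longrightarrow> (f has_derivative (\<lambda>v. fst v * A p + snd v * B p)) (at p within S)" for f A B :: "real \<times> real \<Rightarrow> real" and x y
  proof -
    have "((\<lambda>t. f (x, t\<^sup>2)) has_derivative (\<lambda>k. 0 * A (x, y\<^sup>2) + (k * (2 * y)) * B (x, y\<^sup>2))) (at y)"
      by (rule has_derivative_along_curve[where X = "\<lambda>t. (x, t\<^sup>2)" and T = UNIV, OF f])
        (use x in \<open>auto intro!: derivative_eq_intros simp: S_def\<close>)
    then show ?thesis by (simp add: has_field_derivative_def mult_commute_abs mult_ac)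
  qed
  \<comment> \<open>The identities for \<open>M\<close> and its derivatives are available for
    restricted arguments; for a derivative at \<open>y > 0\<close> agreement on the open half-line
    is enough.\<close>
  have deriv_eq: "deriv h y = c" if "\<And>t. t > 0 \<Longrightarrow> h t = h' t" "(h' has_real_derivative c) (at y)" "y > 0" for h h' :: "real \<Rightarrow> real" and c y
  proof (rule DERIV_imp_deriv)
    show "(h has_real_derivative c) (at y)"
      by (rule has_field_derivative_transform_within_open[OF that(2), where S = "{0<..}"]) (use that in auto)
  qed
  have Dx: "Dx {a..b} M x y = Nx (x, y\<^sup>2)" if "x \<in> {a..b}" "y \<ge> 0" for x y
    unfolding Dx_def by (rule along_x[OF MN that(1) dN]) (use that in auto)
  have Dxx: "Dx {a..b} (Dx {a..b} M) x y = Nxx (x, y\<^sup>2)" if "x \<in> {a..b}" "y \<ge> 0" for x y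
    unfolding Dx_def[of "{a..b}" "Dx {a..b} M"] by (rule along_x[OF Dx that(1) dNx]) (use that in auto)
  have Dy: "Dy M x y = 2 * y * Ny (x, y\<^sup>2)" if "x \<in> {a..b}" "y > 0" for x y
    unfolding Dy_def by (rule deriv_eq[OF MN along_y[OF that dN]]) (use that in auto)
  have Dyx: "Dy (Dx {a..b} M) x y = 2 * y * Nxy (x, y\<^sup>2)" if "x \<in> {a..b}" "y > 0" for x y
    unfolding Dy_def by (rule deriv_eq[OF Dx along_y[OF that dNx]]) (use that in auto)
  have Dyy: "Dy (Dy M) x y = 2 * Ny (x, y\<^sup>2) + 4 * y\<^sup>2 * Nyy (x, y\<^sup>2)" if "x \<in> {a..b}" "y > 0" for x y
    unfolding Dy_def[of "Dy M"]
  proof (rule deriv_eq[OF Dy[OF that(1)]])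
    show "((\<lambda>t. 2 * t * Ny (x, t\<^sup>2)) has_real_derivative 2 * Ny (x, y\<^sup>2) + 4 * y\<^sup>2 * Nyy (x, y\<^sup>2)) (at y)"
      using DERIV_mult[OF DERIV_cmult_Id[of 2] along_y[OF that dNy]] by (simp add: power2_eq_square algebra_simps)
  qed (use that in auto)
  have "bellman a b N Nx Ny Nxx Nxy Nyx Nyy"
  proof (unfold_locales, fold S_def)
    fix x y p q assume x: "x \<in> {a..b}" and y: "(y::real) > 0"
    have "(M_matrix {a..b} M x y $ 1 $ 1) * p\<^sup>2 + (M_matrix {a..b} M x y $ 1 $ 2 + M_matrix {a..b} M x y $ 2 $ 1) * p * q + M_matrix {a..b} M x y $ 2 $ 2 * q\<^sup>2 \<le> 0"
      by (rule neg_semidef_2[OF neg[OF x y]])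
    then show "(Nxx (x, y\<^sup>2) + 2 * Ny (x, y\<^sup>2)) * p\<^sup>2 + 4 * y * Nxy (x, y\<^sup>2) * p * q
        + (2 * Ny (x, y\<^sup>2) + 4 * y\<^sup>2 * Nyy (x, y\<^sup>2)) * q\<^sup>2 \<le> 0"
      using y by (simp add: M_matrix_def vector_2 Dxx[OF x] Dy[OF x y] Dyx[OF x y] Dyy[OF x y])
  next
    show "continuous_on S Nxx" "continuous_on S Nxy" "continuous_on S Nyx" "continuous_on S Nyy"
      unfolding Nxx_def Nxy_def Nyx_def Nyy_def Nx_def Ny_def by (rule d3)+
  qed (use ab dN dNx dNy in auto)
  from that[OF this[unfolded N_def]] show ?thesis .
qed

text \<open>With a finite positive part, failure of integrability can only come from the negative
  part, and the difference is a finite number minus \<open>\<infinity>\<close>.\<close>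

lemma ext_integral_minus_infinity:
  assumes "f \<in> borel_measurable \<mu>" "\<not> integrable \<mu> f" "(\<integral>\<^sup>+x. ennreal (f x) \<partial>\<mu>) < \<infinity>"
  shows "ext_integral \<mu> f = - \<infinity>"
proof -
  have "(\<integral>\<^sup>+x. ennreal (- f x) \<partial>\<mu>) = \<infinity>"
    using assms unfolding real_integrable_def infinity_ennreal_def by (metis top.not_eq_extremum)
  moreover obtain p where "(\<integral>\<^sup>+x. ennreal (f x) \<partial>\<mu>) = ennreal p" "p \<ge> 0"
    using assms(3) by (metis ennreal_cases infinity_ennreal_def less_irrefl)
  ultimately show ?thesis by (simp add: ext_integral_def enn2ereal_ennreal)
qed

text \<open>\<open>N\<close> decreases in its second argument, so the integrand is at most the
  bounded function \<open>M (g x) 0\<close> and its positive part has a finite integral. Either the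
  integrand is integrable and \<open>integral_inequality\<close> applies, or its extended integral
  is minus infinity.\<close>

theorem corollary1:
  fixes M :: "real \<Rightarrow> real \<Rightarrow> real"
    and a b R :: real
    and U g :: "real^'n \<Rightarrow> real"
    and \<mu> :: "(real^'n) measure"
  assumes "a < b"
    and "C_k_on 2 ({a..b} \<times> {0..}) (\<lambda>(x, y). M x (sqrt y))"
    and "\<And>x y. x \<in> {a..b} \<Longrightarrow> y > 0 \<Longrightarrow> neg_semidef (M_matrix {a..b} M x y)"
    and "R > 0"
    and "\<mu> = density lborel (\<lambda>x. ennreal (exp (- U x)))"
    and "prob_space \<mu>"
    and "smooth U"
    and "\<And>x. pos_semidef (Hess U x - R *\<^sub>R mat 1)"
    and "smooth g"
    and "\<And>x. g x \<in> {a..b}"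
  shows "ext_integral \<mu> (\<lambda>x. M (g x) (norm (grad g x) / sqrt R)) \<le> ereal (M (\<integral>x. g x \<partial>\<mu>) 0)"
proof -
  let ?N = "\<lambda>(x, y). M x (sqrt y)"
  obtain Nx Ny Nxx Nxy Nyx Nyy where bell: "bellman a b ?N Nx Ny Nxx Nxy Nyx Nyy"
    by (rule C2_imp_bellman[OF assms(1-3)])
  note CU = smooth_imp_C2(1)[OF assms(7)] and Cg = smooth_imp_C2(1)[OF assms(9)]
  have [measurable]: "U \<in> borel_measurable borel" by (rule borel_measurable_continuous_onI[OF C2_funD(4)[OF CU]])
  interpret P: bellman_log_concave a b ?N Nx Ny Nxx Nxy Nyx Nyy "{a..b} \<times> {0..}" U "grad U" "grad_deriv U" R
  proof (intro bellman_log_concave.intro bell log_concave.intro convex_potential.intro log_concave_axioms.intro)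
    have "(\<integral>\<^sup>+x. ennreal (exp (- U x)) \<partial>lborel) = 1"
      using prob_space.emeasure_space_1[OF assms(6)] by (simp add: assms(5) emeasure_density)
    then have "(\<integral>\<^sup>+x. ennreal (exp (- U x)) \<partial>lborel) = ennreal 1" by simp
    then have "has_bochner_integral lborel (\<lambda>x. exp (- U x)) 1"
      by (intro has_bochner_integral_nn_integral) auto
    then show "(\<integral>x. exp (- U x) \<partial>lborel) = 1" by (rule has_bochner_integral_integral_eq)
    fix x v
    have "0 \<le> v \<bullet> ((Hess U x - R *\<^sub>R mat 1) *v v)" using assms(8) by (simp add: pos_semidef_def)
    then show "R * (v \<bullet> v) \<le> grad_deriv U x v \<bullet> v"
      unfolding grad_deriv_eq_Hess[OF assms(7)]
      by (simp add: matrix_vector_mult_diff_rdistrib scaleR_matrix_vector_assoc[symmetric] inner_diff_right)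
  qed (use assms(4) C2_funD[OF CU] in auto)
  have \<mu>: "\<mu> = P.\<mu>" by (simp add: assms(5) P.\<mu>_def P.\<rho>_def[abs_def])
  let ?\<Psi> = "\<lambda>x. M (g x) (norm (grad g x) / sqrt R)"
  have \<Psi>: "?\<Psi> = (\<lambda>x. ?N (g x, (norm (grad g x))\<^sup>2 / R))"
    by (simp add: real_sqrt_divide)
  show ?thesis
  proof (cases "integrable \<mu> ?\<Psi>")
    case True
    then have "(\<integral>x. ?\<Psi> x \<partial>\<mu>) \<le> M (\<integral>x. g x \<partial>\<mu>) 0"
      using P.integral_inequality[OF Cg assms(10)] unfolding \<mu> \<Psi> by simp
    then show ?thesis using ext_integral_eq_integral[OF True] by simp
  next
    case False
    obtain B where B: "\<And>p. p \<in> {a..b} \<times> {0..0} \<Longrightarrow> \<bar>?N p\<bar> \<le> B" using P.N_bounded by blast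
    have "?\<Psi> x \<le> B" for x
    proof -
      have "?N (g x, (norm (grad g x))\<^sup>2 / R) \<le> ?N (g x, 0)"
        by (rule P.N_antimono[OF assms(10)]) (use assms(4) in auto)
      then show ?thesis using B[of "(g x, 0)"] assms(10)[of x] by (auto simp: abs_le_iff real_sqrt_divide)
    qed
    then have "(\<integral>\<^sup>+x. ennreal (?\<Psi> x) \<partial>\<mu>) \<le> (\<integral>\<^sup>+x. ennreal B \<partial>\<mu>)"
      by (intro nn_integral_mono ennreal_leI)
    also have "\<dots> < \<infinity>" using prob_space.emeasure_space_1[OF assms(6)] by simp
    finally have fin: "(\<integral>\<^sup>+x. ennreal (?\<Psi> x) \<partial>\<mu>) < \<infinity>" .
    have "?\<Psi> \<in> borel_measurable borel"
      unfolding \<Psi> by (intro borel_measurable_continuous_onI P.continuous_on_N_compose continuous_intros C2_funD(4,5)[OF Cg] assms(10))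
        (use assms(4) in auto)
    then have "?\<Psi> \<in> borel_measurable \<mu>" by (simp add: assms(5))
    from ext_integral_minus_infinity[OF this False fin] show ?thesis by simp
  qed
qed

end
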